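(* Let $P$ and $Q$ be Borel probability measures on $\mathbb{R}^d$. Let $X_1,X_2,\ldots$ be i.i.d. random variables with law $P$ and $Y_1,Y_2,\ldots$ i.i.d. random variables with law $Q$, independent of the $X_i$'s. Let $P_n$ be the empirical measure on $X_1,\ldots,X_n$ and $Q_m$ the empirical measure on $Y_1,\ldots,Y_m$. (i) If $P$ and $Q$ have densities with respect to Lebesgue measure and finite fourth moments, then for all $n,m\ge 1$ $$\mathrm{Var}\big(\mathcal{W}_2^2(P_n,Q_m)\big)\le\frac{C(P,Q)}{n}+\frac{C(Q,P)}{m},$$ where $$C(P,Q)=8\Big(E\big(\|X_1-X_2\|^2\|X_1\|^2\big)+\big(E\|X_1-X_2\|^4\big)^{1/2}\Big(\int_{\mathbb{R}^d}\|y\|^4\,dQ(y)\Big)^{1/2}\Big),$$ $$C(Q,P)=8\Big(E\big(\|Y_1-Y_2\|^2\|Y_1\|^2\big)+\big(E\|Y_1-Y_2\|^4\big)^{1/2}\Big(\int_{\mathbb{R}^d}\|x\|^4\,dP(x)\Big)^{1/2}\Big).$$ (ii) Suppose that $P$ and $Q$ each have a positive density in the interior of their convex support and finite moments of order $4+\delta$ for some $\delta>0$. Let $\varphi_0$ be the optimal transportation potential from $P$ to $Q$, let $\psi_0=\varphi_0^*$, and set $$R_{n,m}=\mathcal{W}_2^2(P_n,Q_m)-\int_{\mathbb{R}^d}\big(\|x\|^2-2\varphi_0(x)\big)\,dP_n(x)-\int_{\mathbb{R}^d}\big(\|y\|^2-2\psi_0(y)\big)\,dQ_m(y).$$ If $n\to\infty$,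 $m\to\infty$ and $\frac{n}{n+m}\to\lambda\in(0,1)$, then $$\frac{nm}{n+m}\,\mathrm{Var}(R_{n,m})\to 0.$$
   Context: $\mathcal{W}_2^2(P,Q)$ is the minimum of $\int\|x-y\|^2\,d\pi(x,y)$ over Borel probabilities $\pi$ on $\mathbb{R}^d\times\mathbb{R}^d$ with marginals $P$ and $Q$. Empirical measures are $P_n=\frac1n\sum_{i=1}^n\delta_{X_i}$, $Q_m=\frac1m\sum_{j=1}^m\delta_{Y_j}$. Convex functions on $\mathbb{R}^d$ take values in $(-\infty,+\infty]$, and $h^*(x)=\sup_{y}(x\cdot y-h(y))$ is the convex conjugate of $h$. Let $\Phi$ be the set of pairs $(\varphi,\psi)\in L_1(P)\times L_1(Q)$ with $\varphi(x)+\psi(y)\ge x\cdot y$ for all $x,y\in\mathbb{R}^d$, and $J(\varphi,\psi)=\int\varphi\,dP+\int\psi\,dQ$. An optimal transportation potential from $P$ to $Q$ is a proper, lower semicontinuous, convex function $\varphi_0$ such that $(\varphi_0,\varphi_0^* )\in\Phi$ minimizes $J$ over $\Phi$; under the assumptions of (ii) it is $P$-a.s. unique up to an additive constant, and then $\psi_0=\varphi_0^*$ is an optimal transportation potential from $Q$ to $P$. "$Q$ has a positive density in the interior of its convex support" means that $Q$ is absolutely continuous with respect to Lebesgue measure, with a density that is strictly positive on the interior of the convex support of $Q$ (the smallest closed convex set of full $Q$-measure); likewise for $P$. *)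

theory Defs
  imports "HOL-Probability.Probability"
begin

definition couplings :: "'a::euclidean_space measure \<Rightarrow> 'a measure \<Rightarrow> ('a \<times> 'a) measure set" where
  "couplings P Q = {\<pi>. prob_space \<pi> \<and> sets \<pi> = sets borel \<and>
     distr \<pi> borel fst = P \<and> distr \<pi> borel snd = Q}"

text \<open>
  The infimum over all couplings is taken in the extended nonnegative reals; it is attained
  whenever \<^term>\<open>P\<close> and \<^term>\<open>Q\<close> are Borel probabilities, so it is the minimal transport cost.
  For empirical measures it is finite.
\<close>

definition wasserstein2_sq :: "'a::euclidean_space measure \<Rightarrow> 'a measure \<Rightarrow> ennreal" where
  "wasserstein2_sq P Q =
     (INF \<pi>\<in>couplings P Q. \<integral>\<^sup>+z. ennreal ((norm (fst z - snd z))\<^sup>2) \<partial>\<pi>)"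

text \<open>
  The sample \<open>x\<close> is indexed from 0, so the empirical measure of size \<open>n\<close> uses
  \<open>x 0, \<dots>, x (n - 1)\<close>; the lemma below gives its values.
\<close>

definition empirical_measure :: "nat \<Rightarrow> (nat \<Rightarrow> 'a::euclidean_space) \<Rightarrow> 'a measure" where
  "empirical_measure n x = distr (uniform_count_measure {..<n}) borel x"

lemma emeasure_empirical_measure:
  assumes "n \<ge> 1" "A \<in> sets borel"
  shows "emeasure (empirical_measure n x) A = ennreal (1 / real n * (\<Sum>i<n. indicator A (x i)))"
proof -
  have eq: "x -` A \<inter> {..<n} = {i\<in>{..<n}. x i \<in> A}" by auto
  have card: "real (card {i\<in>{..<n}. x i \<in> A}) = (\<Sum>i<n. indicator A (x i))"
    by (simp add: indicator_def sum.If_cases Int_def)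
  have "emeasure (empirical_measure n x) A
      = emeasure (uniform_count_measure {..<n}) (x -` A \<inter> {..<n})"
    unfolding empirical_measure_def using assms(2)
    by (subst emeasure_distr) (auto simp: space_uniform_count_measure)
  also have "\<dots> = ennreal (real (card {i\<in>{..<n}. x i \<in> A}) / real n)"
    unfolding eq by (subst emeasure_uniform_count_measure) auto
  finally show ?thesis unfolding card by simp
qed

text \<open>
  Extended-valued functions: values outside the real line are allowed on null sets only, and the
  integral is that of the real parts.
\<close>

definition L1_ereal :: "'a measure \<Rightarrow> ('a \<Rightarrow> ereal) set" where
  "L1_ereal P = {f \<in> borel_measurable P.
     (AE x in P. \<bar>f x\<bar> \<noteq> \<infinity>) \<and> integrable P (\<lambda>x. real_of_ereal (f x))}"

definition proper_fun :: "('a \<Rightarrow> ereal) \<Rightarrow> bool" where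
  "proper_fun f \<longleftrightarrow> (\<forall>x. f x \<noteq> -\<infinity>) \<and> (\<exists>x. f x \<noteq> \<infinity>)"

definition lsc_fun :: "('a::topological_space \<Rightarrow> ereal) \<Rightarrow> bool" where
  "lsc_fun f \<longleftrightarrow> (\<forall>x. f x \<le> Liminf (at x) f)"

text \<open>Used for functions that do not take the value \<open>-\<infinity>\<close>.\<close>

definition convex_fun :: "('a::real_vector \<Rightarrow> ereal) \<Rightarrow> bool" where
  "convex_fun f \<longleftrightarrow> (\<forall>x y. \<forall>t\<in>{0<..<1::real}.
     f ((1 - t) *\<^sub>R x + t *\<^sub>R y) \<le> ereal (1 - t) * f x + ereal t * f y)"

definition conjugate :: "('a::euclidean_space \<Rightarrow> ereal) \<Rightarrow> 'a \<Rightarrow> ereal" where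
  "conjugate h x = (SUP y. ereal (x \<bullet> y) - h y)"

text \<open>
  In \<^typ>\<open>ereal\<close> one has \<open>\<infinity> + (-\<infinity>) = \<infinity>\<close>. This does no harm below: if \<open>\<psi> y = -\<infinity>\<close> for
  some \<open>y\<close>, the inequality forces \<open>\<phi> = \<infinity>\<close> everywhere, contradicting integrability.
\<close>

definition dual_pairs ::
    "'a::euclidean_space measure \<Rightarrow> 'a measure \<Rightarrow> (('a \<Rightarrow> ereal) \<times> ('a \<Rightarrow> ereal)) set" where
  "dual_pairs P Q = {(\<phi>, \<psi>). \<phi> \<in> L1_ereal P \<and> \<psi> \<in> L1_ereal Q \<and>
     (\<forall>x y. \<phi> x + \<psi> y \<ge> ereal (x \<bullet> y))}"

definition dual_cost ::
    "'a measure \<Rightarrow> 'a measure \<Rightarrow> ('a \<Rightarrow> ereal) \<Rightarrow> ('a \<Rightarrow> ereal) \<Rightarrow> real" where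
  "dual_cost P Q \<phi> \<psi> = (\<integral>x. real_of_ereal (\<phi> x) \<partial>P) + (\<integral>y. real_of_ereal (\<psi> y) \<partial>Q)"

definition ot_potential ::
    "'a::euclidean_space measure \<Rightarrow> 'a measure \<Rightarrow> ('a \<Rightarrow> ereal) \<Rightarrow> bool" where
  "ot_potential P Q \<phi>0 \<longleftrightarrow>
     proper_fun \<phi>0 \<and> lsc_fun \<phi>0 \<and> convex_fun \<phi>0 \<and>
     (\<phi>0, conjugate \<phi>0) \<in> dual_pairs P Q \<and>
     (\<forall>(\<phi>, \<psi>)\<in>dual_pairs P Q. dual_cost P Q \<phi>0 (conjugate \<phi>0) \<le> dual_cost P Q \<phi> \<psi>)"

definition convex_support :: "'a::euclidean_space measure \<Rightarrow> 'a set" where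
  "convex_support P = \<Inter>{C. closed C \<and> convex C \<and> emeasure P C = 1}"

definition has_lebesgue_density :: "'a::euclidean_space measure \<Rightarrow> bool" where
  "has_lebesgue_density P \<longleftrightarrow> (\<exists>f\<in>borel_measurable borel. P = density lborel f)"

definition positive_density_in_interior :: "'a::euclidean_space measure \<Rightarrow> bool" where
  "positive_density_in_interior P \<longleftrightarrow>
     (\<exists>f\<in>borel_measurable borel. P = density lborel f \<and>
        (\<forall>x\<in>interior (convex_support P). f x > 0))"

text \<open>
  The Bochner integral is 0 for non-integrable functions, so a statement about a variance is
  meaningful only together with the following property.
\<close>

definition square_integrable :: "'w measure \<Rightarrow> ('w \<Rightarrow> real) \<Rightarrow> bool" where
  "square_integrable M Z \<longleftrightarrow> Z \<in> borel_measurable M \<and> integrable M (\<lambda>\<omega>. (Z \<omega>)\<^sup>2)"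

definition empirical_W ::
    "nat \<Rightarrow> nat \<Rightarrow> (nat \<Rightarrow> 'a::euclidean_space) \<Rightarrow> (nat \<Rightarrow> 'a) \<Rightarrow> real" where
  "empirical_W n m x y = enn2real (wasserstein2_sq (empirical_measure n x) (empirical_measure m y))"

definition ot_remainder :: "('a \<Rightarrow> ereal) \<Rightarrow>
    nat \<Rightarrow> nat \<Rightarrow> (nat \<Rightarrow> 'a::euclidean_space) \<Rightarrow> (nat \<Rightarrow> 'a) \<Rightarrow> real" where
  "ot_remainder \<phi>0 n m x y = empirical_W n m x y
     - (\<integral>z. (norm z)\<^sup>2 - 2 * real_of_ereal (\<phi>0 z) \<partial>empirical_measure n x)
     - (\<integral>z. (norm z)\<^sup>2 - 2 * real_of_ereal (conjugate \<phi>0 z) \<partial>empirical_measure m y)"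

end

theory Submission
  imports Defs "HOL-Combinatorics.Cycles"
begin

text \<open>
  Expanding the square gives \<open>W = avg \<bar>x\<bar>\<^sup>2 + avg \<bar>y\<bar>\<^sup>2 - 2 S\<close>, where \<open>S\<close> is the value of a finite linear
  programme (maximal correlation). An optimal plan for the sample stays admissible when one point is
  resampled, and even when the barycentres \<open>z\<^sub>i\<close> of its rows are permuted; hence all increments
  under resampling are bounded through one and the same plan, and the Efron--Stein inequality applies.
  Part (i) follows with the identity permutation from \<open>\<Sum> \<bar>z\<^sub>i\<bar>\<^sup>4 / n \<le> \<Sum> \<bar>y\<^sub>j\<bar>\<^sup>4 / m\<close>.

  For part (ii), the remainder is twice the duality gap \<open>avg \<phi> + avg \<psi> - S \<ge> 0\<close> of the population potentials
  on the sample. Quantizing the sample turns the dual solution of a finite problem into a competitor of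
  the population potentials, so the expected gap tends to 0. Therefore \<open>z\<^sub>i\<close> is, for most \<open>i\<close>, an approximate
  subgradient of \<open>\<phi>\<close> at \<open>x\<^sub>i\<close>. Since the sample points fill the support, the barycentres may be shifted
  along a chain of sample points leading from \<open>x\<^sub>i\<close> to its replacement \<open>t\<close>; this gains \<open>\<phi> t - \<phi> x\<^sub>i\<close> up to a
  small error, so that the increment of the gap is \<open>o(1/n)\<close>. The exceptional indices are controlled by uniform
  integrability of the fourth moments.
\<close>

section \<open>Assignment and transport problems\<close>

text \<open>An old plan is only admissible for the new sample, so the transport value is bounded
  from below and every increment from above only. Hence Efron--Stein is set up with positive parts:
  for two independent copies, the mean of \<open>(max 0 (f y - f x))\<^sup>2\<close> is already the
  full variance.

  An optimal plan is neither unique nor selected measurably. Every estimate that mentions it is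
  therefore pointwise in the sample, and the plan is eliminated before an expectation is taken: the
  slacks of the indices sum to \<open>n\<close> times the gap, and the fourth powers of the
  barycentres are dominated on average by those of the second sample.

  Keeping the barycentres in place bounds \<open>n\<close> times the increment of the gap by
  \<open>f t - f (x i) - (t - x i) \<bullet> z i\<close>. This is a linearization error over a long
  distance and need not be small, however small the gap is. Routing through intermediate sample
  points removes it. The price is that chains have to be fixed before the sample is drawn, and that
  finitely many of them must serve nearly all pairs of an old and a new point.\<close>

fun path_weight :: "('i \<Rightarrow> 'i \<Rightarrow> real) \<Rightarrow> 'i list \<Rightarrow> real" where
  "path_weight d (a # b # xs) = d a b + path_weight d (b # xs)"
| "path_weight d _ = 0"

lemma path_weight_append:
  "path_weight d (xs @ k # ys) = path_weight d (xs @ [k]) + path_weight d (k # ys)"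
proof (induction xs)
  case Nil
  then show ?case by simp
next
  case (Cons a xs)
  then show ?case by (cases xs) auto
qed

lemma path_weight_snoc: "path_weight d (xs @ [a, b]) = path_weight d (xs @ [a]) + d a b"
  using path_weight_append[of d xs a "[b]"] by simp

text \<open>\<open>cycle_of_list\<close> sends each entry of the list to the next one, so pairing
  the list with its rotation runs through the edges of the closed walk. Both the duality theorem and
  the shift of barycentres evaluate a cyclic competitor through this identity.\<close>

lemma sum_cycle:
  assumes "distinct (x # xs)"
  shows "(\<Sum>i\<in>set (x # xs). d i (cycle_of_list (x # xs) i)) = path_weight d (x # xs @ [x])"
proof -
  have aux: "sum_list (map2 d (a # as) (as @ [b])) = path_weight d (a # as @ [b])" for a b as
    by (induction as arbitrary: a) auto
  have rot: "map (cycle_of_list (x # xs)) (x # xs) = xs @ [x]"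
    using cyclic_rotation[OF assms, of 1] by simp
  have "(\<Sum>i\<in>set (x # xs). d i (cycle_of_list (x # xs) i))
      = sum_list (map (\<lambda>i. d i (cycle_of_list (x # xs) i)) (x # xs))"
    using sum_list_distinct_conv_sum_set[OF assms, of "\<lambda>i. d i (cycle_of_list (x # xs) i)"] by presburger
  also have "\<dots> = sum_list (map2 d (x # xs) (map (cycle_of_list (x # xs)) (x # xs)))"
    by (simp add: zip_map2 zip_same_conv_map split_def comp_def)
  finally show ?thesis unfolding rot aux .
qed

text \<open>The potentials are longest-path lengths for the weights
  \<open>d i k = c k (\<sigma> i) - c i (\<sigma> i)\<close>; optimality of \<open>\<sigma>\<close> excludes cycles of positive weight.\<close>

lemma assignment_duality:
  fixes c :: "'i \<Rightarrow> 'i \<Rightarrow> real"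
  assumes fin: "finite I" and \<sigma>: "\<sigma> permutes I"
    and opt: "\<And>\<tau>. \<tau> permutes I \<Longrightarrow> (\<Sum>i\<in>I. c i (\<tau> i)) \<le> (\<Sum>i\<in>I. c i (\<sigma> i))"
  obtains u v where "\<And>i j. i \<in> I \<Longrightarrow> j \<in> I \<Longrightarrow> c i j \<le> u i + v j"
    and "\<And>i. i \<in> I \<Longrightarrow> u i + v (\<sigma> i) = c i (\<sigma> i)"
proof -
  define d where "d i k = c k (\<sigma> i) - c i (\<sigma> i)" for i k
  \<comment> \<open>The competitor is \<open>\<sigma> \<circ> inv ?p\<close>, which passes the
    assigned columns along the cycle; its gain over \<open>\<sigma>\<close> is exactly the weight of
    the closed walk.\<close>
  have cyc: "path_weight d (x # xs @ [x]) \<le> 0" if dist: "distinct (x # xs)" and sub: "set (x # xs) \<subseteq> I" for x xs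
  proof -
    let ?p = "cycle_of_list (x # xs)"
    have p: "?p permutes I" using permutes_subset[OF cycle_permutes sub] .
    have out: "?p i = i" if "i \<notin> set (x # xs)" for i
      using cycle_permutes that by (metis permutes_def)
    have "path_weight d (x # xs @ [x]) = (\<Sum>i\<in>set (x # xs). d i (?p i))"
      using sum_cycle[OF dist] by simp
    also have "\<dots> = (\<Sum>i\<in>I. d i (?p i))"
      by (rule sum.mono_neutral_left[OF fin sub]) (auto simp: out d_def)
    also have "\<dots> = (\<Sum>i\<in>I. c (?p i) (\<sigma> i)) - (\<Sum>i\<in>I. c i (\<sigma> i))"
      by (simp add: d_def sum_subtractf)
    also have "(\<Sum>i\<in>I. c (?p i) (\<sigma> i)) = (\<Sum>i\<in>I. c i ((\<sigma> \<circ> inv ?p) i))"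
      by (subst sum.permute[OF permutes_inv[OF p]]) (simp add: comp_def permutes_inverses[OF p])
    also have "\<dots> \<le> (\<Sum>i\<in>I. c i (\<sigma> i))"
      by (rule opt) (intro permutes_compose permutes_inv p \<sigma>)
    finally show ?thesis by simp
  qed
  define W where "W k = {path_weight d (xs @ [k]) |xs. distinct (xs @ [k]) \<and> set xs \<subseteq> I}" for k
  define u where "u k = Max (W k)" for k
  have finW: "finite (W k)" for k
  proof -
    have "W k \<subseteq> (\<lambda>xs. path_weight d (xs @ [k])) ` {xs. set xs \<subseteq> I \<and> distinct xs}"
      by (auto simp: W_def)
    then show ?thesis
      using finite_subset finite_subset_distinct[OF fin] by blast
  qed
  have step: "u i + d i k \<le> u k" if i: "i \<in> I" and k: "k \<in> I" for i k
  proof -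
    have "path_weight d ([] @ [i]) \<in> W i"
      unfolding W_def by (intro CollectI exI[of _ "[]"]) simp
    then have "u i \<in> W i" unfolding u_def using Max_in[OF finW] by blast
    then obtain xs where xs: "u i = path_weight d (xs @ [i])" "distinct (xs @ [i])" "set xs \<subseteq> I"
      by (auto simp: W_def)
    show ?thesis
    proof (cases "k \<in> set (xs @ [i])")
      case False
      then have "path_weight d ((xs @ [i]) @ [k]) \<in> W k"
        unfolding W_def using xs i by fastforce
      then have "path_weight d ((xs @ [i]) @ [k]) \<le> u k" unfolding u_def by (rule Max_ge[OF finW])
      then show ?thesis using path_weight_snoc[of d xs i k] xs(1) by simp
    next
      \<comment> \<open>The extended path closes a loop \<open>k # p2 @ [k]\<close>. Its weight is
        at most 0, so cutting it off leaves the simple path \<open>p1 @ [k]\<close>, which is no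
        lighter.\<close>
      case True
      then obtain p1 p2 where sp: "xs @ [i] = p1 @ k # p2" by (meson split_list)
      have "path_weight d (p1 @ [k]) \<in> W k"
      proof -
        have "distinct (p1 @ k # p2)" "set (p1 @ k # p2) \<subseteq> I" using xs(2,3) i by (simp_all flip: sp)
        then show ?thesis unfolding W_def by (intro CollectI exI[of _ p1]) auto
      qed
      then have le: "path_weight d (p1 @ [k]) \<le> u k" unfolding u_def by (rule Max_ge[OF finW])
      have last: "k # p2 = butlast (k # p2) @ [i]"
        by (metis append_butlast_last_id last_appendR last_snoc list.distinct(1) sp)
      have "path_weight d (k # p2 @ [k]) = path_weight d (k # p2) + d i k"
        using path_weight_snoc[of d "butlast (k # p2)" i k] last
        by (metis append.assoc append_Cons append_Nil)
      moreover have "path_weight d (k # p2 @ [k]) \<le> 0"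
      proof (rule cyc)
        show "distinct (k # p2)" using xs(2) unfolding sp by simp
        have "set (xs @ [i]) \<subseteq> I" using xs(3) i by simp
        then show "set (k # p2) \<subseteq> I" unfolding sp by simp
      qed
      moreover have "u i = path_weight d (p1 @ [k]) + path_weight d (k # p2)"
        using path_weight_append[of d p1 k p2] xs(1) sp by simp
      ultimately show ?thesis using le by simp
    qed
  qed
  \<comment> \<open>\<open>v\<close> is forced by equality along \<open>\<sigma>\<close>; with it,
    the inequality for \<open>(i, j)\<close> is the edge inequality \<open>step\<close> from
    \<open>inv \<sigma> j\<close> to \<open>i\<close>.\<close>
  define v where "v j = c (inv \<sigma> j) j - u (inv \<sigma> j)" for j
  show thesis
  proof
    show "c i j \<le> u i + v j" if "i \<in> I" "j \<in> I" for i j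
      using step[of "inv \<sigma> j" i] that permutes_in_image[OF permutes_inv[OF \<sigma>]]
      by (simp add: d_def v_def permutes_inverses[OF \<sigma>])
    show "u i + v (\<sigma> i) = c i (\<sigma> i)" for i
      by (simp add: v_def permutes_inverses[OF \<sigma>])
  qed
qed

definition plan :: "nat \<Rightarrow> nat \<Rightarrow> (nat \<Rightarrow> nat \<Rightarrow> real) \<Rightarrow> bool" where
  "plan n m a \<longleftrightarrow> (\<forall>i<n. \<forall>j<m. 0 \<le> a i j) \<and>
     (\<forall>i<n. (\<Sum>j<m. a i j) = 1 / real n) \<and> (\<forall>j<m. (\<Sum>i<n. a i j) = 1 / real m)"

text \<open>Repeating each of the \<open>n\<close> rows \<open>m\<close> times and each of the \<open>m\<close> columns \<open>n\<close> times turns the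
  transport problem with uniform marginals into an assignment problem on \<open>n * m\<close> points.\<close>

definition transport_value :: "nat \<Rightarrow> nat \<Rightarrow> (nat \<Rightarrow> nat \<Rightarrow> real) \<Rightarrow> real" where
  "transport_value n m c = Max ((\<lambda>\<sigma>. (\<Sum>r\<in>{..<n} \<times> {..<m}. c (fst r) (snd (\<sigma> r))) / (real n * real m)) `
     {\<sigma>. \<sigma> permutes {..<n} \<times> {..<m}})"

text \<open>Apart from duality this is the device for averaging a pointwise inequality over a plan:
  any bound whose right-hand side splits into a function of the row and one of the column passes to
  the marginals.\<close>

lemma plan_weak_duality:
  assumes "plan n m a" and "\<And>i j. i < n \<Longrightarrow> j < m \<Longrightarrow> c i j \<le> u i + v j"
  shows "(\<Sum>i<n. \<Sum>j<m. a i j * c i j) \<le> (\<Sum>i<n. u i) / real n + (\<Sum>j<m. v j) / real m"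
proof -
  have "(\<Sum>i<n. \<Sum>j<m. a i j * c i j) \<le> (\<Sum>i<n. \<Sum>j<m. a i j * (u i + v j))"
    using assms by (intro sum_mono mult_left_mono) (auto simp: plan_def)
  also have "\<dots> = (\<Sum>i<n. \<Sum>j<m. a i j * u i) + (\<Sum>i<n. \<Sum>j<m. a i j * v j)"
    by (simp add: distrib_left sum.distrib)
  also have "(\<Sum>i<n. \<Sum>j<m. a i j * u i) = (\<Sum>i<n. (\<Sum>j<m. a i j) * u i)"
    by (simp add: sum_distrib_right)
  also have "\<dots> = (\<Sum>i<n. u i) / real n"
    using assms(1) by (simp add: plan_def sum_divide_distrib)
  also have "(\<Sum>i<n. \<Sum>j<m. a i j * v j) = (\<Sum>j<m. (\<Sum>i<n. a i j) * v j)"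
    by (subst sum.swap) (simp add: sum_distrib_right)
  also have "\<dots> = (\<Sum>j<m. v j) / real m"
    using assms(1) by (simp add: plan_def sum_divide_distrib)
  finally show ?thesis .
qed

text \<open>One optimal permutation of the copies yields all certificates: counting how often copies
  of row \<open>i\<close> meet copies of column \<open>j\<close> gives the plan, and averaging the
  assignment potentials over the copies gives \<open>u\<close> and \<open>v\<close>. The permutation
  itself is kept because a coupling of the empirical measures is built from it.\<close>

lemma transport_duality:
  assumes n: "n \<ge> 1" and m: "m \<ge> 1"
  obtains \<sigma> a u v where "\<sigma> permutes {..<n} \<times> {..<m}"
    and "transport_value n m c = (\<Sum>r\<in>{..<n} \<times> {..<m}. c (fst r) (snd (\<sigma> r))) / (real n * real m)"
    and "plan n m a" and "transport_value n m c = (\<Sum>i<n. \<Sum>j<m. a i j * c i j)"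
    and "\<And>i j. i < n \<Longrightarrow> j < m \<Longrightarrow> c i j \<le> u i + v j"
    and "transport_value n m c = (\<Sum>i<n. u i) / real n + (\<Sum>j<m. v j) / real m"
proof -
  let ?I = "{..<n} \<times> {..<m}"
  let ?val = "\<lambda>\<sigma>. (\<Sum>r\<in>?I. c (fst r) (snd (\<sigma> r))) / (real n * real m)"
  have fin: "finite (?val ` {\<sigma>. \<sigma> permutes ?I})"
    by (intro finite_imageI finite_permutations) auto
  have "?val id \<in> ?val ` {\<sigma>. \<sigma> permutes ?I}" by (intro imageI CollectI permutes_id)
  then have "transport_value n m c \<in> ?val ` {\<sigma>. \<sigma> permutes ?I}"
    unfolding transport_value_def by (intro Max_in[OF fin]) blast
  then obtain \<sigma> where \<sigma>: "\<sigma> permutes ?I" and val: "transport_value n m c = ?val \<sigma>" by blast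
  have nm: "real n * real m > 0" using n m by simp
  have opt: "(\<Sum>r\<in>?I. c (fst r) (snd (\<tau> r))) \<le> (\<Sum>r\<in>?I. c (fst r) (snd (\<sigma> r)))" if "\<tau> permutes ?I" for \<tau>
  proof -
    have "?val \<tau> \<le> ?val \<sigma>"
      unfolding val[symmetric] unfolding transport_value_def using that by (intro Max_ge[OF fin]) blast
    then show ?thesis using nm by (simp add: divide_le_cancel)
  qed
  obtain u0 v0 where uv: "\<And>r s. r \<in> ?I \<Longrightarrow> s \<in> ?I \<Longrightarrow> c (fst r) (snd s) \<le> u0 r + v0 s"
    and uv_eq: "\<And>r. r \<in> ?I \<Longrightarrow> u0 r + v0 (\<sigma> r) = c (fst r) (snd (\<sigma> r))"
    using assignment_duality[of ?I \<sigma> "\<lambda>r s. c (fst r) (snd s)"] \<sigma> opt by auto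
  define a where "a i j = real (card {r\<in>?I. fst r = i \<and> snd (\<sigma> r) = j}) / (real n * real m)" for i j
  define u where "u i = (\<Sum>j<m. u0 (i, j)) / real m" for i
  define v where "v j = (\<Sum>i<n. v0 (i, j)) / real n" for j
  have a_alt: "a i j = (\<Sum>r\<in>?I. if fst r = i \<and> snd (\<sigma> r) = j then 1 else 0) / (real n * real m)" for i j
    by (simp add: a_def sum.If_cases Int_def)
  have img: "snd (\<sigma> r) < m" "fst r < n" if "r \<in> ?I" for r
    using permutes_in_image[OF \<sigma>, of r] that by auto
  \<comment> \<open>A general test function \<open>h\<close> is carried along because three
    instances are needed: the constant 1 for the row marginals, an indicator for the column
    marginals, and \<open>c i\<close> for the value.\<close>
  have rowsum: "(\<Sum>j<m. a i j * h j) = (\<Sum>k<m. h (snd (\<sigma> (i, k)))) / (real n * real m)" if "i < n" for i h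
  proof -
    have "(\<Sum>j<m. a i j * h j)
        = (\<Sum>j<m. \<Sum>r\<in>?I. if fst r = i \<and> snd (\<sigma> r) = j then h j else 0) / (real n * real m)"
      unfolding a_alt sum_divide_distrib sum_distrib_right by (intro sum.cong refl) auto
    also have "(\<Sum>j<m. \<Sum>r\<in>?I. if fst r = i \<and> snd (\<sigma> r) = j then h j else 0)
        = (\<Sum>r\<in>?I. \<Sum>j<m. if j = snd (\<sigma> r) then (if fst r = i then h (snd (\<sigma> r)) else 0) else 0)"
      by (subst sum.swap) (intro sum.cong refl, auto)
    also have "\<dots> = (\<Sum>r\<in>?I. if fst r = i then h (snd (\<sigma> r)) else 0)"
      using img by (intro sum.cong refl) (subst sum.delta, auto)
    also have "\<dots> = (\<Sum>i'<n. \<Sum>k<m. if i' = i then h (snd (\<sigma> (i', k))) else 0)"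
      by (simp only: sum.cartesian_product split_def prod.collapse)
    also have "\<dots> = (\<Sum>i'<n. if i' = i then (\<Sum>k<m. h (snd (\<sigma> (i', k)))) else 0)"
      by (intro sum.cong refl) auto
    also have "\<dots> = (\<Sum>k<m. h (snd (\<sigma> (i, k))))" using that by (subst sum.delta) auto
    finally show ?thesis .
  qed
  have "plan n m a"
    unfolding plan_def
  proof (intro conjI allI impI)
    show "0 \<le> a i j" for i j by (simp add: a_def)
    show "(\<Sum>j<m. a i j) = 1 / real n" if "i < n" for i
      using rowsum[OF that, of "\<lambda>_. 1"] m by simp
    show "(\<Sum>i<n. a i j) = 1 / real m" if j: "j < m" for j
    proof -
      have "(\<Sum>i<n. a i j) = (\<Sum>i<n. \<Sum>j'<m. a i j' * (if j' = j then 1 else 0))"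
        using j by (intro sum.cong refl) (simp add: if_distrib cong: if_cong)
      also have "\<dots> = (\<Sum>i<n. (\<Sum>k<m. if snd (\<sigma> (i, k)) = j then 1 else 0) / (real n * real m))"
        by (intro sum.cong refl) (simp add: rowsum)
      also have "\<dots> = (\<Sum>r\<in>?I. if snd (\<sigma> r) = j then 1 else 0) / (real n * real m)"
        by (simp add: sum.cartesian_product split_def sum_divide_distrib)
      also have "(\<Sum>r\<in>?I. if snd (\<sigma> r) = j then 1 else (0::real)) = (\<Sum>r\<in>?I. if snd r = j then 1 else 0)"
        using sum.permute[OF \<sigma>, of "\<lambda>r. if snd r = j then 1 else (0::real)"] by (simp add: comp_def)
      also have "\<dots> = (\<Sum>i<n. \<Sum>k<m. if k = j then 1 else 0)"
        by (simp only: sum.cartesian_product split_def)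
      also have "\<dots> = real n" using j by simp
      finally show ?thesis using n by simp
    qed
  qed
  moreover have "transport_value n m c = (\<Sum>i<n. \<Sum>j<m. a i j * c i j)"
    unfolding val
    by (simp add: rowsum[of _ "c _"] sum.cartesian_product split_def flip: sum_divide_distrib)
  moreover have "c i j \<le> u i + v j" if i: "i < n" and j: "j < m" for i j
  proof -
    have "real n * real m * c i j = (\<Sum>k<m. \<Sum>l<n. c i j)" by simp
    also have "\<dots> \<le> (\<Sum>k<m. \<Sum>l<n. u0 (i, k) + v0 (l, j))"
      using uv[of "(i, _)" "(_, j)"] i j by (intro sum_mono) auto
    also have "\<dots> = real n * (\<Sum>k<m. u0 (i, k)) + real m * (\<Sum>l<n. v0 (l, j))"
      by (simp add: sum.distrib sum_distrib_left)
    also have "\<dots> = real n * real m * (u i + v j)"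
      using n m by (simp add: u_def v_def field_simps)
    finally show ?thesis using nm by (simp only: mult_le_cancel_left_pos)
  qed
  moreover have "transport_value n m c = (\<Sum>i<n. u i) / real n + (\<Sum>j<m. v j) / real m"
  proof -
    \<comment> \<open>The potentials are tight along the optimal permutation, and a permutation does
      not change the sum of \<open>v0\<close>; so their averages attain the value.\<close>
    have "transport_value n m c = (\<Sum>r\<in>?I. u0 r + v0 (\<sigma> r)) / (real n * real m)"
      unfolding val by (simp add: uv_eq)
    also have "(\<Sum>r\<in>?I. u0 r + v0 (\<sigma> r)) = (\<Sum>r\<in>?I. u0 r) + (\<Sum>r\<in>?I. v0 r)"
      using sum.permute[OF \<sigma>, of v0] by (simp add: sum.distrib comp_def)
    also have "(\<Sum>r\<in>?I. u0 r) = (\<Sum>i<n. u i) * real m"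
    proof -
      have "(\<Sum>r\<in>?I. u0 r) = (\<Sum>i<n. \<Sum>j<m. u0 (i, j))" by (simp add: sum.cartesian_product split_def)
      then show ?thesis using m by (simp add: u_def flip: sum_divide_distrib)
    qed
    also have "(\<Sum>r\<in>?I. v0 r) = (\<Sum>j<m. v j) * real n"
    proof -
      have "(\<Sum>r\<in>?I. v0 r) = (\<Sum>i<n. \<Sum>j<m. v0 (i, j))" by (simp add: sum.cartesian_product split_def)
      also have "\<dots> = (\<Sum>j<m. \<Sum>i<n. v0 (i, j))" by (rule sum.swap)
      finally show ?thesis using n by (simp add: v_def flip: sum_divide_distrib)
    qed
    finally show ?thesis using n m by (simp add: add_divide_distrib)
  qed
  ultimately show thesis using that[OF \<sigma> val] by blast
qed

text \<open>\<open>transport_value\<close> is a maximum over permutations of the copies only. That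
  fractional plans cannot exceed it follows by testing the plan against the dual solution, which
  replaces a decomposition of plans into permutations.\<close>

lemma plan_le_transport_value:
  assumes "n \<ge> 1" "m \<ge> 1" "plan n m a"
  shows "(\<Sum>i<n. \<Sum>j<m. a i j * c i j) \<le> transport_value n m c"
proof (rule transport_duality[OF assms(1,2), of c])
  fix u v assume "\<And>i j. i < n \<Longrightarrow> j < m \<Longrightarrow> c i j \<le> u i + v j"
    and *: "transport_value n m c = (\<Sum>i<n. u i) / real n + (\<Sum>j<m. v j) / real m"
  then show ?thesis unfolding * by (intro plan_weak_duality assms(3))
qed

lemma transport_value_cong:
  assumes "\<And>i j. i < n \<Longrightarrow> j < m \<Longrightarrow> c i j = c' i j"
  shows "transport_value n m c = transport_value n m c'"
proof -
  have "(\<Sum>r\<in>{..<n} \<times> {..<m}. c (fst r) (snd (\<sigma> r))) = (\<Sum>r\<in>{..<n} \<times> {..<m}. c' (fst r) (snd (\<sigma> r)))"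
    if \<sigma>: "\<sigma> permutes {..<n} \<times> {..<m}" for \<sigma>
  proof (intro sum.cong refl assms)
    fix r assume "r \<in> {..<n} \<times> {..<m}"
    then show "fst r < n" "snd (\<sigma> r) < m" using permutes_in_image[OF \<sigma>, of r] by auto
  qed
  then show ?thesis
    unfolding transport_value_def by (intro arg_cong[where f = Max] image_cong refl) auto
qed

lemma transport_value_swap:
  assumes n: "n \<ge> 1" and m: "m \<ge> 1"
  shows "transport_value n m c = transport_value m n (\<lambda>j i. c i j)"
proof -
  have le: "transport_value n m c \<le> transport_value m n (\<lambda>j i. c i j)" if "n \<ge> 1" "m \<ge> 1" for n m c
  proof (rule transport_duality[OF that, of c])
    fix a assume a: "plan n m a" and *: "transport_value n m c = (\<Sum>i<n. \<Sum>j<m. a i j * c i j)"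
    have "plan m n (\<lambda>j i. a i j)" using a by (auto simp: plan_def)
    from plan_le_transport_value[OF that(2,1) this, of "\<lambda>j i. c i j"] show ?thesis
      unfolding * by (subst sum.swap) simp
  qed
  show ?thesis using le[OF n m, of c] le[OF m n, of "\<lambda>j i. c i j"] by simp
qed

text \<open>The value is a finite maximum of finite sums of the entries, so that no optimal plan has
  to be selected measurably.\<close>

lemma transport_value_measurable:
  assumes "\<And>i j. i < n \<Longrightarrow> j < m \<Longrightarrow> (\<lambda>\<omega>. c \<omega> i j) \<in> borel_measurable N"
  shows "(\<lambda>\<omega>. transport_value n m (c \<omega>)) \<in> borel_measurable N"
  unfolding transport_value_def
proof (rule borel_measurable_Max)
  show "finite {\<sigma>. \<sigma> permutes {..<n} \<times> {..<m}}" by (intro finite_permutations) auto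
  fix \<sigma> :: "nat \<times> nat \<Rightarrow> nat \<times> nat" assume "\<sigma> \<in> {\<sigma>. \<sigma> permutes {..<n} \<times> {..<m}}"
  then have "fst r < n \<and> snd (\<sigma> r) < m" if "r \<in> {..<n} \<times> {..<m}" for r
    using that permutes_in_image[of \<sigma> _ r] by (metis SigmaE fst_conv lessThan_iff mem_Collect_eq mem_Sigma_iff surjective_pairing)
  then show "(\<lambda>\<omega>. (\<Sum>r\<in>{..<n} \<times> {..<m}. c \<omega> (fst r) (snd (\<sigma> r))) / (real n * real m)) \<in> borel_measurable N"
    by (intro borel_measurable_divide borel_measurable_sum borel_measurable_const assms) auto
qed

section \<open>Transport between empirical measures\<close>

lemma empirical_measure_sets [simp, measurable_cong]: "sets (empirical_measure n x) = sets borel"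
  by (simp add: empirical_measure_def)

lemma prob_space_empirical_measure:
  assumes "n \<ge> 1" shows "prob_space (empirical_measure n x)"
  unfolding empirical_measure_def
  by (intro prob_space.prob_space_distr prob_space_uniform_count_measure)
     (use assms in \<open>auto simp: lessThan_empty_iff\<close>)

lemma integral_empirical_measure:
  fixes h :: "'a::euclidean_space \<Rightarrow> real"
  assumes h: "h \<in> borel_measurable borel"
  shows "(\<integral>z. h z \<partial>empirical_measure n x) = (\<Sum>i<n. h (x i)) / real n"
    and "integrable (empirical_measure n x) h"
proof -
  have x: "x \<in> measurable (uniform_count_measure {..<n}) borel" by simp
  show "(\<integral>z. h z \<partial>empirical_measure n x) = (\<Sum>i<n. h (x i)) / real n"
    unfolding empirical_measure_def
    by (subst integral_distr[OF x h])
       (simp add: uniform_count_measure_def lebesgue_integral_point_measure_finite sum_divide_distrib)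
  show "integrable (empirical_measure n x) h"
    unfolding empirical_measure_def
    by (subst integrable_distr_eq[OF x h])
       (simp add: uniform_count_measure_def integrable_point_measure_finite)
qed

lemma AE_empirical_measure:
  assumes "n \<ge> 1" shows "AE z in empirical_measure n x. z \<in> x ` {..<n}"
proof -
  have "emeasure (empirical_measure n x) (x ` {..<n}) = ennreal (1 / real n * (\<Sum>i<n. indicator (x ` {..<n}) (x i)))"
    by (intro emeasure_empirical_measure assms borel_closed finite_imp_closed) auto
  also have "\<dots> = 1" using assms by simp
  finally show ?thesis
    by (intro prob_space.AE_prob_1[OF prob_space_empirical_measure[OF assms]])
       (simp add: measure_def)
qed

lemma sum_coupling_permutation:
  fixes f g :: "nat \<Rightarrow> real"
  shows "(\<Sum>r\<in>{..<n} \<times> {..<m}. f (fst r)) = real m * (\<Sum>i<n. f i)"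
    and "(\<Sum>r\<in>{..<n} \<times> {..<m}. g (snd r)) = real n * (\<Sum>j<m. g j)"
proof -
  have "(\<Sum>r\<in>{..<n} \<times> {..<m}. f (fst r)) = (\<Sum>i<n. \<Sum>j<m. f i)"
    by (simp only: sum.cartesian_product split_def)
  then show "(\<Sum>r\<in>{..<n} \<times> {..<m}. f (fst r)) = real m * (\<Sum>i<n. f i)" by (simp add: sum_distrib_left)
  have "(\<Sum>r\<in>{..<n} \<times> {..<m}. g (snd r)) = (\<Sum>i<n. \<Sum>j<m. g j)"
    by (simp only: sum.cartesian_product split_def)
  then show "(\<Sum>r\<in>{..<n} \<times> {..<m}. g (snd r)) = real n * (\<Sum>j<m. g j)" by simp
qed

lemma measure_eqI_card:
  fixes x :: "nat \<Rightarrow> 'a::euclidean_space"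
  assumes "n \<ge> 1" "finite I" "I \<noteq> {}" 
    and "\<And>A. A \<in> sets borel \<Longrightarrow> (\<Sum>r\<in>I. indicator A (h r)) / real (card I) = (\<Sum>i<n. indicator A (x i)) / real n"
  shows "distr (uniform_count_measure I) borel h = empirical_measure n x"
proof (rule measure_eqI)
  fix A assume "A \<in> sets (distr (uniform_count_measure I) borel h)"
  then have A: "A \<in> sets borel" by simp
  have eq: "h -` A \<inter> I = {r\<in>I. h r \<in> A}" by auto
  have "emeasure (distr (uniform_count_measure I) borel h) A = ennreal (real (card {r\<in>I. h r \<in> A}) / real (card I))"
    using A assms(2,3) by (subst emeasure_distr) (auto simp: space_uniform_count_measure eq emeasure_uniform_count_measure)
  also have "real (card {r\<in>I. h r \<in> A}) = (\<Sum>r\<in>I. indicator A (h r))"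
    using assms(2) by (simp add: indicator_def sum.If_cases Int_def)
  finally show "emeasure (distr (uniform_count_measure I) borel h) A = emeasure (empirical_measure n x) A"
    using assms(4)[OF A] by (simp add: emeasure_empirical_measure[OF assms(1) A])
qed simp

text \<open>The upper bound couples through the optimal permutation of the \<open>n * m\<close>
  copies. For the lower bound, \<open>u\<close> and \<open>v\<close> are indexed by sample positions
  while a coupling only sees points, and points may coincide; the dual solution is therefore first
  turned into functions on the space.\<close>

theorem wasserstein2_sq_empirical:
  fixes x y :: "nat \<Rightarrow> 'a::euclidean_space"
  assumes n: "n \<ge> 1" and m: "m \<ge> 1"
  defines "w \<equiv> (\<Sum>i<n. (norm (x i))\<^sup>2) / real n + (\<Sum>j<m. (norm (y j))\<^sup>2) / real m
    - 2 * transport_value n m (\<lambda>i j. x i \<bullet> y j)"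
  shows "0 \<le> w" and "wasserstein2_sq (empirical_measure n x) (empirical_measure m y) = ennreal w"
proof -
  let ?P = "empirical_measure n x" and ?Q = "empirical_measure m y"
  let ?I = "{..<n} \<times> {..<m}"
  have sq: "(norm (a - b))\<^sup>2 = (norm a)\<^sup>2 + (norm b)\<^sup>2 - 2 * (a \<bullet> b)" for a b :: 'a
    by (simp add: power2_norm_eq_inner inner_diff_left inner_diff_right inner_commute)
  obtain \<sigma> a u v where \<sigma>: "\<sigma> permutes ?I"
    and val: "transport_value n m (\<lambda>i j. x i \<bullet> y j) = (\<Sum>r\<in>?I. x (fst r) \<bullet> y (snd (\<sigma> r))) / (real n * real m)"
    and uv: "\<And>i j. i < n \<Longrightarrow> j < m \<Longrightarrow> x i \<bullet> y j \<le> u i + v j"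
    and dual: "transport_value n m (\<lambda>i j. x i \<bullet> y j) = (\<Sum>i<n. u i) / real n + (\<Sum>j<m. v j) / real m"
    by (rule transport_duality[OF n m, of "\<lambda>i j. x i \<bullet> y j"]) blast
  have card: "card ?I = n * m" by (simp add: card_cartesian_product)
  have nm: "real n * real m > 0" using n m by simp
  have ne: "?I \<noteq> {}" using n m by (auto simp: lessThan_empty_iff)
  have perm_snd: "(\<Sum>r\<in>?I. g (snd (\<sigma> r))) = real n * (\<Sum>j<m. g j)" for g :: "nat \<Rightarrow> real"
    using sum.permute[OF \<sigma>, of "\<lambda>r. g (snd r)"] sum_coupling_permutation(2)[of g n m] by (simp add: comp_def)
  define F where "F = (\<lambda>r. (x (fst r), y (snd (\<sigma> r))))"
  define \<pi> where "\<pi> = distr (uniform_count_measure ?I) borel F"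
  have F [measurable]: "F \<in> measurable (uniform_count_measure ?I) borel" by simp
  have cost: "(\<Sum>r\<in>?I. (norm (x (fst r) - y (snd (\<sigma> r))))\<^sup>2) / (real n * real m) = w"
  proof -
    have "(\<Sum>r\<in>?I. (norm (x (fst r) - y (snd (\<sigma> r))))\<^sup>2)
        = (\<Sum>r\<in>?I. (norm (x (fst r)))\<^sup>2) + (\<Sum>r\<in>?I. (norm (y (snd (\<sigma> r))))\<^sup>2)
          - 2 * (\<Sum>r\<in>?I. x (fst r) \<bullet> y (snd (\<sigma> r)))"
      by (simp add: sq sum.distrib sum_subtractf sum_distrib_left)
    then show ?thesis
      using n m unfolding w_def val
      by (simp add: perm_snd[of "\<lambda>j. (norm (y j))\<^sup>2"] sum_coupling_permutation(1)[of "\<lambda>i. (norm (x i))\<^sup>2"]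
          add_divide_distrib diff_divide_distrib)
  qed
  show "0 \<le> w" unfolding cost[symmetric] by (intro divide_nonneg_nonneg sum_nonneg) auto
  have "\<pi> \<in> couplings ?P ?Q"
    unfolding couplings_def
  proof (intro CollectI conjI)
    show "prob_space \<pi>" unfolding \<pi>_def
      by (intro prob_space.prob_space_distr[OF _ F] prob_space_uniform_count_measure) (use ne in auto)
    show "sets \<pi> = sets borel" by (simp add: \<pi>_def)
    have "distr \<pi> borel fst = distr (uniform_count_measure ?I) borel (\<lambda>r. x (fst r))"
      unfolding \<pi>_def
      by (subst distr_distr[OF borel_measurable_continuous_onI F])
        (auto simp: F_def comp_def intro!: continuous_intros)
    also have "\<dots> = ?P"
      using n m by (intro measure_eqI_card ne) (auto simp: card sum_coupling_permutation(1)[of "\<lambda>i. indicator _ (x i)"])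
    finally show "distr \<pi> borel fst = ?P" .
    have "distr \<pi> borel snd = distr (uniform_count_measure ?I) borel (\<lambda>r. y (snd (\<sigma> r)))"
      unfolding \<pi>_def
      by (subst distr_distr[OF borel_measurable_continuous_onI F])
        (auto simp: F_def comp_def intro!: continuous_intros)
    also have "\<dots> = ?Q"
      using n m by (intro measure_eqI_card ne) (auto simp: card perm_snd[of "\<lambda>j. indicator _ (y j)"])
    finally show "distr \<pi> borel snd = ?Q" .
  qed
  moreover have "(\<integral>\<^sup>+z. ennreal ((norm (fst z - snd z))\<^sup>2) \<partial>\<pi>) = ennreal w"
  proof -
    have "(\<integral>\<^sup>+z. ennreal ((norm (fst z - snd z))\<^sup>2) \<partial>\<pi>)
        = (\<integral>\<^sup>+r. ennreal ((norm (x (fst r) - y (snd (\<sigma> r))))\<^sup>2) \<partial>uniform_count_measure ?I)"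
      unfolding \<pi>_def 
      by (subst nn_integral_distr[OF F])
        (auto simp: F_def intro!: borel_measurable_continuous_onI continuous_intros measurable_compose[OF _ measurable_ennreal])
    also have "\<dots> = (\<Sum>r\<in>?I. ennreal (1 / (real n * real m)) * ennreal ((norm (x (fst r) - y (snd (\<sigma> r))))\<^sup>2))"
      unfolding uniform_count_measure_def by (subst nn_integral_point_measure_finite) (auto simp: card)
    also have "\<dots> = ennreal (\<Sum>r\<in>?I. 1 / (real n * real m) * (norm (x (fst r) - y (snd (\<sigma> r))))\<^sup>2)"
      by (subst sum_ennreal[symmetric]) (simp, intro sum.cong refl ennreal_mult[symmetric], simp_all)
    also have "\<dots> = ennreal w" unfolding cost[symmetric] by (simp add: sum_divide_distrib)
    finally show ?thesis .
  qed
  ultimately have le: "wasserstein2_sq ?P ?Q \<le> ennreal w"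
    unfolding wasserstein2_sq_def by (intro INF_lower2[of \<pi>]) auto
  \<comment> \<open>\<open>\<phi>\<close> extends the row potentials to the whole space, and
    \<open>\<psi>\<close> is its transform over the sample points \<open>x i\<close> only. At the
    sample both lie below \<open>u\<close> and \<open>v\<close>, while
    \<open>\<phi> + \<psi>\<close> dominates the inner product as soon as the first argument is a
    sample point, which holds almost surely under any coupling.\<close>
  define \<phi> where "\<phi> z = Max ((\<lambda>j. z \<bullet> y j - v j) ` {..<m})" for z
  define \<psi> where "\<psi> z = Max ((\<lambda>i. x i \<bullet> z - \<phi> (x i)) ` {..<n})" for z
  have [measurable]: "\<phi> \<in> borel_measurable borel" "\<psi> \<in> borel_measurable borel"
    unfolding \<phi>_def \<psi>_def by (intro borel_measurable_Max; simp)+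
  have \<phi>_le: "\<phi> (x i) \<le> u i" if "i < n" for i
    unfolding \<phi>_def using m uv[OF that] by (subst Max_le_iff) (auto simp: lessThan_empty_iff algebra_simps)
  have \<psi>_le: "\<psi> (y j) \<le> v j" if j: "j < m" for j
    unfolding \<psi>_def
  proof (subst Max_le_iff)
    have "x i \<bullet> y j - v j \<le> \<phi> (x i)" for i unfolding \<phi>_def using j by (intro Max_ge) auto
    then show "\<forall>a\<in>(\<lambda>i. x i \<bullet> y j - \<phi> (x i)) ` {..<n}. a \<le> v j" by (auto simp: algebra_simps)
  qed (use n in \<open>auto simp: lessThan_empty_iff\<close>)
  have "ennreal w \<le> (\<integral>\<^sup>+z. ennreal ((norm (fst z - snd z))\<^sup>2) \<partial>\<pi>')" if \<pi>': "\<pi>' \<in> couplings ?P ?Q" for \<pi>'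
  proof -
    define f where "f z = (norm z)\<^sup>2 - 2 * \<phi> z" for z
    define g where "g z = (norm z)\<^sup>2 - 2 * \<psi> z" for z
    have [measurable]: "f \<in> borel_measurable borel" "g \<in> borel_measurable borel"
      unfolding f_def g_def by measurable
    from \<pi>' have sets: "sets \<pi>' = sets (borel \<Otimes>\<^sub>M borel)" and pr: "prob_space \<pi>'"
      and d1: "distr \<pi>' borel fst = ?P" and d2: "distr \<pi>' borel snd = ?Q"
      unfolding couplings_def borel_prod by blast+
    have [measurable]: "fst \<in> measurable \<pi>' borel" "snd \<in> measurable \<pi>' borel"
      unfolding measurable_cong_sets[OF sets refl] by measurable
    have i1: "integrable \<pi>' (\<lambda>z. f (fst z))" "(\<integral>z. f (fst z) \<partial>\<pi>') = (\<Sum>i<n. f (x i)) / real n"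
      unfolding integral_empirical_measure(1)[of f n x, symmetric, simplified]
      using integral_empirical_measure(2)[of f n x]
      by (auto simp flip: d1 simp: integrable_distr_eq integral_distr)
    have i2: "integrable \<pi>' (\<lambda>z. g (snd z))" "(\<integral>z. g (snd z) \<partial>\<pi>') = (\<Sum>j<m. g (y j)) / real m"
      unfolding integral_empirical_measure(1)[of g m y, symmetric, simplified]
      using integral_empirical_measure(2)[of g m y]
      by (auto simp flip: d2 simp: integrable_distr_eq integral_distr)
    have ae1: "AE z in \<pi>'. fst z \<in> x ` {..<n}"
    proof -
      have "AE z in distr \<pi>' borel fst. z \<in> x ` {..<n}" unfolding d1 by (rule AE_empirical_measure[OF n])
      moreover have "x ` {..<n} \<in> sets borel" by (intro borel_closed finite_imp_closed) auto
      ultimately show ?thesis by (subst (asm) AE_distr_iff) auto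
    qed
    have "w = (\<Sum>i<n. (norm (x i))\<^sup>2 - 2 * u i) / real n + (\<Sum>j<m. (norm (y j))\<^sup>2 - 2 * v j) / real m"
      unfolding w_def dual by (simp add: sum_subtractf sum_distrib_left[symmetric] diff_divide_distrib)
    also have "\<dots> \<le> (\<Sum>i<n. f (x i)) / real n + (\<Sum>j<m. g (y j)) / real m"
      by (intro add_mono divide_right_mono sum_mono) (auto simp: f_def g_def \<phi>_le \<psi>_le)
    also have "\<dots> = (\<integral>z. f (fst z) + g (snd z) \<partial>\<pi>')" using i1 i2 by simp
    finally have "ennreal w \<le> ennreal (\<integral>z. f (fst z) + g (snd z) \<partial>\<pi>')" by (rule ennreal_leI)
    \<comment> \<open>\<open>f + g\<close> may be negative; cutting at 0 makes its Bochner integral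
      comparable with the extended nonnegative one.\<close>
    also have "\<dots> \<le> ennreal (\<integral>z. max 0 (f (fst z) + g (snd z)) \<partial>\<pi>')"
      using i1 i2 by (intro ennreal_leI integral_mono) auto
    also have "\<dots> = (\<integral>\<^sup>+z. ennreal (max 0 (f (fst z) + g (snd z))) \<partial>\<pi>')"
      using i1 i2 by (intro nn_integral_eq_integral[symmetric]) auto
    also have "\<dots> \<le> (\<integral>\<^sup>+z. ennreal ((norm (fst z - snd z))\<^sup>2) \<partial>\<pi>')"
    proof (rule nn_integral_mono_AE, use ae1 in eventually_elim)
      case (elim z)
      have "fst z \<bullet> snd z - \<phi> (fst z) \<le> \<psi> (snd z)"
        unfolding \<psi>_def using elim by (intro Max_ge) auto
      then have "f (fst z) + g (snd z) \<le> (norm (fst z - snd z))\<^sup>2"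
        by (simp add: f_def g_def sq)
      then show ?case by (intro ennreal_leI) auto
    qed
    finally show ?thesis .
  qed
  then have "ennreal w \<le> wasserstein2_sq ?P ?Q"
    unfolding wasserstein2_sq_def by (intro INF_greatest) auto
  with le show "wasserstein2_sq ?P ?Q = ennreal w" by simp
qed

lemma empirical_W_eq:
  assumes "n \<ge> 1" "m \<ge> 1"
  shows "empirical_W n m x y = (\<Sum>i<n. (norm (x i))\<^sup>2) / real n + (\<Sum>j<m. (norm (y j))\<^sup>2) / real m
    - 2 * transport_value n m (\<lambda>i j. x i \<bullet> y j)"
  unfolding empirical_W_def wasserstein2_sq_empirical(2)[OF assms]
  by (rule enn2real_ennreal[OF wasserstein2_sq_empirical(1)[OF assms]])

section \<open>The Efron--Stein inequality\<close>

text \<open>For square integrable functions this is the variance; see \<open>pos_var_eq_variance\<close>.\<close>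

definition pos_var :: "'a measure \<Rightarrow> ('a \<Rightarrow> real) \<Rightarrow> ennreal" where
  "pos_var N f = (\<integral>\<^sup>+x. \<integral>\<^sup>+y. ennreal ((max 0 (f y - f x))\<^sup>2) \<partial>N \<partial>N)"

text \<open>Exchanging the two copies turns \<open>max 0 (f y - f x)\<close> into
  \<open>max 0 (f x - f y)\<close>. The squares of these two add up to
  \<open>(f y - f x)\<^sup>2\<close>, whose mean is twice the variance, so one-sided increments lose
  nothing.\<close>

lemma (in prob_space) pos_var_eq:
  assumes f [measurable]: "f \<in> borel_measurable M" and f2: "integrable M (\<lambda>x. (f x)\<^sup>2)"
  shows "pos_var M f = ennreal (expectation (\<lambda>x. (f x)\<^sup>2) - (expectation f)\<^sup>2)"
proof -
  interpret MM: pair_sigma_finite M M ..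
  have fi: "integrable M f" using square_integrable_imp_integrable[OF f f2] .
  let ?A = "expectation (\<lambda>x. (f x)\<^sup>2)" and ?e = "expectation f"
  have swap: "pos_var M f = (\<integral>\<^sup>+x. \<integral>\<^sup>+y. ennreal ((max 0 (f x - f y))\<^sup>2) \<partial>M \<partial>M)"
    unfolding pos_var_def by (rule MM.Fubini') simp
  have "2 * pos_var M f = (\<integral>\<^sup>+x. \<integral>\<^sup>+y. ennreal ((max 0 (f y - f x))\<^sup>2) \<partial>M \<partial>M)
      + (\<integral>\<^sup>+x. \<integral>\<^sup>+y. ennreal ((max 0 (f x - f y))\<^sup>2) \<partial>M \<partial>M)"
    unfolding swap[symmetric] pos_var_def[symmetric] by (simp add: mult_2)
  also have "\<dots> = (\<integral>\<^sup>+x. \<integral>\<^sup>+y. ennreal ((max 0 (f y - f x))\<^sup>2) + ennreal ((max 0 (f x - f y))\<^sup>2) \<partial>M \<partial>M)"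
    by (subst nn_integral_add[symmetric]) (auto intro!: nn_integral_cong simp: nn_integral_add)
  also have "\<dots> = (\<integral>\<^sup>+x. \<integral>\<^sup>+y. ennreal ((f y - f x)\<^sup>2) \<partial>M \<partial>M)"
    by (intro nn_integral_cong)
       (auto simp: max_def power2_commute simp flip: ennreal_plus)
  also have "\<dots> = (\<integral>\<^sup>+x. ennreal (?A - 2 * f x * ?e + (f x)\<^sup>2) \<partial>M)"
  proof (intro nn_integral_cong)
    fix x
    have i: "integrable M (\<lambda>y. (f y - f x)\<^sup>2)"
      unfolding power2_diff using fi f2 by auto
    have "(\<integral>\<^sup>+y. ennreal ((f y - f x)\<^sup>2) \<partial>M) = ennreal (\<integral>y. (f y - f x)\<^sup>2 \<partial>M)"
      by (intro nn_integral_eq_integral i) auto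
    also have "(\<integral>y. (f y - f x)\<^sup>2 \<partial>M) = ?A - 2 * f x * ?e + (f x)\<^sup>2"
      unfolding power2_diff using fi f2 by (simp add: prob_space)
    finally show "(\<integral>\<^sup>+y. ennreal ((f y - f x)\<^sup>2) \<partial>M) = ennreal (?A - 2 * f x * ?e + (f x)\<^sup>2)" .
  qed
  also have "\<dots> = ennreal (\<integral>x. ?A - 2 * f x * ?e + (f x)\<^sup>2 \<partial>M)"
  proof (intro nn_integral_eq_integral)
    have "?A - 2 * f x * ?e + (f x)\<^sup>2 = (?A - ?e\<^sup>2) + (f x - ?e)\<^sup>2" for x by (simp add: power2_diff)
    moreover have "?A - ?e\<^sup>2 \<ge> 0" using variance_eq[OF fi f2] variance_positive[of f] by simp
    ultimately show "AE x in M. 0 \<le> ?A - 2 * f x * ?e + (f x)\<^sup>2"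
      by (intro AE_I2) (metis add_nonneg_nonneg zero_le_power2)
  qed (use fi f2 in auto)
  also have "(\<integral>x. ?A - 2 * f x * ?e + (f x)\<^sup>2 \<partial>M) = 2 * (?A - ?e\<^sup>2)"
    using fi f2 by (simp add: prob_space power2_eq_square)
  also have "ennreal (2 * (?A - ?e\<^sup>2)) = 2 * ennreal (?A - ?e\<^sup>2)"
    by (subst ennreal_mult') simp_all
  finally show ?thesis by (simp add: ennreal_mult_cancel_left)
qed

lemma (in prob_space) pos_var_eq_variance:
  assumes "f \<in> borel_measurable M" "integrable M (\<lambda>x. (f x)\<^sup>2)"
  shows "pos_var M f = ennreal (variance f)"
  using pos_var_eq[OF assms] variance_eq[OF square_integrable_imp_integrable[OF assms] assms(2)] by simp

lemma pos_var_distr: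
  assumes [measurable]: "T \<in> measurable N L" "f \<in> borel_measurable L" and "sigma_finite_measure N" "sigma_finite_measure (distr N L T)"
  shows "pos_var (distr N L T) f = pos_var N (\<lambda>x. f (T x))"
proof -
  interpret D: sigma_finite_measure "distr N L T" by fact
  interpret N: sigma_finite_measure N by fact
  show ?thesis
    unfolding pos_var_def by (simp add: nn_integral_distr)
qed

text \<open>With the partial means \<open>g\<close>, \<open>k\<close> and the mean \<open>e\<close>,
  this is the orthogonal decomposition of \<open>F\<close>: the interaction term
  \<open>F - g - k + e\<close> has a nonnegative second moment, that is, the variances of
  \<open>g\<close> and \<open>k\<close> together do not exceed that of \<open>F\<close>. The
  integrated variances of the sections are the second moment of \<open>F\<close> minus that of
  \<open>g\<close> or of \<open>k\<close>.\<close>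

lemma pos_var_pair_bounded:
  fixes F :: "'a \<times> 'b \<Rightarrow> real"
  assumes "prob_space A" "prob_space B" and F [measurable]: "F \<in> borel_measurable (A \<Otimes>\<^sub>M B)"
    and bd: "\<And>z. \<bar>F z\<bar> \<le> K"
  shows "pos_var (A \<Otimes>\<^sub>M B) F \<le> (\<integral>\<^sup>+b. pos_var A (\<lambda>a. F (a, b)) \<partial>B) + (\<integral>\<^sup>+a. pos_var B (\<lambda>b. F (a, b)) \<partial>A)"
proof -
  interpret A: prob_space A by fact
  interpret B: prob_space B by fact
  interpret AB: pair_prob_space A B ..
  define g where "g b = (\<integral>a. F (a, b) \<partial>A)" for b
  define k where "k a = (\<integral>b. F (a, b) \<partial>B)" for a
  define e where "e = (\<integral>z. F z \<partial>(A \<Otimes>\<^sub>M B))"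
  have [measurable]: "g \<in> borel_measurable B" "k \<in> borel_measurable A"
    unfolding g_def k_def by measurable
  have K: "0 \<le> K" using bd[of undefined] by simp
  have intA: "integrable A h" if "h \<in> borel_measurable A" "\<And>x. \<bar>h x\<bar> \<le> L" for h :: "'a \<Rightarrow> real" and L
    using that by (intro A.integrable_const_bound[where B = L]) auto
  have intB: "integrable B h" if "h \<in> borel_measurable B" "\<And>x. \<bar>h x\<bar> \<le> L" for h :: "'b \<Rightarrow> real" and L
    using that by (intro B.integrable_const_bound[where B = L]) auto
  have intAB: "integrable (A \<Otimes>\<^sub>M B) h" if "h \<in> borel_measurable (A \<Otimes>\<^sub>M B)" "\<And>x. \<bar>h x\<bar> \<le> L" for h :: "'a \<times> 'b \<Rightarrow> real" and L
    using that by (intro AB.P.integrable_const_bound[where B = L]) auto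
  have bound: "\<bar>\<integral>x. h x \<partial>N\<bar> \<le> K" if "prob_space N" "\<And>x. \<bar>h x\<bar> \<le> K" for N :: "'c measure" and h :: "'c \<Rightarrow> real"
  proof (cases "integrable N h")
    case True
    interpret N: prob_space N by fact
    have "\<bar>\<integral>x. h x \<partial>N\<bar> \<le> (\<integral>x. \<bar>h x\<bar> \<partial>N)" by (rule integral_abs_bound)
    also have "\<dots> \<le> (\<integral>x. K \<partial>N)" using True that by (intro integral_mono) auto
    finally show ?thesis by (simp add: N.prob_space)
  qed (use K in \<open>simp add: not_integrable_integral_eq\<close>)
  have gK: "\<bar>g b\<bar> \<le> K" for b unfolding g_def using A.prob_space_axioms bd by (intro bound) auto
  have kK: "\<bar>k a\<bar> \<le> K" for a unfolding k_def using B.prob_space_axioms bd by (intro bound) auto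
  have mb: "\<bar>p * q\<bar> \<le> K * K" if "\<bar>p\<bar> \<le> K" "\<bar>q\<bar> \<le> K" for p q :: real
    unfolding abs_mult using that by (intro mult_mono) auto
  note b2 = mb[OF bd bd] mb[OF bd gK] mb[OF bd kK] mb[OF gK gK] mb[OF kK kK] mb[OF gK kK]
  let ?E = "\<lambda>h. \<integral>z. h z \<partial>(A \<Otimes>\<^sub>M B)"
  have int1: "integrable (A \<Otimes>\<^sub>M B) F" "integrable (A \<Otimes>\<^sub>M B) (\<lambda>z. g (snd z))" "integrable (A \<Otimes>\<^sub>M B) (\<lambda>z. k (fst z))"
    by (intro intAB[of _ "K"] bd gK kK; measurable)+
  have int2: "integrable (A \<Otimes>\<^sub>M B) (\<lambda>z. F z * F z)" "integrable (A \<Otimes>\<^sub>M B) (\<lambda>z. F z * g (snd z))"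
    "integrable (A \<Otimes>\<^sub>M B) (\<lambda>z. F z * k (fst z))" "integrable (A \<Otimes>\<^sub>M B) (\<lambda>z. g (snd z) * g (snd z))"
    "integrable (A \<Otimes>\<^sub>M B) (\<lambda>z. k (fst z) * k (fst z))" "integrable (A \<Otimes>\<^sub>M B) (\<lambda>z. g (snd z) * k (fst z))"
    by (intro intAB[of _ "K*K"] b2; measurable)+
  have Eg: "?E (\<lambda>z. g (snd z)) = e" "?E (\<lambda>z. k (fst z)) = e"
    unfolding e_def using AB.integral_snd[of "\<lambda>a b. F (a, b)"] AB.integral_fst'[of F] int1
      AB.integral_snd[of "\<lambda>a b. g b"] AB.integral_fst'[of "\<lambda>z. k (fst z)"]
    by (simp_all add: g_def[symmetric] k_def[symmetric] split_def A.prob_space B.prob_space)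
  have EFg: "?E (\<lambda>z. F z * g (snd z)) = ?E (\<lambda>z. g (snd z) * g (snd z))"
    using AB.integral_snd[of "\<lambda>a b. F (a, b) * g b"] AB.integral_snd[of "\<lambda>a b. g b * g b"] int2
    by (simp add: split_def A.prob_space g_def[symmetric])
  have EFk: "?E (\<lambda>z. F z * k (fst z)) = ?E (\<lambda>z. k (fst z) * k (fst z))"
    using AB.integral_fst'[of "\<lambda>z. F z * k (fst z)"] AB.integral_fst'[of "\<lambda>z. k (fst z) * k (fst z)"] int2
    by (simp add: split_def B.prob_space k_def[symmetric])
  have Egk: "?E (\<lambda>z. g (snd z) * k (fst z)) = e * e"
  proof -
    have "(\<integral>b. g b \<partial>B) = e" using AB.integral_snd[of "\<lambda>a b. g b"] int1 Eg(1) by (simp add: split_def A.prob_space)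
    moreover have "(\<integral>a. k a \<partial>A) = e" using AB.integral_fst'[of "\<lambda>z. k (fst z)"] int1 Eg(2) by (simp add: B.prob_space)
    ultimately show ?thesis using AB.integral_fst'[of "\<lambda>z. g (snd z) * k (fst z)"] int2 by simp
  qed
  have "0 \<le> ?E (\<lambda>z. (F z - g (snd z) - k (fst z) + e)\<^sup>2)" by simp
  also have "(\<lambda>z. (F z - g (snd z) - k (fst z) + e)\<^sup>2) = (\<lambda>z. F z * F z + g (snd z) * g (snd z) + k (fst z) * k (fst z) + e * e
      - 2 * (F z * g (snd z)) - 2 * (F z * k (fst z)) + 2 * (g (snd z) * k (fst z))
      + 2 * e * F z - 2 * e * g (snd z) - 2 * e * k (fst z))"
    by (simp add: fun_eq_iff power2_eq_square algebra_simps)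
  also have "?E \<dots> = ?E (\<lambda>z. F z * F z) - ?E (\<lambda>z. g (snd z) * g (snd z)) - ?E (\<lambda>z. k (fst z) * k (fst z)) + e * e"
    using int1 int2 by (simp add: EFg EFk Egk Eg AB.P.prob_space e_def[symmetric])
  finally have key: "?E (\<lambda>z. g (snd z) * g (snd z)) + ?E (\<lambda>z. k (fst z) * k (fst z)) \<le> ?E (\<lambda>z. F z * F z) + e * e"
    by simp
  have bd2: "\<bar>F z * F z\<bar> \<le> K * K" for z using b2(1) .
  have "(\<integral>\<^sup>+b. pos_var A (\<lambda>a. F (a, b)) \<partial>B) = (\<integral>\<^sup>+b. ennreal ((\<integral>a. F (a, b) * F (a, b) \<partial>A) - g b * g b) \<partial>B)"
  proof (intro nn_integral_cong)
    fix b assume b: "b \<in> space B"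
    then have [measurable]: "(\<lambda>a. F (a, b)) \<in> borel_measurable A" by measurable
    show "pos_var A (\<lambda>a. F (a, b)) = ennreal ((\<integral>a. F (a, b) * F (a, b) \<partial>A) - g b * g b)"
      using bd2 by (subst A.pos_var_eq) (auto simp: power2_eq_square g_def intro!: intA[of _ "K*K"])
  qed
  also have "\<dots> = ennreal (\<integral>b. (\<integral>a. F (a, b) * F (a, b) \<partial>A) - g b * g b \<partial>B)"
  proof (intro nn_integral_eq_integral)
    show "AE b in B. 0 \<le> (\<integral>a. F (a, b) * F (a, b) \<partial>A) - g b * g b"
    proof (intro AE_I2)
      fix b assume b: "b \<in> space B"
      then have [measurable]: "(\<lambda>a. F (a, b)) \<in> borel_measurable A" by measurable
      show "0 \<le> (\<integral>a. F (a, b) * F (a, b) \<partial>A) - g b * g b"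
      proof -
        have "0 \<le> A.variance (\<lambda>a. F (a, b))" by (rule A.variance_positive)
        also have "\<dots> = (\<integral>a. (F (a, b))\<^sup>2 \<partial>A) - (\<integral>a. F (a, b) \<partial>A)\<^sup>2"
          using bd bd2 by (intro A.variance_eq intA[of _ K] intA[of _ "K * K"]) (simp_all add: power2_eq_square)
        finally show ?thesis by (simp add: power2_eq_square g_def)
      qed
    qed
    show "integrable B (\<lambda>b. (\<integral>a. F (a, b) * F (a, b) \<partial>A) - g b * g b)"
      using AB.integrable_snd[of "\<lambda>a b. F (a, b) * F (a, b)"] int2 intB[of "\<lambda>b. g b * g b", OF _ mb[OF gK gK]]
      by (auto simp: split_def)
  qed
  also have "(\<integral>b. (\<integral>a. F (a, b) * F (a, b) \<partial>A) - g b * g b \<partial>B) = ?E (\<lambda>z. F z * F z) - ?E (\<lambda>z. g (snd z) * g (snd z))"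
    using AB.integral_snd[of "\<lambda>a b. F (a, b) * F (a, b)"] AB.integral_snd[of "\<lambda>a b. g b * g b"] int2
      AB.integrable_snd[of "\<lambda>a b. F (a, b) * F (a, b)"] AB.integrable_snd[of "\<lambda>a b. g b * g b"]
    by (simp add: split_def A.prob_space)
  finally have R1: "(\<integral>\<^sup>+b. pos_var A (\<lambda>a. F (a, b)) \<partial>B) = ennreal (?E (\<lambda>z. F z * F z) - ?E (\<lambda>z. g (snd z) * g (snd z)))" .
  have "(\<integral>\<^sup>+a. pos_var B (\<lambda>b. F (a, b)) \<partial>A) = (\<integral>\<^sup>+a. ennreal ((\<integral>b. F (a, b) * F (a, b) \<partial>B) - k a * k a) \<partial>A)"
  proof (intro nn_integral_cong)
    fix a assume a: "a \<in> space A"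
    then have [measurable]: "(\<lambda>b. F (a, b)) \<in> borel_measurable B" by measurable
    show "pos_var B (\<lambda>b. F (a, b)) = ennreal ((\<integral>b. F (a, b) * F (a, b) \<partial>B) - k a * k a)"
      using bd2 by (subst B.pos_var_eq) (auto simp: power2_eq_square k_def intro!: intB[of _ "K*K"])
  qed
  also have "\<dots> = ennreal (\<integral>a. (\<integral>b. F (a, b) * F (a, b) \<partial>B) - k a * k a \<partial>A)"
  proof (intro nn_integral_eq_integral)
    show "AE a in A. 0 \<le> (\<integral>b. F (a, b) * F (a, b) \<partial>B) - k a * k a"
    proof (intro AE_I2)
      fix a assume a: "a \<in> space A"
      then have [measurable]: "(\<lambda>b. F (a, b)) \<in> borel_measurable B" by measurable
      show "0 \<le> (\<integral>b. F (a, b) * F (a, b) \<partial>B) - k a * k a"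
      proof -
        have "0 \<le> B.variance (\<lambda>b. F (a, b))" by (rule B.variance_positive)
        also have "\<dots> = (\<integral>b. (F (a, b))\<^sup>2 \<partial>B) - (\<integral>b. F (a, b) \<partial>B)\<^sup>2"
          using bd bd2 by (intro B.variance_eq intB[of _ K] intB[of _ "K * K"]) (simp_all add: power2_eq_square)
        finally show ?thesis by (simp add: power2_eq_square k_def)
      qed
    qed
    show "integrable A (\<lambda>a. (\<integral>b. F (a, b) * F (a, b) \<partial>B) - k a * k a)"
      using AB.integrable_fst'[of "\<lambda>z. F z * F z"] int2 intA[of "\<lambda>a. k a * k a", OF _ mb[OF kK kK]]
      by auto
  qed
  also have "(\<integral>a. (\<integral>b. F (a, b) * F (a, b) \<partial>B) - k a * k a \<partial>A) = ?E (\<lambda>z. F z * F z) - ?E (\<lambda>z. k (fst z) * k (fst z))"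
    using AB.integral_fst'[of "\<lambda>z. F z * F z"] AB.integral_fst'[of "\<lambda>z. k (fst z) * k (fst z)"] int2
      AB.integrable_fst'[of "\<lambda>z. F z * F z"] AB.integrable_fst'[of "\<lambda>z. k (fst z) * k (fst z)"]
    by (simp add: split_def B.prob_space)
  finally have R2: "(\<integral>\<^sup>+a. pos_var B (\<lambda>b. F (a, b)) \<partial>A) = ennreal (?E (\<lambda>z. F z * F z) - ?E (\<lambda>z. k (fst z) * k (fst z)))" .
  have "pos_var (A \<Otimes>\<^sub>M B) F = ennreal (?E (\<lambda>z. F z * F z) - e * e)"
    using int2 by (subst AB.P.pos_var_eq) (auto simp: power2_eq_square e_def)
  also have "\<dots> \<le> ennreal ((?E (\<lambda>z. F z * F z) - ?E (\<lambda>z. g (snd z) * g (snd z))) + (?E (\<lambda>z. F z * F z) - ?E (\<lambda>z. k (fst z) * k (fst z))))"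
    using key by (intro ennreal_leI) simp
  also have "\<dots> = (\<integral>\<^sup>+b. pos_var A (\<lambda>a. F (a, b)) \<partial>B) + (\<integral>\<^sup>+a. pos_var B (\<lambda>b. F (a, b)) \<partial>A)"
    unfolding R1 R2
  proof (intro ennreal_plus)
    have "0 \<le> ?E (\<lambda>z. (F z - g (snd z))\<^sup>2)" by simp
    also have "(\<lambda>z. (F z - g (snd z))\<^sup>2) = (\<lambda>z. F z * F z + g (snd z) * g (snd z) - 2 * (F z * g (snd z)))"
      by (simp add: fun_eq_iff power2_eq_square algebra_simps)
    finally show "0 \<le> ?E (\<lambda>z. F z * F z) - ?E (\<lambda>z. g (snd z) * g (snd z))" using int2 by (simp add: EFg)
    have "0 \<le> ?E (\<lambda>z. (F z - k (fst z))\<^sup>2)" by simp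
    also have "(\<lambda>z. (F z - k (fst z))\<^sup>2) = (\<lambda>z. F z * F z + k (fst z) * k (fst z) - 2 * (F z * k (fst z)))"
      by (simp add: fun_eq_iff power2_eq_square algebra_simps)
    finally show "0 \<le> ?E (\<lambda>z. F z * F z) - ?E (\<lambda>z. k (fst z) * k (fst z))" using int2 by (simp add: EFk)
  qed
  finally show ?thesis .
qed


lemma pos_var_eq_pair:
  assumes "prob_space N" and [measurable]: "f \<in> borel_measurable N"
  shows "pos_var N f = (\<integral>\<^sup>+z. ennreal ((max 0 (f (snd z) - f (fst z)))\<^sup>2) \<partial>(N \<Otimes>\<^sub>M N))"
proof -
  interpret N: prob_space N by fact
  interpret pair_sigma_finite N N ..
  show ?thesis unfolding pos_var_def by (subst N.nn_integral_fst[symmetric]) simp_all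
qed

text \<open>Clipping at level \<open>k\<close> is monotone and contracts distances, so it only
  decreases the right-hand side, while Fatou recovers the left-hand side in the limit. The
  inequality thus holds for every measurable \<open>F\<close>, with values in the extended
  half-line.\<close>

lemma pos_var_pair:
  fixes F :: "'a \<times> 'b \<Rightarrow> real"
  assumes A: "prob_space A" and B: "prob_space B" and F [measurable]: "F \<in> borel_measurable (A \<Otimes>\<^sub>M B)"
  shows "pos_var (A \<Otimes>\<^sub>M B) F \<le> (\<integral>\<^sup>+b. pos_var A (\<lambda>a. F (a, b)) \<partial>B) + (\<integral>\<^sup>+a. pos_var B (\<lambda>b. F (a, b)) \<partial>A)"
    (is "_ \<le> ?R F")
proof -
  interpret A: prob_space A by fact
  interpret B: prob_space B by fact
  interpret AB: pair_prob_space A B ..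
  let ?N = "A \<Otimes>\<^sub>M B"
  define clip :: "nat \<Rightarrow> real \<Rightarrow> real" where "clip k r = max (- real k) (min (real k) r)" for k r
  have [measurable]: "clip k \<in> borel_measurable borel" for k unfolding clip_def by measurable
  have clip_le: "(max 0 (clip k r - clip k s))\<^sup>2 \<le> (max 0 (r - s))\<^sup>2" for k r s
    unfolding clip_def by (intro power_mono) auto
  have clip_abs: "\<bar>clip k r\<bar> \<le> real k" for k r unfolding clip_def by auto
  have clip_lim: "(\<lambda>k. clip k r) \<longlonglongrightarrow> r" for r
  proof (rule tendsto_eventually)
    obtain K where "\<bar>r\<bar> \<le> real K" using real_arch_simple by blast
    then show "\<forall>\<^sub>F k in sequentially. clip k r = r"
      unfolding eventually_sequentially clip_def by (intro exI[of _ K]) (auto simp: max_def min_def)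
  qed
  have "pos_var ?N F = (\<integral>\<^sup>+z. ennreal ((max 0 (F (snd z) - F (fst z)))\<^sup>2) \<partial>(?N \<Otimes>\<^sub>M ?N))"
    by (intro pos_var_eq_pair AB.P.prob_space_axioms F)
  also have "\<dots> = (\<integral>\<^sup>+z. liminf (\<lambda>k. ennreal ((max 0 (clip k (F (snd z)) - clip k (F (fst z))))\<^sup>2)) \<partial>(?N \<Otimes>\<^sub>M ?N))"
    by (intro nn_integral_cong lim_imp_Liminf[symmetric] tendsto_intros clip_lim sequentially_bot)
  also have "\<dots> \<le> liminf (\<lambda>k. \<integral>\<^sup>+z. ennreal ((max 0 (clip k (F (snd z)) - clip k (F (fst z))))\<^sup>2) \<partial>(?N \<Otimes>\<^sub>M ?N))"
    by (intro nn_integral_liminf) measurable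
  also have "\<dots> = liminf (\<lambda>k. pos_var ?N (\<lambda>z. clip k (F z)))"
    by (subst pos_var_eq_pair) (auto intro: AB.P.prob_space_axioms)
  also have "\<dots> \<le> ?R F"
  proof (intro Liminf_le)
    have "pos_var ?N (\<lambda>z. clip k (F z)) \<le> ?R F" for k
  proof -
    have "pos_var ?N (\<lambda>z. clip k (F z)) \<le> ?R (\<lambda>z. clip k (F z))"
      by (intro pos_var_pair_bounded[OF A B _ clip_abs]) measurable
    also have "\<dots> \<le> ?R F"
      unfolding pos_var_def by (intro add_mono nn_integral_mono ennreal_leI clip_le)
    finally show ?thesis .
  qed
  then show "\<forall>\<^sub>F k in sequentially. pos_var ?N (\<lambda>z. clip k (F z)) \<le> ?R F" by simp
  show "sequentially \<noteq> bot" by (rule sequentially_bot)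
  qed
  finally show ?thesis .
qed

text \<open>Induction on the index set: one coordinate is split off with
  \<open>pos_var_pair\<close>, the others are handled with that coordinate frozen, and integrating
  over it restores the full product measure.\<close>

lemma efron_stein_PiM:
  fixes M :: "'i \<Rightarrow> 'a measure"
  assumes fin: "finite I" and M: "\<And>i. prob_space (M i)" and f: "f \<in> borel_measurable (PiM I M)"
  shows "pos_var (PiM I M) f \<le> (\<Sum>i\<in>I. \<integral>\<^sup>+x. \<integral>\<^sup>+t. ennreal ((max 0 (f (x(i := t)) - f x))\<^sup>2) \<partial>M i \<partial>PiM I M)"
  using fin f
proof (induction I arbitrary: f)
  case empty
  have "pos_var (PiM {} M) f = 0"
    unfolding pos_var_def by (simp add: PiM_empty nn_integral_count_space_finite)
  then show ?case by simp
next
  case (insert i I)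
  interpret M: prob_space "M j" for j by (rule M)
  interpret product_prob_space M ..
  interpret I: prob_space "PiM I M" by (intro prob_space_PiM M)
  interpret MI: pair_prob_space "M i" "PiM I M" ..
  note f [measurable] = insert.prems
  have inc: "(\<lambda>x. \<integral>\<^sup>+t. ennreal ((max 0 (f (x(j := t)) - f x))\<^sup>2) \<partial>M j) \<in> borel_measurable (PiM (insert i I) M)"
    if j: "j \<in> insert i I" for j
  proof -
    have [measurable]: "(\<lambda>z. (fst z)(j := snd z)) \<in> measurable (PiM (insert i I) M \<Otimes>\<^sub>M M j) (PiM (insert i I) M)"
      by (rule measurable_fun_upd[where J = "insert i I"]) (use j in auto)
    show ?thesis by measurable
  qed
  let ?T = "\<lambda>(s, x). x(i := s)"
  have T [measurable]: "?T \<in> measurable (M i \<Otimes>\<^sub>M PiM I M) (PiM (insert i I) M)"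
    by measurable
  have "pos_var (PiM (insert i I) M) f = pos_var (distr (M i \<Otimes>\<^sub>M PiM I M) (PiM (insert i I) M) ?T) f"
    by (subst distr_pair_PiM_eq_PiM) (auto intro: M)
  also have "\<dots> = pos_var (M i \<Otimes>\<^sub>M PiM I M) (\<lambda>z. f (?T z))"
    by (intro pos_var_distr T f prob_space_imp_sigma_finite prob_space.prob_space_distr MI.P.prob_space_axioms)
  also have "\<dots> \<le> (\<integral>\<^sup>+x. pos_var (M i) (\<lambda>s. f (?T (s, x))) \<partial>PiM I M) + (\<integral>\<^sup>+s. pos_var (PiM I M) (\<lambda>x. f (?T (s, x))) \<partial>M i)"
    by (intro pos_var_pair M I.prob_space_axioms) measurable
  also have "(\<integral>\<^sup>+x. pos_var (M i) (\<lambda>s. f (?T (s, x))) \<partial>PiM I M)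
      = (\<integral>\<^sup>+x. \<integral>\<^sup>+t. ennreal ((max 0 (f (x(i := t)) - f x))\<^sup>2) \<partial>M i \<partial>PiM (insert i I) M)"
    unfolding pos_var_def using insert.hyps by (subst product_nn_integral_insert[OF _ _ inc]) auto
  finally have le: "pos_var (PiM (insert i I) M) f
      \<le> (\<integral>\<^sup>+x. \<integral>\<^sup>+t. ennreal ((max 0 (f (x(i := t)) - f x))\<^sup>2) \<partial>M i \<partial>PiM (insert i I) M)
        + (\<integral>\<^sup>+s. pos_var (PiM I M) (\<lambda>x. f (?T (s, x))) \<partial>M i)" .
  have "(\<integral>\<^sup>+s. pos_var (PiM I M) (\<lambda>x. f (?T (s, x))) \<partial>M i)
      \<le> (\<integral>\<^sup>+s. (\<Sum>j\<in>I. \<integral>\<^sup>+x. \<integral>\<^sup>+t. ennreal ((max 0 (f (x(j := t, i := s)) - f (x(i := s))))\<^sup>2) \<partial>M j \<partial>PiM I M) \<partial>M i)"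
  proof (intro nn_integral_mono)
    fix s assume [measurable]: "s \<in> space (M i)"
    have "(\<lambda>x. f (x(i := s))) \<in> borel_measurable (PiM I M)" by measurable
    from insert.IH[OF this] show "pos_var (PiM I M) (\<lambda>x. f (?T (s, x)))
      \<le> (\<Sum>j\<in>I. \<integral>\<^sup>+x. \<integral>\<^sup>+t. ennreal ((max 0 (f (x(j := t, i := s)) - f (x(i := s))))\<^sup>2) \<partial>M j \<partial>PiM I M)"
      unfolding case_prod_conv .
  qed
  also have "\<dots> = (\<Sum>j\<in>I. \<integral>\<^sup>+s. (\<integral>\<^sup>+x. \<integral>\<^sup>+t. ennreal ((max 0 (f (x(j := t, i := s)) - f (x(i := s))))\<^sup>2) \<partial>M j \<partial>PiM I M) \<partial>M i)"
  proof (intro nn_integral_sum)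
    fix j assume j [simp]: "j \<in> I"
    have [measurable]: "(\<lambda>z. (snd (fst z))(j := snd z)) \<in> measurable ((M i \<Otimes>\<^sub>M PiM I M) \<Otimes>\<^sub>M M j) (PiM I M)"
      by (rule measurable_fun_upd[where J = I]) (use j in auto)
    have [measurable]: "(\<lambda>z. (snd (fst z))(j := snd z, i := fst (fst z))) \<in> measurable ((M i \<Otimes>\<^sub>M PiM I M) \<Otimes>\<^sub>M M j) (PiM (insert i I) M)"
      by (rule measurable_fun_upd[where J = I]) auto
    have [measurable]: "(\<lambda>z. (snd z)(i := fst z)) \<in> measurable (M i \<Otimes>\<^sub>M PiM I M) (PiM (insert i I) M)"
      by (rule measurable_fun_upd[where J = I]) auto
    show "(\<lambda>s. \<integral>\<^sup>+x. \<integral>\<^sup>+t. ennreal ((max 0 (f (x(j := t, i := s)) - f (x(i := s))))\<^sup>2) \<partial>M j \<partial>PiM I M) \<in> borel_measurable (M i)"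
      by measurable
  qed
  also have "\<dots> = (\<Sum>j\<in>I. \<integral>\<^sup>+x. \<integral>\<^sup>+t. ennreal ((max 0 (f (x(j := t)) - f x))\<^sup>2) \<partial>M j \<partial>PiM (insert i I) M)"
  proof (intro sum.cong refl)
    fix j assume j: "j \<in> I"
    then have "j \<noteq> i" using insert.hyps by auto
    show "(\<integral>\<^sup>+s. (\<integral>\<^sup>+x. \<integral>\<^sup>+t. ennreal ((max 0 (f (x(j := t, i := s)) - f (x(i := s))))\<^sup>2) \<partial>M j \<partial>PiM I M) \<partial>M i)
      = (\<integral>\<^sup>+x. \<integral>\<^sup>+t. ennreal ((max 0 (f (x(j := t)) - f x))\<^sup>2) \<partial>M j \<partial>PiM (insert i I) M)"
      using insert.hyps \<open>j \<noteq> i\<close> j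
      by (subst product_nn_integral_insert_rev[OF _ _ inc]) (auto simp: fun_upd_twist)
  qed
  finally show ?case
    unfolding sum.insert[OF insert.hyps] using le by (meson add_left_mono order_trans)
qed

lemma efron_stein_two_samples:
  fixes P :: "'a measure" and Q :: "'b measure"
  assumes P: "prob_space P" and Q: "prob_space Q" and fin: "finite I" "finite J"
    and F [measurable]: "(\<lambda>z. F (fst z) (snd z)) \<in> borel_measurable (PiM I (\<lambda>_. P) \<Otimes>\<^sub>M PiM J (\<lambda>_. Q))"
  shows "pos_var (PiM I (\<lambda>_. P) \<Otimes>\<^sub>M PiM J (\<lambda>_. Q)) (\<lambda>z. F (fst z) (snd z))
    \<le> (\<integral>\<^sup>+z. (\<Sum>i\<in>I. \<integral>\<^sup>+t. ennreal ((max 0 (F ((fst z)(i := t)) (snd z) - F (fst z) (snd z)))\<^sup>2) \<partial>P)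
          \<partial>(PiM I (\<lambda>_. P) \<Otimes>\<^sub>M PiM J (\<lambda>_. Q)))
      + (\<integral>\<^sup>+z. (\<Sum>j\<in>J. \<integral>\<^sup>+t. ennreal ((max 0 (F (fst z) ((snd z)(j := t)) - F (fst z) (snd z)))\<^sup>2) \<partial>Q)
          \<partial>(PiM I (\<lambda>_. P) \<Otimes>\<^sub>M PiM J (\<lambda>_. Q)))"
proof -
  let ?A = "PiM I (\<lambda>_. P)" and ?B = "PiM J (\<lambda>_. Q)"
  interpret P: prob_space P by (rule P)
  interpret Q: prob_space Q by (rule Q)
  interpret A: prob_space ?A by (intro prob_space_PiM P)
  interpret B: prob_space ?B by (intro prob_space_PiM Q)
  interpret AB: pair_prob_space ?A ?B ..
  have mI [measurable]: "(\<lambda>z. \<integral>\<^sup>+t. ennreal ((max 0 (F ((fst z)(i := t)) (snd z) - F (fst z) (snd z)))\<^sup>2) \<partial>P) \<in> borel_measurable (?A \<Otimes>\<^sub>M ?B)"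
    if i: "i \<in> I" for i
  proof -
    have [measurable]: "(\<lambda>z. (fst (fst z))(i := snd z)) \<in> measurable ((?A \<Otimes>\<^sub>M ?B) \<Otimes>\<^sub>M P) ?A"
      by (rule measurable_fun_upd[where J = I]) (use i in auto)
    have "(\<lambda>z. ((fst (fst z))(i := snd z), snd (fst z))) \<in> measurable ((?A \<Otimes>\<^sub>M ?B) \<Otimes>\<^sub>M P) (?A \<Otimes>\<^sub>M ?B)"
      by measurable
    from measurable_compose[OF this F] show ?thesis by simp
  qed
  have mJ [measurable]: "(\<lambda>z. \<integral>\<^sup>+t. ennreal ((max 0 (F (fst z) ((snd z)(j := t)) - F (fst z) (snd z)))\<^sup>2) \<partial>Q) \<in> borel_measurable (?A \<Otimes>\<^sub>M ?B)"
    if j: "j \<in> J" for j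
  proof -
    have [measurable]: "(\<lambda>z. (snd (fst z))(j := snd z)) \<in> measurable ((?A \<Otimes>\<^sub>M ?B) \<Otimes>\<^sub>M Q) ?B"
      by (rule measurable_fun_upd[where J = J]) (use j in auto)
    have "(\<lambda>z. (fst (fst z), (snd (fst z))(j := snd z))) \<in> measurable ((?A \<Otimes>\<^sub>M ?B) \<Otimes>\<^sub>M Q) (?A \<Otimes>\<^sub>M ?B)"
      by measurable
    from measurable_compose[OF this F] show ?thesis by simp
  qed
  have "pos_var (?A \<Otimes>\<^sub>M ?B) (\<lambda>z. F (fst z) (snd z))
      \<le> (\<integral>\<^sup>+y. pos_var ?A (\<lambda>x. F x y) \<partial>?B) + (\<integral>\<^sup>+x. pos_var ?B (\<lambda>y. F x y) \<partial>?A)"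
    using pos_var_pair[OF A.prob_space_axioms B.prob_space_axioms F] by simp
  also have "\<dots> \<le> (\<integral>\<^sup>+y. (\<Sum>i\<in>I. \<integral>\<^sup>+x. \<integral>\<^sup>+t. ennreal ((max 0 (F (x(i := t)) y - F x y))\<^sup>2) \<partial>P \<partial>?A) \<partial>?B)
      + (\<integral>\<^sup>+x. (\<Sum>j\<in>J. \<integral>\<^sup>+y. \<integral>\<^sup>+t. ennreal ((max 0 (F x (y(j := t)) - F x y))\<^sup>2) \<partial>Q \<partial>?B) \<partial>?A)"
  proof (intro add_mono nn_integral_mono efron_stein_PiM fin P Q)
    show "(\<lambda>x. F x y) \<in> borel_measurable ?A" if "y \<in> space ?B" for y
      using measurable_compose[OF measurable_Pair2'[OF that] F] by simp
    show "F x \<in> borel_measurable ?B" if "x \<in> space ?A" for x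
      using measurable_compose[OF measurable_Pair1'[OF that] F] by simp
  qed
  also have "(\<integral>\<^sup>+y. (\<Sum>i\<in>I. \<integral>\<^sup>+x. \<integral>\<^sup>+t. ennreal ((max 0 (F (x(i := t)) y - F x y))\<^sup>2) \<partial>P \<partial>?A) \<partial>?B)
      = (\<integral>\<^sup>+z. (\<Sum>i\<in>I. \<integral>\<^sup>+t. ennreal ((max 0 (F ((fst z)(i := t)) (snd z) - F (fst z) (snd z)))\<^sup>2) \<partial>P) \<partial>(?A \<Otimes>\<^sub>M ?B))"
    by (subst AB.nn_integral_snd[symmetric])
       (auto simp: nn_integral_sum measurable_compose[OF measurable_Pair2' mI, simplified] intro!: nn_integral_cong borel_measurable_sum mI)
  also have "(\<integral>\<^sup>+x. (\<Sum>j\<in>J. \<integral>\<^sup>+y. \<integral>\<^sup>+t. ennreal ((max 0 (F x (y(j := t)) - F x y))\<^sup>2) \<partial>Q \<partial>?B) \<partial>?A)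
      = (\<integral>\<^sup>+z. (\<Sum>j\<in>J. \<integral>\<^sup>+t. ennreal ((max 0 (F (fst z) ((snd z)(j := t)) - F (fst z) (snd z)))\<^sup>2) \<partial>Q) \<partial>(?A \<Otimes>\<^sub>M ?B))"
  proof (subst B.nn_integral_fst[symmetric])
    have "(\<lambda>y. \<integral>\<^sup>+t. ennreal ((max 0 (F x (y(j := t)) - F x y))\<^sup>2) \<partial>Q) \<in> borel_measurable ?B"
      if "x \<in> space ?A" "j \<in> J" for x j
      using measurable_compose[OF measurable_Pair1'[OF that(1)] mJ[OF that(2)]] by simp
    then show "(\<integral>\<^sup>+x. (\<Sum>j\<in>J. \<integral>\<^sup>+y. \<integral>\<^sup>+t. ennreal ((max 0 (F x (y(j := t)) - F x y))\<^sup>2) \<partial>Q \<partial>?B) \<partial>?A)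
      = (\<integral>\<^sup>+x. \<integral>\<^sup>+y. (\<Sum>j\<in>J. \<integral>\<^sup>+t. ennreal ((max 0 (F (fst (x, y)) ((snd (x, y))(j := t)) - F (fst (x, y)) (snd (x, y))))\<^sup>2) \<partial>Q) \<partial>?B \<partial>?A)"
      by (intro nn_integral_cong) (subst nn_integral_sum, auto)
  qed (intro borel_measurable_sum mJ)
  finally show ?thesis .
qed

section \<open>Two independent samples\<close>

locale two_samples = P: prob_space P + Q: prob_space Q
  for P Q :: "'a::euclidean_space measure" +
  assumes sets_P [simp, measurable_cong]: "sets P = sets borel"
    and sets_Q [simp, measurable_cong]: "sets Q = sets borel"
begin

lemma space_P [simp]: "space P = UNIV" and space_Q [simp]: "space Q = UNIV"
  using sets_eq_imp_space_eq[OF sets_P] sets_eq_imp_space_eq[OF sets_Q] by simp_all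

text \<open>The canonical space of both samples. Its index sets are finite so that Efron--Stein for
  finite products applies; estimates made here are carried over to the given variables by
  \<open>distr_samples\<close> and \<open>distr_transfer\<close>.\<close>

definition samples :: "nat \<Rightarrow> nat \<Rightarrow> ((nat \<Rightarrow> 'a) \<times> (nat \<Rightarrow> 'a)) measure" where
  "samples n m = PiM {..<n} (\<lambda>_. P) \<Otimes>\<^sub>M PiM {..<m} (\<lambda>_. Q)"

lemma pair_prob_space_samples:
  "pair_prob_space (PiM {..<n} (\<lambda>_. P)) (PiM {..<m} (\<lambda>_. Q))"
proof -
  interpret A: prob_space "PiM {..<n} (\<lambda>_. P)" by (intro prob_space_PiM P.prob_space_axioms)
  interpret B: prob_space "PiM {..<m} (\<lambda>_. Q)" by (intro prob_space_PiM Q.prob_space_axioms)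
  show ?thesis ..
qed

lemma prob_space_samples: "prob_space (samples n m)"
proof -
  interpret AB: pair_prob_space "PiM {..<n} (\<lambda>_. P)" "PiM {..<m} (\<lambda>_. Q)" by (rule pair_prob_space_samples)
  show ?thesis unfolding samples_def by (rule AB.P.prob_space_axioms)
qed

lemma fst_sample_measurable: "i < n \<Longrightarrow> (\<lambda>z. fst z i) \<in> measurable (samples n m) borel"
  unfolding samples_def
  by (rule measurable_compose[OF measurable_fst measurable_component_singleton[of i _ "\<lambda>_. P", unfolded measurable_cong_sets[OF refl sets_P]]]) simp

lemma snd_sample_measurable: "j < m \<Longrightarrow> (\<lambda>z. snd z j) \<in> measurable (samples n m) borel"
  unfolding samples_def
  by (rule measurable_compose[OF measurable_snd measurable_component_singleton[of j _ "\<lambda>_. Q", unfolded measurable_cong_sets[OF refl sets_Q]]]) simp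

lemma distr_fst_sample:
  assumes "i < n" shows "distr (samples n m) borel (\<lambda>z. fst z i) = P"
proof -
  interpret AB: pair_prob_space "PiM {..<n} (\<lambda>_. P)" "PiM {..<m} (\<lambda>_. Q)" by (rule pair_prob_space_samples)
  interpret PP: product_prob_space "\<lambda>_. P" "{..<n}" ..
  have "distr (samples n m) borel (\<lambda>z. fst z i) = distr (distr (samples n m) (PiM {..<n} (\<lambda>_. P)) fst) P (\<lambda>x. x i)"
    unfolding samples_def using assms by (subst distr_distr) (auto simp: comp_def intro!: distr_cong)
  also have "distr (samples n m) (PiM {..<n} (\<lambda>_. P)) fst = PiM {..<n} (\<lambda>_. P)"
    unfolding samples_def by (simp add: AB.M2.distr_pair_fst)
  also have "distr (PiM {..<n} (\<lambda>_. P)) P (\<lambda>x. x i) = P"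
    using assms by (subst PP.PiM_component) auto
  finally show ?thesis .
qed

text \<open>Lets statements about the second sample be read off from those about the first sample
  with \<open>P\<close> and \<open>Q\<close> exchanged.\<close>

lemma nn_integral_swap_samples:
  assumes [measurable]: "h \<in> borel_measurable (samples n m)"
  shows "(\<integral>\<^sup>+z. h z \<partial>samples n m) = (\<integral>\<^sup>+z. h (snd z, fst z) \<partial>two_samples.samples Q P m n)"
proof -
  interpret AB: pair_prob_space "PiM {..<n} (\<lambda>_. P)" "PiM {..<m} (\<lambda>_. Q)" by (rule pair_prob_space_samples)
  interpret QP: two_samples Q P by unfold_locales simp_all
  have [measurable]: "h \<in> borel_measurable (PiM {..<n} (\<lambda>_. P) \<Otimes>\<^sub>M PiM {..<m} (\<lambda>_. Q))"
    using assms by (simp add: samples_def)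
  show ?thesis
    unfolding samples_def QP.samples_def
    by (subst AB.distr_pair_swap, subst nn_integral_distr) (auto simp: split_def)
qed

lemma distr_snd_sample:
  assumes j: "j < m" shows "distr (samples n m) borel (\<lambda>z. snd z j) = Q"
proof (rule measure_eqI)
  interpret QP: two_samples Q P by unfold_locales simp_all
  fix A assume "A \<in> sets (distr (samples n m) borel (\<lambda>z. snd z j))"
  then have A [measurable]: "A \<in> sets borel" by simp
  note [measurable] = snd_sample_measurable[OF j] QP.fst_sample_measurable[OF j]
  have "emeasure (distr (samples n m) borel (\<lambda>z. snd z j)) A = (\<integral>\<^sup>+z. indicator A (snd z j) \<partial>samples n m)"
    by (subst nn_integral_indicator[symmetric], simp, subst nn_integral_distr) auto
  also have "\<dots> = (\<integral>\<^sup>+z. indicator A (fst z j) \<partial>QP.samples m n)"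
    by (subst nn_integral_swap_samples) auto
  also have "\<dots> = emeasure (distr (QP.samples m n) borel (\<lambda>z. fst z j)) A"
    by (subst nn_integral_indicator[symmetric], simp, subst nn_integral_distr) auto
  finally show "emeasure (distr (samples n m) borel (\<lambda>z. snd z j)) A = emeasure Q A"
    unfolding QP.distr_fst_sample[OF j] .
qed simp

lemma nn_integral_fst_sample:
  assumes "i < n" "h \<in> borel_measurable borel"
  shows "(\<integral>\<^sup>+z. h (fst z i) \<partial>samples n m) = (\<integral>\<^sup>+x. h x \<partial>P)"
  using nn_integral_distr[OF fst_sample_measurable[OF assms(1)], of h m] assms(2)
  by (simp add: distr_fst_sample[OF assms(1)])

lemma nn_integral_snd_sample:
  assumes "j < m" "h \<in> borel_measurable borel"
  shows "(\<integral>\<^sup>+z. h (snd z j) \<partial>samples n m) = (\<integral>\<^sup>+x. h x \<partial>Q)"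
  using nn_integral_distr[OF snd_sample_measurable[OF assms(1)], of h n] assms(2)
  by (simp add: distr_snd_sample[OF assms(1)])

lemma integrable_fst_sample:
  fixes h :: "'a \<Rightarrow> real"
  assumes "i < n" "h \<in> borel_measurable borel" "integrable P h"
  shows "integrable (samples n m) (\<lambda>z. h (fst z i))" "(\<integral>z. h (fst z i) \<partial>samples n m) = (\<integral>x. h x \<partial>P)"
  using integrable_distr_eq[OF fst_sample_measurable[OF assms(1)], of h m] integral_distr[OF fst_sample_measurable[OF assms(1)], of h m] assms(2,3)
  by (simp_all add: distr_fst_sample[OF assms(1)])

lemma integrable_snd_sample:
  fixes h :: "'a \<Rightarrow> real"
  assumes "j < m" "h \<in> borel_measurable borel" "integrable Q h"
  shows "integrable (samples n m) (\<lambda>z. h (snd z j))" "(\<integral>z. h (snd z j) \<partial>samples n m) = (\<integral>x. h x \<partial>Q)"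
  using integrable_distr_eq[OF snd_sample_measurable[OF assms(1)], of h n] integral_distr[OF snd_sample_measurable[OF assms(1)], of h n] assms(2,3)
  by (simp_all add: distr_snd_sample[OF assms(1)])

lemma AE_fst_sample:
  assumes "AE x in P. x \<in> A" "A \<in> sets borel"
  shows "AE z in samples n m. \<forall>i<n. fst z i \<in> A"
proof -
  have "AE z in samples n m. fst z i \<in> A" if "i < n" for i
    using AE_distrD[OF fst_sample_measurable[OF that], of "\<lambda>x. x \<in> A" m] assms(1)
    unfolding distr_fst_sample[OF that] by simp
  then have "AE z in samples n m. \<forall>i\<in>{..<n}. fst z i \<in> A"
    by (intro AE_finite_allI) auto
  then show ?thesis by (elim eventually_mono) auto
qed

lemma AE_snd_sample:
  assumes "AE x in Q. x \<in> A" "A \<in> sets borel"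
  shows "AE z in samples n m. \<forall>j<m. snd z j \<in> A"
proof -
  have "AE z in samples n m. snd z j \<in> A" if "j < m" for j
    using AE_distrD[OF snd_sample_measurable[OF that], of "\<lambda>x. x \<in> A" n] assms(1)
    unfolding distr_snd_sample[OF that] by simp
  then have "AE z in samples n m. \<forall>j\<in>{..<m}. snd z j \<in> A"
    by (intro AE_finite_allI) auto
  then show ?thesis by (elim eventually_mono) auto
qed

lemma resample_fst_measurable:
  assumes "(\<lambda>z. F (fst z) (snd z)) \<in> borel_measurable (samples n m)" "i < n"
  shows "(\<lambda>w. F ((fst (fst w))(i := snd w)) (snd (fst w))) \<in> borel_measurable (samples n m \<Otimes>\<^sub>M P)"
proof -
  have [measurable]: "(\<lambda>z. (fst (fst z))(i := snd z)) \<in> measurable (samples n m \<Otimes>\<^sub>M P) (PiM {..<n} (\<lambda>_. P))"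
    unfolding samples_def by (rule measurable_fun_upd[where J = "{..<n}"]) (use assms(2) in auto)
  have "(\<lambda>w. ((fst (fst w))(i := snd w), snd (fst w))) \<in> measurable (samples n m \<Otimes>\<^sub>M P) (samples n m)"
    unfolding samples_def by (intro measurable_Pair) (simp_all flip: samples_def, simp add: samples_def)
  from measurable_compose[OF this assms(1)] show ?thesis by simp
qed

lemma pos_var_samples:
  assumes F: "(\<lambda>z. F (fst z) (snd z)) \<in> borel_measurable (samples n m)"
  shows "pos_var (samples n m) (\<lambda>z. F (fst z) (snd z))
    \<le> (\<integral>\<^sup>+z. (\<Sum>i<n. \<integral>\<^sup>+t. ennreal ((max 0 (F ((fst z)(i := t)) (snd z) - F (fst z) (snd z)))\<^sup>2) \<partial>P) \<partial>samples n m)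
      + (\<integral>\<^sup>+z. (\<Sum>j<m. \<integral>\<^sup>+t. ennreal ((max 0 (F (fst z) ((snd z)(j := t)) - F (fst z) (snd z)))\<^sup>2) \<partial>Q) \<partial>samples n m)"
  unfolding samples_def
  by (intro efron_stein_two_samples P.prob_space_axioms Q.prob_space_axioms finite_lessThan F[unfolded samples_def])

lemma nn_integral_sample_pair:
  assumes [measurable]: "(\<lambda>w. g (fst w) (snd w)) \<in> borel_measurable (borel \<Otimes>\<^sub>M borel)"
  shows "(\<integral>\<^sup>+z. (\<Sum>i<n. \<integral>\<^sup>+t. g (fst z i) t \<partial>P) \<partial>samples n m) = of_nat n * (\<integral>\<^sup>+s. \<integral>\<^sup>+t. g s t \<partial>P \<partial>P)"
proof -
  have m: "(\<lambda>s. \<integral>\<^sup>+t. g s t \<partial>P) \<in> borel_measurable borel" by measurable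
  have "(\<integral>\<^sup>+z. (\<Sum>i<n. \<integral>\<^sup>+t. g (fst z i) t \<partial>P) \<partial>samples n m) = (\<Sum>i<n. \<integral>\<^sup>+z. (\<integral>\<^sup>+t. g (fst z i) t \<partial>P) \<partial>samples n m)"
    by (intro nn_integral_sum measurable_compose[OF fst_sample_measurable m]) auto
  also have "\<dots> = (\<Sum>i<n. \<integral>\<^sup>+s. \<integral>\<^sup>+t. g s t \<partial>P \<partial>P)"
    using nn_integral_fst_sample[OF _ m] by (intro sum.cong) auto
  finally show ?thesis by simp
qed

lemma nn_integral_average_snd:
  assumes m: "m \<ge> 1" and [measurable]: "h \<in> borel_measurable borel" and nn: "\<And>y. h y \<ge> 0"
  shows "(\<integral>\<^sup>+z. ennreal ((\<Sum>j<m. h (snd z j)) / real m) \<partial>samples n m) = (\<integral>\<^sup>+y. ennreal (h y) \<partial>Q)"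
proof -
  have "(\<integral>\<^sup>+z. ennreal ((\<Sum>j<m. h (snd z j)) / real m) \<partial>samples n m)
      = (\<integral>\<^sup>+z. (\<Sum>j<m. ennreal (h (snd z j))) * ennreal (1 / real m) \<partial>samples n m)"
    by (intro nn_integral_cong) (simp add: sum_ennreal nn sum_nonneg flip: ennreal_mult)
  also have "\<dots> = (\<Sum>j<m. (\<integral>\<^sup>+y. ennreal (h y) \<partial>Q)) * ennreal (1 / real m)"
  proof -
    have "(\<integral>\<^sup>+z. (\<Sum>j<m. ennreal (h (snd z j))) \<partial>samples n m) = (\<Sum>j<m. \<integral>\<^sup>+z. ennreal (h (snd z j)) \<partial>samples n m)"
      by (intro nn_integral_sum measurable_compose[OF snd_sample_measurable, of _ m "\<lambda>y. ennreal (h y)"]) auto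
    also have "\<dots> = (\<Sum>j<m. (\<integral>\<^sup>+y. ennreal (h y) \<partial>Q))"
      by (intro sum.cong nn_integral_snd_sample[of _ m "\<lambda>y. ennreal (h y)"]) auto
    finally show ?thesis
      by (subst nn_integral_multc, intro borel_measurable_sum measurable_compose[OF snd_sample_measurable, of _ m "\<lambda>y. ennreal (h y)"]) auto
  qed
  also have "\<dots> = (\<integral>\<^sup>+y. ennreal (h y) \<partial>Q) * (ennreal (real m) * ennreal (1 / real m))"
    by (simp add: ennreal_of_nat_eq_real_of_nat mult_ac)
  also have "ennreal (real m) * ennreal (1 / real m) = 1"
    using m by (simp flip: ennreal_mult)
  finally show ?thesis by simp
qed

text \<open>Efron--Stein applied to the empirical frequency of \<open>C\<close> itself bounds its variance by \<open>1 / n\<close>.\<close>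

lemma frequency_fst:
  assumes n: "n \<ge> 1" and C [measurable]: "C \<in> sets borel"
  shows "(\<integral>z. \<bar>(\<Sum>i<n. indicator C (fst z i)) / real n - measure P C\<bar> \<partial>samples n m) \<le> 1 / sqrt (real n)"
    and "(\<lambda>z. (\<Sum>i<n. indicator C (fst z i)) / real n :: real) \<in> borel_measurable (samples n m)"
proof -
  interpret S: prob_space "samples n m" by (rule prob_space_samples)
  define F :: "(nat \<Rightarrow> 'a) \<Rightarrow> (nat \<Rightarrow> 'a) \<Rightarrow> real" where "F x y = (\<Sum>i<n. indicator C (x i)) / real n" for x y
  show F_meas [measurable]: "(\<lambda>z. (\<Sum>i<n. indicator C (fst z i)) / real n :: real) \<in> borel_measurable (samples n m)"
    by (intro borel_measurable_divide borel_measurable_sum measurable_compose[OF fst_sample_measurable, of _ n "indicator C"]) auto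
  then have F_meas' [measurable]: "(\<lambda>z. F (fst z) (snd z)) \<in> borel_measurable (samples n m)" by (simp add: F_def)
  have "(\<Sum>i<n. indicator C (x i)) \<le> (\<Sum>i<n. (1::real))" for x :: "nat \<Rightarrow> 'a"
    by (intro sum_mono) (simp add: indicator_def)
  then have F01: "0 \<le> F x y" "F x y \<le> 1" for x y using n by (auto simp: F_def sum_nonneg)
  have diff: "(max 0 (F (x(i := t)) y - F x y))\<^sup>2 \<le> 1 / (real n)\<^sup>2" if "i < n" for x y i t
  proof -
    have "F (x(i := t)) y - F x y = (indicator C t - indicator C (x i)) / real n"
      using that unfolding F_def by (simp add: sum.remove[of _ i] flip: diff_divide_distrib)
    also have "\<dots> \<le> 1 / real n" by (intro divide_right_mono) (auto simp: indicator_def)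
    finally have "max 0 (F (x(i := t)) y - F x y) \<le> 1 / real n" by simp
    then have "(max 0 (F (x(i := t)) y - F x y))\<^sup>2 \<le> (1 / real n)\<^sup>2" by (intro power_mono) auto
    then show ?thesis by (simp add: power_divide)
  qed
  have int: "integrable (samples n m) (\<lambda>z. F (fst z) (snd z))" "integrable (samples n m) (\<lambda>z. (F (fst z) (snd z))\<^sup>2)"
    using F01 by (auto intro!: S.integrable_const_bound[of _ 1] AE_I2 simp: abs_square_le_1 power_le_one)
  have iC: "integrable P (indicator C :: _ \<Rightarrow> real)"
    by (intro P.integrable_const_bound[of _ 1]) (auto simp: indicator_def)
  have EF: "S.expectation (\<lambda>z. F (fst z) (snd z)) = measure P C"
  proof -
    have "S.expectation (\<lambda>z. F (fst z) (snd z)) = (\<Sum>i<n. S.expectation (\<lambda>z. indicator C (fst z i))) / real n"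
      unfolding F_def using integrable_fst_sample(1)[of _ n "indicator C" m] iC
      by (simp add: Bochner_Integration.integral_sum)
    also have "\<dots> = measure P C"
      using n integrable_fst_sample(2)[of _ n "indicator C" m] iC by simp
    finally show ?thesis .
  qed
  have "ennreal (S.variance (\<lambda>z. F (fst z) (snd z))) = pos_var (samples n m) (\<lambda>z. F (fst z) (snd z))"
    by (intro S.pos_var_eq_variance[symmetric] int) measurable
  also have "\<dots> \<le> (\<integral>\<^sup>+z. (\<Sum>i<n. \<integral>\<^sup>+t. ennreal ((max 0 (F ((fst z)(i := t)) (snd z) - F (fst z) (snd z)))\<^sup>2) \<partial>P) \<partial>samples n m)
      + (\<integral>\<^sup>+z. (\<Sum>j<m. \<integral>\<^sup>+t. ennreal ((max 0 (F (fst z) ((snd z)(j := t)) - F (fst z) (snd z)))\<^sup>2) \<partial>Q) \<partial>samples n m)"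
    by (rule pos_var_samples[OF F_meas'])
  also have "\<dots> = (\<integral>\<^sup>+z. (\<Sum>i<n. \<integral>\<^sup>+t. ennreal ((max 0 (F ((fst z)(i := t)) (snd z) - F (fst z) (snd z)))\<^sup>2) \<partial>P) \<partial>samples n m)"
    by (simp add: F_def)
  also have "\<dots> \<le> (\<integral>\<^sup>+z. (\<Sum>i<n. \<integral>\<^sup>+t. ennreal (1 / (real n)\<^sup>2) \<partial>P) \<partial>samples n m)"
    using diff by (intro nn_integral_mono sum_mono ennreal_leI) auto
  also have "\<dots> = ennreal (1 / real n)"
    using n P.emeasure_space_1 by (simp add: S.emeasure_space_1 ennreal_of_nat_eq_real_of_nat power2_eq_square flip: ennreal_mult)
  finally have var: "S.variance (\<lambda>z. F (fst z) (snd z)) \<le> 1 / real n"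
    by (subst (asm) ennreal_le_iff) auto
  \<comment> \<open>Jensen's inequality, in the form that the variance of the absolute deviation is
    nonnegative.\<close>
  have "(S.expectation (\<lambda>z. \<bar>F (fst z) (snd z) - measure P C\<bar>))\<^sup>2 \<le> S.expectation (\<lambda>z. \<bar>F (fst z) (snd z) - measure P C\<bar>\<^sup>2)"
  proof -
    have i1: "integrable (samples n m) (\<lambda>z. \<bar>F (fst z) (snd z) - measure P C\<bar>)" using int by auto
    have i2: "integrable (samples n m) (\<lambda>z. \<bar>F (fst z) (snd z) - measure P C\<bar>\<^sup>2)"
      using int by (auto simp: power2_diff)
    show ?thesis using S.variance_eq[OF i1 i2] S.variance_positive[of "\<lambda>z. \<bar>F (fst z) (snd z) - measure P C\<bar>"] by linarith
  qed
  also have "\<dots> \<le> 1 / real n" using var by (simp add: EF)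
  finally have "S.expectation (\<lambda>z. \<bar>F (fst z) (snd z) - measure P C\<bar>) \<le> sqrt (1 / real n)" by (rule real_le_rsqrt)
  then show "(\<integral>z. \<bar>(\<Sum>i<n. indicator C (fst z i)) / real n - measure P C\<bar> \<partial>samples n m) \<le> 1 / sqrt (real n)"
    by (simp add: F_def real_sqrt_divide)
qed

lemma distr_samples:
  fixes M :: "'w measure" and X Y :: "nat \<Rightarrow> 'w \<Rightarrow> 'a"
  assumes M: "prob_space M"
    and X_indep: "prob_space.indep_vars M (\<lambda>_. borel) X UNIV" and X_law: "\<And>i. distr M borel (X i) = P"
    and Y_indep: "prob_space.indep_vars M (\<lambda>_. borel) Y UNIV" and Y_law: "\<And>j. distr M borel (Y j) = Q"
    and XY_indep: "prob_space.indep_var M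
          (\<Pi>\<^sub>M i\<in>UNIV. borel) (\<lambda>\<omega> i. X i \<omega>) (\<Pi>\<^sub>M j\<in>UNIV. borel) (\<lambda>\<omega> j. Y j \<omega>)"
    and n: "n \<ge> 1" and m: "m \<ge> 1"
  shows "distr M (samples n m) (\<lambda>\<omega>. (\<lambda>i\<in>{..<n}. X i \<omega>, \<lambda>j\<in>{..<m}. Y j \<omega>)) = samples n m"
    and "(\<lambda>\<omega>. (\<lambda>i\<in>{..<n}. X i \<omega>, \<lambda>j\<in>{..<m}. Y j \<omega>)) \<in> measurable M (samples n m)"
proof -
  interpret M: prob_space M by (rule M)
  let ?S = "PiM {..<n} (\<lambda>_. borel :: 'a measure)" and ?T = "PiM {..<m} (\<lambda>_. borel :: 'a measure)"
  have XS: "distr M ?S (\<lambda>\<omega>. \<lambda>i\<in>{..<n}. X i \<omega>) = PiM {..<n} (\<lambda>_. P)"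
  proof -
    have "M.indep_vars (\<lambda>_. borel) X {..<n}" by (rule M.indep_vars_subset[OF X_indep]) simp
    then have "distr M ?S (\<lambda>\<omega>. \<lambda>i\<in>{..<n}. X i \<omega>) = (\<Pi>\<^sub>M i\<in>{..<n}. distr M borel (X i))"
      using n X_indep by (subst (asm) M.indep_vars_iff_distr_eq_PiM') (auto simp: lessThan_empty_iff M.indep_vars_def)
    then show ?thesis by (simp add: X_law)
  qed
  have YS: "distr M ?T (\<lambda>\<omega>. \<lambda>j\<in>{..<m}. Y j \<omega>) = PiM {..<m} (\<lambda>_. Q)"
  proof -
    have "M.indep_vars (\<lambda>_. borel) Y {..<m}" by (rule M.indep_vars_subset[OF Y_indep]) simp
    then have "distr M ?T (\<lambda>\<omega>. \<lambda>j\<in>{..<m}. Y j \<omega>) = (\<Pi>\<^sub>M j\<in>{..<m}. distr M borel (Y j))"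
      using m Y_indep by (subst (asm) M.indep_vars_iff_distr_eq_PiM') (auto simp: lessThan_empty_iff M.indep_vars_def)
    then show ?thesis by (simp add: Y_law)
  qed
  have "M.indep_var ?S ((\<lambda>x. restrict x {..<n}) \<circ> (\<lambda>\<omega> i. X i \<omega>)) ?T ((\<lambda>x. restrict x {..<m}) \<circ> (\<lambda>\<omega> j. Y j \<omega>))"
    by (rule M.indep_var_compose[OF XY_indep]) (intro measurable_restrict_subset subset_UNIV)+
  then have *: "(\<lambda>\<omega>. \<lambda>i\<in>{..<n}. X i \<omega>) \<in> measurable M ?S" "(\<lambda>\<omega>. \<lambda>j\<in>{..<m}. Y j \<omega>) \<in> measurable M ?T"
    "distr M ?S (\<lambda>\<omega>. \<lambda>i\<in>{..<n}. X i \<omega>) \<Otimes>\<^sub>M distr M ?T (\<lambda>\<omega>. \<lambda>j\<in>{..<m}. Y j \<omega>)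
      = distr M (?S \<Otimes>\<^sub>M ?T) (\<lambda>\<omega>. (\<lambda>i\<in>{..<n}. X i \<omega>, \<lambda>j\<in>{..<m}. Y j \<omega>))"
    unfolding M.indep_var_distribution_eq by (auto simp: comp_def)
  have sets: "sets (samples n m) = sets (?S \<Otimes>\<^sub>M ?T)"
    unfolding samples_def by (intro sets_pair_measure_cong sets_PiM_cong) auto
  show "distr M (samples n m) (\<lambda>\<omega>. (\<lambda>i\<in>{..<n}. X i \<omega>, \<lambda>j\<in>{..<m}. Y j \<omega>)) = samples n m"
    by (rule trans[OF distr_cong[OF refl sets refl]]) (use *(3) in \<open>simp add: XS YS samples_def\<close>)
  show "(\<lambda>\<omega>. (\<lambda>i\<in>{..<n}. X i \<omega>, \<lambda>j\<in>{..<m}. Y j \<omega>)) \<in> measurable M (samples n m)"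
    unfolding measurable_cong_sets[OF refl sets] using *(1,2) by (rule measurable_Pair)
qed

end

section \<open>Barycentres of optimal plans and one-point resampling\<close>

text \<open>Row \<open>i\<close> of an optimal plan, rescaled by \<open>n\<close>, is a probability
  vector \<open>b i\<close> on the columns, and a cost linear in \<open>x i\<close> sees this row
  only through its barycentre \<open>z i\<close>. The third property is the column marginal
  condition. The last one holds because permuting the rows of a plan gives a plan again, whatever
  points \<open>x'\<close> it is then applied to.\<close>

lemma transport_barycentres:
  fixes x y :: "nat \<Rightarrow> 'a::euclidean_space"
  assumes n: "n \<ge> 1" and m: "m \<ge> 1"
  obtains b z where "\<And>i j. i < n \<Longrightarrow> j < m \<Longrightarrow> 0 \<le> b i j"
    and "\<And>i. i < n \<Longrightarrow> (\<Sum>j<m. b i j) = 1"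
    and "\<And>h. (\<Sum>i<n. \<Sum>j<m. b i j * h j) / real n = (\<Sum>j<m. h j) / real m"
    and "\<And>i. i < n \<Longrightarrow> z i = (\<Sum>j<m. b i j *\<^sub>R y j)"
    and "transport_value n m (\<lambda>i j. x i \<bullet> y j) = (\<Sum>i<n. x i \<bullet> z i) / real n"
    and "\<And>x' \<sigma>. \<sigma> permutes {..<n} \<Longrightarrow>
      (\<Sum>i<n. x' (\<sigma> i) \<bullet> z i) / real n \<le> transport_value n m (\<lambda>i j. x' i \<bullet> y j)"
proof -
  obtain a where a: "plan n m a"
    and val: "transport_value n m (\<lambda>i j. x i \<bullet> y j) = (\<Sum>i<n. \<Sum>j<m. a i j * (x i \<bullet> y j))"
    by (rule transport_duality[OF n m, of "\<lambda>i j. x i \<bullet> y j"]) blast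
  define b where "b i j = real n * a i j" for i j
  define z where "z i = (\<Sum>j<m. b i j *\<^sub>R y j)" for i
  have a_eq: "a i j = b i j / real n" for i j using n by (simp add: b_def)
  have cost: "(\<Sum>i<n. \<Sum>j<m. a i j * (w i \<bullet> y j)) = (\<Sum>i<n. w i \<bullet> z i) / real n" for w
    by (simp add: z_def inner_sum_right a_eq sum_divide_distrib)
  show thesis
  proof
    show "0 \<le> b i j" if "i < n" "j < m" for i j using a that by (simp add: b_def plan_def)
    show "(\<Sum>j<m. b i j) = 1" if "i < n" for i
      using a that n by (simp add: b_def plan_def flip: sum_distrib_left)
    show "(\<Sum>i<n. \<Sum>j<m. b i j * h j) / real n = (\<Sum>j<m. h j) / real m" for h
    proof -
      have "(\<Sum>i<n. \<Sum>j<m. b i j * h j) / real n = (\<Sum>j<m. \<Sum>i<n. a i j * h j)"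
        by (subst sum.swap) (simp add: a_eq sum_divide_distrib)
      also have "\<dots> = (\<Sum>j<m. (1 / real m) * h j)"
        using a by (intro sum.cong refl) (simp add: plan_def flip: sum_distrib_right)
      finally show ?thesis by (simp add: sum_divide_distrib)
    qed
    show "z i = (\<Sum>j<m. b i j *\<^sub>R y j)" for i by (rule z_def)
    show "transport_value n m (\<lambda>i j. x i \<bullet> y j) = (\<Sum>i<n. x i \<bullet> z i) / real n"
      unfolding val by (rule cost)
    fix x' \<sigma> assume \<sigma>: "\<sigma> permutes {..<n}"
    have "plan n m (\<lambda>i j. a (inv \<sigma> i) j)"
      unfolding plan_def
    proof (intro conjI allI impI)
      have inv: "inv \<sigma> i < n" if "i < n" for i
        using permutes_in_image[OF permutes_inv[OF \<sigma>], of i] that by simp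
      show "0 \<le> a (inv \<sigma> i) j" if "i < n" "j < m" for i j
        using a inv that by (auto simp: plan_def)
      show "(\<Sum>j<m. a (inv \<sigma> i) j) = 1 / real n" if "i < n" for i
        using a inv that by (auto simp: plan_def)
      show "(\<Sum>i<n. a (inv \<sigma> i) j) = 1 / real m" if "j < m" for j
        using a that sum.permute[OF permutes_inv[OF \<sigma>], of "\<lambda>i. a i j"] by (simp add: plan_def comp_def)
    qed
    from plan_le_transport_value[OF n m this, of "\<lambda>i j. x' i \<bullet> y j"]
    have "(\<Sum>i<n. \<Sum>j<m. a (inv \<sigma> i) j * (x' i \<bullet> y j)) \<le> transport_value n m (\<lambda>i j. x' i \<bullet> y j)" .
    also have "(\<Sum>i<n. \<Sum>j<m. a (inv \<sigma> i) j * (x' i \<bullet> y j)) = (\<Sum>i<n. \<Sum>j<m. a i j * (x' (\<sigma> i) \<bullet> y j))"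
      using sum.permute[OF \<sigma>, of "\<lambda>i. \<Sum>j<m. a (inv \<sigma> i) j * (x' i \<bullet> y j)"]
      by (simp add: comp_def permutes_inverses[OF \<sigma>])
    finally show "(\<Sum>i<n. x' (\<sigma> i) \<bullet> z i) / real n \<le> transport_value n m (\<lambda>i j. x' i \<bullet> y j)"
      using cost[of "\<lambda>i. x' (\<sigma> i)"] by simp
  qed
qed

text \<open>Jensen's inequality for the square, \<open>sq\<close>, applied to the norms and then to
  their squares.\<close>

lemma norm_convex_combination_power4_le:
  fixes y :: "nat \<Rightarrow> 'a::real_normed_vector"
  assumes b: "\<And>j. j < m \<Longrightarrow> 0 \<le> b j" "(\<Sum>j<m. b j) = 1"
  shows "norm (\<Sum>j<m. b j *\<^sub>R y j) ^ 4 \<le> (\<Sum>j<m. b j * norm (y j) ^ 4)"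
proof -
  have sq: "(\<Sum>j<m. b j * t j)\<^sup>2 \<le> (\<Sum>j<m. b j * (t j)\<^sup>2)" for t :: "nat \<Rightarrow> real"
  proof -
    let ?\<mu> = "\<Sum>j<m. b j * t j"
    have "0 \<le> (\<Sum>j<m. b j * (t j - ?\<mu>)\<^sup>2)" using b by (intro sum_nonneg) auto
    also have "\<dots> = (\<Sum>j<m. b j * (t j)\<^sup>2 - 2 * ?\<mu> * (b j * t j) + ?\<mu>\<^sup>2 * b j)"
      by (intro sum.cong) (auto simp: power2_eq_square algebra_simps)
    also have "\<dots> = (\<Sum>j<m. b j * (t j)\<^sup>2) - 2 * ?\<mu> * ?\<mu> + ?\<mu>\<^sup>2 * (\<Sum>j<m. b j)"
      by (simp add: sum.distrib sum_subtractf sum_distrib_left)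
    finally show ?thesis using b(2) by (simp add: power2_eq_square)
  qed
  have "norm (\<Sum>j<m. b j *\<^sub>R y j) \<le> (\<Sum>j<m. b j * norm (y j))"
    using b(1) by (intro order_trans[OF norm_sum] sum_mono) auto
  then have "norm (\<Sum>j<m. b j *\<^sub>R y j) ^ 4 \<le> (\<Sum>j<m. b j * norm (y j)) ^ 4" by (intro power_mono) auto
  also have "\<dots> = ((\<Sum>j<m. b j * norm (y j))\<^sup>2)\<^sup>2" by simp
  also have "\<dots> \<le> (\<Sum>j<m. b j * (norm (y j))\<^sup>2)\<^sup>2" by (intro power_mono sq) auto
  also have "\<dots> \<le> (\<Sum>j<m. b j * ((norm (y j))\<^sup>2)\<^sup>2)" by (rule sq)
  finally show ?thesis by simp
qed

text \<open>The old plan is merely admissible for the new sample, so only this direction is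
  available. It bounds the increments of \<open>empirical_W\<close> and of the gap from
  above.\<close>

lemma transport_value_update_ge:
  fixes x z :: "nat \<Rightarrow> 'a::euclidean_space"
  assumes "i < n" and "transport_value n m (\<lambda>i j. x i \<bullet> y j) = (\<Sum>i<n. x i \<bullet> z i) / real n"
    and "\<And>x' \<sigma>. \<sigma> permutes {..<n} \<Longrightarrow>
      (\<Sum>i<n. x' (\<sigma> i) \<bullet> z i) / real n \<le> transport_value n m (\<lambda>i j. x' i \<bullet> y j)"
  shows "transport_value n m (\<lambda>i j. x i \<bullet> y j) + ((t - x i) \<bullet> z i) / real n
    \<le> transport_value n m (\<lambda>k j. (x(i := t)) k \<bullet> y j)"
proof -
  have "transport_value n m (\<lambda>i j. x i \<bullet> y j) + ((t - x i) \<bullet> z i) / real n = (\<Sum>k<n. (x(i := t)) k \<bullet> z k) / real n"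
    using assms(1) unfolding assms(2)
    by (simp add: sum.remove[of _ i] inner_diff_left flip: add_divide_distrib)
  also have "\<dots> \<le> transport_value n m (\<lambda>k j. (x(i := t)) k \<bullet> y j)"
    using assms(3)[of id "x(i := t)"] by (simp add: permutes_id[unfolded id_def] id_def)
  finally show ?thesis .
qed

context two_samples
begin

text \<open>The half of the Efron--Stein bound that comes from the first sample; the other half is
  the same expression with the roles of \<open>P\<close> and \<open>Q\<close> exchanged.\<close>

definition resample_energy :: "nat \<Rightarrow> nat \<Rightarrow> ((nat \<Rightarrow> 'a) \<Rightarrow> (nat \<Rightarrow> 'a) \<Rightarrow> real) \<Rightarrow> ennreal" where
  "resample_energy n m F =
    (\<integral>\<^sup>+z. (\<Sum>i<n. \<integral>\<^sup>+t. ennreal ((max 0 (F ((fst z)(i := t)) (snd z) - F (fst z) (snd z)))\<^sup>2) \<partial>P) \<partial>samples n m)"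

lemma two_samples_swap: "two_samples Q P"
  by unfold_locales simp_all

lemma pos_var_le_resample_energy:
  assumes F: "(\<lambda>z. F (fst z) (snd z)) \<in> borel_measurable (samples n m)"
  shows "pos_var (samples n m) (\<lambda>z. F (fst z) (snd z))
    \<le> resample_energy n m F + two_samples.resample_energy Q P m n (\<lambda>y x. F x y)"
proof -
  interpret QP: two_samples Q P by (rule two_samples_swap)
  interpret AB: pair_prob_space "PiM {..<m} (\<lambda>_. Q)" "PiM {..<n} (\<lambda>_. P)" by (rule QP.pair_prob_space_samples)
  have sw: "(\<lambda>z. (snd z, fst z)) \<in> measurable (samples n m) (QP.samples m n)"
    "(\<lambda>z. (snd z, fst z)) \<in> measurable (QP.samples m n) (samples n m)"
    unfolding samples_def QP.samples_def by measurable
  have F': "(\<lambda>z. F (snd z) (fst z)) \<in> borel_measurable (QP.samples m n)"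
    using measurable_compose[OF sw(2) F] by simp
  have "(\<lambda>z. \<Sum>j<m. \<integral>\<^sup>+t. ennreal ((max 0 (F (snd z) ((fst z)(j := t)) - F (snd z) (fst z)))\<^sup>2) \<partial>Q) \<in> borel_measurable (QP.samples m n)"
  proof (intro borel_measurable_sum)
    fix j assume "j \<in> {..<m}"
    then have [measurable]: "(\<lambda>w. F (snd (fst w)) ((fst (fst w))(j := snd w))) \<in> borel_measurable (QP.samples m n \<Otimes>\<^sub>M Q)"
      using QP.resample_fst_measurable[of "\<lambda>y x. F x y" m n j] F' by simp
    note [measurable] = F'
    show "(\<lambda>z. \<integral>\<^sup>+t. ennreal ((max 0 (F (snd z) ((fst z)(j := t)) - F (snd z) (fst z)))\<^sup>2) \<partial>Q) \<in> borel_measurable (QP.samples m n)"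
      by measurable
  qed
  from measurable_compose[OF sw(1) this]
  have "(\<lambda>z. \<Sum>j<m. \<integral>\<^sup>+t. ennreal ((max 0 (F (fst z) ((snd z)(j := t)) - F (fst z) (snd z)))\<^sup>2) \<partial>Q) \<in> borel_measurable (samples n m)"
    by simp
  note swap = nn_integral_swap_samples[OF this]
  from pos_var_samples[OF F] show ?thesis
    unfolding resample_energy_def QP.resample_energy_def swap fst_conv snd_conv .
qed

lemma average_fst_measurable:
  "h \<in> borel_measurable borel \<Longrightarrow> (\<lambda>z. (\<Sum>i<n. h (fst z i)) / real n) \<in> borel_measurable (samples n m)"
  by (intro borel_measurable_divide borel_measurable_sum borel_measurable_const
      measurable_compose[OF fst_sample_measurable, of _ n h]) auto

lemma average_snd_measurable:
  "h \<in> borel_measurable borel \<Longrightarrow> (\<lambda>z. (\<Sum>j<m. h (snd z j)) / real m) \<in> borel_measurable (samples n m)"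
  by (intro borel_measurable_divide borel_measurable_sum borel_measurable_const
      measurable_compose[OF snd_sample_measurable, of _ m h]) auto

lemma transport_value_samples_measurable [measurable]:
  "(\<lambda>z. transport_value n m (\<lambda>i j. fst z i \<bullet> snd z j)) \<in> borel_measurable (samples n m)"
  by (intro transport_value_measurable borel_measurable_inner fst_sample_measurable snd_sample_measurable)

lemma empirical_W_measurable:
  assumes "n \<ge> 1" "m \<ge> 1"
  shows "(\<lambda>z. empirical_W n m (fst z) (snd z)) \<in> borel_measurable (samples n m)"
  unfolding empirical_W_eq[OF assms]
  using average_fst_measurable[of "\<lambda>x. (norm x)\<^sup>2" n m] average_snd_measurable[of "\<lambda>y. (norm y)\<^sup>2" m n]
  by simp

text \<open>With \<open>s\<close> the old point, the increment is at most
  \<open>norm (t - s) * (norm t + norm s + 2 * norm (z i)) / n\<close>. The mixed term is separated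
  pointwise, by AM-GM with a free weight \<open>\<theta>\<close>: only the sum of
  \<open>norm (z i) ^ 4\<close>, and not the single barycentre, has a bound that does not depend on
  the plan.\<close>

lemma resample_energy_W:
  assumes n: "n \<ge> 1" and m: "m \<ge> 1" and \<theta>: "\<theta> > 0"
  defines "G \<equiv> \<lambda>s t::'a. norm (s - t) ^ 2 * (4 * norm s ^ 2 + 4 * norm t ^ 2) + 4 * \<theta> * norm (s - t) ^ 4"
  shows "resample_energy n m (empirical_W n m)
    \<le> ennreal (1 / real n) * ((\<integral>\<^sup>+s. \<integral>\<^sup>+t. ennreal (G s t) \<partial>P \<partial>P) + ennreal (4 / \<theta>) * (\<integral>\<^sup>+y. ennreal (norm y ^ 4) \<partial>Q))"
proof -
  have G0: "0 \<le> G s t" for s t using \<theta> by (simp add: G_def)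
  have [measurable]: "(\<lambda>w. G (fst w) (snd w)) \<in> borel_measurable (borel \<Otimes>\<^sub>M borel)" unfolding G_def by measurable
  have [measurable]: "G s \<in> borel_measurable borel" for s unfolding G_def by measurable
  have point: "(\<Sum>i<n. \<integral>\<^sup>+t. ennreal ((max 0 (empirical_W n m (x(i := t)) y - empirical_W n m x y))\<^sup>2) \<partial>P)
      \<le> ennreal (1 / (real n)\<^sup>2) * ((\<Sum>i<n. \<integral>\<^sup>+t. ennreal (G (x i) t) \<partial>P) + ennreal (4 / \<theta> * real n) * ennreal ((\<Sum>j<m. norm (y j) ^ 4) / real m))"
    for x y :: "nat \<Rightarrow> 'a"
  proof (rule transport_barycentres[OF n m, of y x])
    fix b z
    assume b: "\<And>i j. i < n \<Longrightarrow> j < m \<Longrightarrow> 0 \<le> b i j" "\<And>i. i < n \<Longrightarrow> (\<Sum>j<m. b i j) = 1"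
      "\<And>h. (\<Sum>i<n. \<Sum>j<m. b i j * h j) / real n = (\<Sum>j<m. h j) / real m"
      "\<And>i. i < n \<Longrightarrow> z i = (\<Sum>j<m. b i j *\<^sub>R y j)"
      and val: "transport_value n m (\<lambda>i j. x i \<bullet> y j) = (\<Sum>i<n. x i \<bullet> z i) / real n"
      "\<And>x' \<sigma>. \<sigma> permutes {..<n} \<Longrightarrow> (\<Sum>i<n. x' (\<sigma> i) \<bullet> z i) / real n \<le> transport_value n m (\<lambda>i j. x' i \<bullet> y j)"
    have z4: "(\<Sum>i<n. norm (z i) ^ 4) \<le> real n * ((\<Sum>j<m. norm (y j) ^ 4) / real m)"
    proof -
      have "(\<Sum>i<n. norm (z i) ^ 4) \<le> (\<Sum>i<n. \<Sum>j<m. b i j * norm (y j) ^ 4)"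
        using b by (intro sum_mono) (auto intro!: norm_convex_combination_power4_le)
      also have "\<dots> = real n * ((\<Sum>j<m. norm (y j) ^ 4) / real m)"
        using b(3)[of "\<lambda>j. norm (y j) ^ 4"] n by (simp add: field_simps)
      finally show ?thesis .
    qed
    have pt: "(max 0 (empirical_W n m (x(i := t)) y - empirical_W n m x y))\<^sup>2 \<le> 1 / (real n)\<^sup>2 * (G (x i) t + 4 / \<theta> * norm (z i) ^ 4)"
      if i: "i < n" for i t
    proof -
      let ?s = "x i"
      have sums: "(\<Sum>k<n. (norm ((x(i := t)) k))\<^sup>2) / real n - (\<Sum>k<n. (norm (x k))\<^sup>2) / real n = ((norm t)\<^sup>2 - (norm ?s)\<^sup>2) / real n"
        using i by (simp add: sum.remove[of _ i] flip: diff_divide_distrib)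
      have "empirical_W n m (x(i := t)) y - empirical_W n m x y \<le> ((norm t)\<^sup>2 - (norm ?s)\<^sup>2) / real n - 2 * (((t - ?s) \<bullet> z i) / real n)"
        using transport_value_update_ge[OF i val, of t] sums unfolding empirical_W_eq[OF n m] by linarith
      also have "\<dots> = ((norm t)\<^sup>2 - (norm ?s)\<^sup>2 - 2 * ((t - ?s) \<bullet> z i)) / real n" by (simp add: diff_divide_distrib)
      also have "(norm t)\<^sup>2 - (norm ?s)\<^sup>2 - 2 * ((t - ?s) \<bullet> z i) = (t - ?s) \<bullet> (t + ?s - 2 *\<^sub>R z i)"
        by (simp add: power2_norm_eq_inner inner_diff_left inner_diff_right inner_add_right inner_commute)
      also have "\<dots> / real n \<le> norm (t - ?s) * (norm t + norm ?s + 2 * norm (z i)) / real n"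
      proof (intro divide_right_mono order_trans[OF norm_cauchy_schwarz] mult_left_mono)
        show "norm (t + ?s - 2 *\<^sub>R z i) \<le> norm t + norm ?s + 2 * norm (z i)"
          using norm_triangle_ineq4[of "t + ?s" "2 *\<^sub>R z i"] norm_triangle_ineq[of t ?s] by simp
      qed auto
      finally have "empirical_W n m (x(i := t)) y - empirical_W n m x y \<le> norm (t - ?s) * (norm t + norm ?s + 2 * norm (z i)) / real n" .
      then have "max 0 (empirical_W n m (x(i := t)) y - empirical_W n m x y) \<le> norm (t - ?s) * (norm t + norm ?s + 2 * norm (z i)) / real n"
        by (intro max.boundedI) auto
      then have "(max 0 (empirical_W n m (x(i := t)) y - empirical_W n m x y))\<^sup>2 \<le> (norm (t - ?s) * (norm t + norm ?s + 2 * norm (z i)) / real n)\<^sup>2"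
        by (intro power_mono) auto
      also have "\<dots> = 1 / (real n)\<^sup>2 * ((norm (t - ?s))\<^sup>2 * (norm t + norm ?s + 2 * norm (z i))\<^sup>2)"
        by (simp add: power_mult_distrib power_divide)
      also have "\<dots> \<le> 1 / (real n)\<^sup>2 * (G ?s t + 4 / \<theta> * norm (z i) ^ 4)"
      proof (intro mult_left_mono)
        let ?d = "(norm (t - ?s))\<^sup>2" and ?q = "(norm (z i))\<^sup>2"
        \<comment> \<open>The constants 4, 4, 8 come from \<open>(p + q + 2 * r)\<^sup>2 \<le> 2 *
          (p + q)\<^sup>2 + 8 * r\<^sup>2\<close> followed by
          \<open>(p + q)\<^sup>2 \<le> 2 * p\<^sup>2 + 2 * q\<^sup>2\<close>. They are the origin of
          the factor 8 in the constants of the variance bound.\<close>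
        have "(p + q + 2 * r)\<^sup>2 \<le> 4 * p\<^sup>2 + 4 * q\<^sup>2 + 8 * r\<^sup>2" for p q r :: real
          using zero_le_power2[of "p - q"] zero_le_power2[of "p + q - 2 * r"]
          by (simp add: power2_eq_square algebra_simps)
        then have "?d * (norm t + norm ?s + 2 * norm (z i))\<^sup>2 \<le> ?d * (4 * (norm t)\<^sup>2 + 4 * (norm ?s)\<^sup>2 + 8 * ?q)"
          by (intro mult_left_mono) auto
        also have "\<dots> = ?d * (4 * (norm ?s)\<^sup>2 + 4 * (norm t)\<^sup>2) + 8 * ?d * ?q" by (simp add: algebra_simps)
        also have "8 * ?d * ?q \<le> 4 * \<theta> * ?d\<^sup>2 + 4 / \<theta> * ?q\<^sup>2"
        proof -
          have "0 \<le> 4 / \<theta> * (\<theta> * ?d - ?q)\<^sup>2" using \<theta> by simp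
          also have "\<dots> = 4 * \<theta> * ?d\<^sup>2 + 4 / \<theta> * ?q\<^sup>2 - 8 * ?d * ?q"
            using \<theta> by (simp add: power2_eq_square field_simps)
          finally show ?thesis by simp
        qed
        finally show "?d * (norm t + norm ?s + 2 * norm (z i))\<^sup>2 \<le> G ?s t + 4 / \<theta> * norm (z i) ^ 4"
          by (simp add: G_def norm_minus_commute)
      qed auto
      finally show ?thesis .
    qed
    have "(\<Sum>i<n. \<integral>\<^sup>+t. ennreal ((max 0 (empirical_W n m (x(i := t)) y - empirical_W n m x y))\<^sup>2) \<partial>P)
        \<le> (\<Sum>i<n. \<integral>\<^sup>+t. ennreal (1 / (real n)\<^sup>2) * (ennreal (G (x i) t) + ennreal (4 / \<theta> * norm (z i) ^ 4)) \<partial>P)"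
      using pt G0 \<theta> by (intro sum_mono nn_integral_mono) (auto simp flip: ennreal_plus ennreal_mult intro!: ennreal_leI)
    also have "\<dots> = (\<Sum>i<n. ennreal (1 / (real n)\<^sup>2) * ((\<integral>\<^sup>+t. ennreal (G (x i) t) \<partial>P) + ennreal (4 / \<theta> * norm (z i) ^ 4)))"
      using P.emeasure_space_1 by (intro sum.cong refl) (simp add: nn_integral_cmult nn_integral_add)
    also have "\<dots> = ennreal (1 / (real n)\<^sup>2) * ((\<Sum>i<n. \<integral>\<^sup>+t. ennreal (G (x i) t) \<partial>P) + ennreal (\<Sum>i<n. 4 / \<theta> * norm (z i) ^ 4))"
      using \<theta> by (simp add: sum_distrib_left[symmetric] sum.distrib)
    also have "\<dots> \<le> ennreal (1 / (real n)\<^sup>2) * ((\<Sum>i<n. \<integral>\<^sup>+t. ennreal (G (x i) t) \<partial>P) + ennreal (4 / \<theta> * real n) * ennreal ((\<Sum>j<m. norm (y j) ^ 4) / real m))"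
    proof (intro mult_left_mono add_left_mono)
      have "(\<Sum>i<n. 4 / \<theta> * norm (z i) ^ 4) \<le> 4 / \<theta> * real n * ((\<Sum>j<m. norm (y j) ^ 4) / real m)"
        using mult_left_mono[OF z4, of "4 / \<theta>"] \<theta> by (simp add: sum_distrib_left mult.assoc)
      then show "ennreal (\<Sum>i<n. 4 / \<theta> * norm (z i) ^ 4) \<le> ennreal (4 / \<theta> * real n) * ennreal ((\<Sum>j<m. norm (y j) ^ 4) / real m)"
        using \<theta> by (subst ennreal_mult[symmetric]) (auto intro!: ennreal_leI divide_nonneg_nonneg sum_nonneg)
    qed auto
    finally show ?thesis .
  qed
  have "resample_energy n m (empirical_W n m)
      \<le> (\<integral>\<^sup>+z. ennreal (1 / (real n)\<^sup>2) * ((\<Sum>i<n. \<integral>\<^sup>+t. ennreal (G (fst z i) t) \<partial>P) + ennreal (4 / \<theta> * real n) * ennreal ((\<Sum>j<m. norm (snd z j) ^ 4) / real m)) \<partial>samples n m)"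
    unfolding resample_energy_def by (intro nn_integral_mono point)
  also have "\<dots> = ennreal (1 / (real n)\<^sup>2) * ((\<integral>\<^sup>+z. (\<Sum>i<n. \<integral>\<^sup>+t. ennreal (G (fst z i) t) \<partial>P) \<partial>samples n m)
      + ennreal (4 / \<theta> * real n) * (\<integral>\<^sup>+z. ennreal ((\<Sum>j<m. norm (snd z j) ^ 4) / real m) \<partial>samples n m))"
  proof -
    have 1: "(\<lambda>z. (\<Sum>i<n. \<integral>\<^sup>+t. ennreal (G (fst z i) t) \<partial>P)) \<in> borel_measurable (samples n m)"
    proof (intro borel_measurable_sum)
      fix i assume "i \<in> {..<n}"
      have "(\<lambda>s. \<integral>\<^sup>+t. ennreal (G s t) \<partial>P) \<in> borel_measurable borel" by measurable
      from measurable_compose[OF fst_sample_measurable this] \<open>i \<in> {..<n}\<close>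
      show "(\<lambda>z. \<integral>\<^sup>+t. ennreal (G (fst z i) t) \<partial>P) \<in> borel_measurable (samples n m)" by simp
    qed
    have 2: "(\<lambda>z. ennreal ((\<Sum>j<m. norm (snd z j) ^ 4) / real m)) \<in> borel_measurable (samples n m)"
      using average_snd_measurable[of "\<lambda>y. norm y ^ 4" m n] by simp
    show ?thesis using 1 2 by (simp add: nn_integral_cmult nn_integral_add)
  qed
  also have "(\<integral>\<^sup>+z. (\<Sum>i<n. \<integral>\<^sup>+t. ennreal (G (fst z i) t) \<partial>P) \<partial>samples n m) = of_nat n * (\<integral>\<^sup>+s. \<integral>\<^sup>+t. ennreal (G s t) \<partial>P \<partial>P)"
    by (rule nn_integral_sample_pair) measurable
  also have "(\<integral>\<^sup>+z. ennreal ((\<Sum>j<m. norm (snd z j) ^ 4) / real m) \<partial>samples n m) = (\<integral>\<^sup>+y. ennreal (norm y ^ 4) \<partial>Q)"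
    by (rule nn_integral_average_snd[OF m]) auto
  also have "ennreal (1 / (real n)\<^sup>2) * (of_nat n * (\<integral>\<^sup>+s. \<integral>\<^sup>+t. ennreal (G s t) \<partial>P \<partial>P) + ennreal (4 / \<theta> * real n) * (\<integral>\<^sup>+y. ennreal (norm y ^ 4) \<partial>Q))
      = ennreal (1 / real n) * ((\<integral>\<^sup>+s. \<integral>\<^sup>+t. ennreal (G s t) \<partial>P \<partial>P) + ennreal (4 / \<theta>) * (\<integral>\<^sup>+y. ennreal (norm y ^ 4) \<partial>Q))"
  proof -
    have "ennreal (1 / (real n)\<^sup>2) * of_nat n = ennreal (1 / real n)"
      using n by (simp add: ennreal_of_nat_eq_real_of_nat power2_eq_square flip: ennreal_mult)
    moreover have "ennreal (4 / \<theta> * real n) = of_nat n * ennreal (4 / \<theta>)"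
      using \<theta> by (simp add: ennreal_of_nat_eq_real_of_nat mult.commute flip: ennreal_mult)
    ultimately show ?thesis by (simp add: distrib_left mult.assoc[symmetric])
  qed
  finally show ?thesis .
qed

end

section \<open>The variance bound\<close>

text \<open>Half the squared norms are admissible potentials for both signs of the inner product;
  the lower bound tests the optimal plan against the negated cost.\<close>

lemma abs_transport_value_inner_le:
  fixes x y :: "nat \<Rightarrow> 'a::euclidean_space"
  assumes n: "n \<ge> 1" and m: "m \<ge> 1"
  shows "\<bar>transport_value n m (\<lambda>i j. x i \<bullet> y j)\<bar>
    \<le> ((\<Sum>i<n. (norm (x i))\<^sup>2) / real n + (\<Sum>j<m. (norm (y j))\<^sup>2) / real m) / 2"
proof -
  let ?u = "\<lambda>i. (norm (x i))\<^sup>2 / 2" and ?v = "\<lambda>j. (norm (y j))\<^sup>2 / 2"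
  have uv: "(\<Sum>i<n. ?u i) / real n + (\<Sum>j<m. ?v j) / real m
      = ((\<Sum>i<n. (norm (x i))\<^sup>2) / real n + (\<Sum>j<m. (norm (y j))\<^sup>2) / real m) / 2"
    by (simp add: add_divide_distrib flip: sum_divide_distrib)
  have young: "s \<bullet> t \<le> (norm s)\<^sup>2 / 2 + (norm t)\<^sup>2 / 2" "- (s \<bullet> t) \<le> (norm s)\<^sup>2 / 2 + (norm t)\<^sup>2 / 2" for s t :: 'a
    using inner_ge_zero[of "s - t"] inner_ge_zero[of "s + t"]
    by (simp_all add: power2_norm_eq_inner inner_diff_left inner_diff_right inner_add_left inner_add_right inner_commute)
  obtain a where a: "plan n m a" and val: "transport_value n m (\<lambda>i j. x i \<bullet> y j) = (\<Sum>i<n. \<Sum>j<m. a i j * (x i \<bullet> y j))"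
    by (rule transport_duality[OF n m, of "\<lambda>i j. x i \<bullet> y j"]) blast
  have "transport_value n m (\<lambda>i j. x i \<bullet> y j) \<le> (\<Sum>i<n. ?u i) / real n + (\<Sum>j<m. ?v j) / real m"
    unfolding val using young(1) by (intro plan_weak_duality a)
  moreover have "(\<Sum>i<n. \<Sum>j<m. a i j * (- (x i \<bullet> y j))) \<le> (\<Sum>i<n. ?u i) / real n + (\<Sum>j<m. ?v j) / real m"
    using young(2) by (intro plan_weak_duality a)
  ultimately show ?thesis unfolding uv val by (simp add: sum_negf abs_le_iff)
qed

lemma average_power2_le:
  fixes h :: "nat \<Rightarrow> real"
  assumes "n \<ge> 1"
  shows "((\<Sum>i<n. h i) / real n)\<^sup>2 \<le> (\<Sum>i<n. (h i)\<^sup>2) / real n"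
proof -
  have "((\<Sum>i<n. h i) / real n)\<^sup>2 \<le> (\<Sum>i<n. (h i)\<^sup>2) * real n / (real n)\<^sup>2"
    unfolding power_divide using sum_squared_le_sum_of_squares[of h "{..<n}"] by (intro divide_right_mono) auto
  then show ?thesis using assms by (simp add: power2_eq_square)
qed

text \<open>The weight \<open>\<theta> = sqrt b / sqrt a\<close> would balance the two terms. Since
  \<open>a\<close> or \<open>b\<close> may vanish, both roots are shifted by
  \<open>\<epsilon>\<close>, at the price of an error linear in \<open>\<epsilon>\<close> that
  disappears in the limit.\<close>

lemma le_sqrt_mult_if_le_AM_GM:
  fixes v c k a b :: real
  assumes le: "\<And>\<theta>. \<theta> > 0 \<Longrightarrow> v \<le> c + k * (4 * \<theta> * a + 4 / \<theta> * b)" and nn: "k \<ge> 0" "a \<ge> 0" "b \<ge> 0"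
  shows "v \<le> c + k * (8 * (sqrt a * sqrt b))"
proof -
  have "((\<lambda>\<epsilon>. c + k * (8 * (sqrt a * sqrt b) + 4 * \<epsilon> * (sqrt a + sqrt b))) \<longlongrightarrow> c + k * (8 * (sqrt a * sqrt b) + 4 * 0 * (sqrt a + sqrt b))) (at_right 0)"
    by (intro tendsto_intros)
  moreover have "\<forall>\<^sub>F \<epsilon> in at_right 0. v \<le> c + k * (8 * (sqrt a * sqrt b) + 4 * \<epsilon> * (sqrt a + sqrt b))"
    unfolding eventually_at_right_field
  proof (intro exI[of _ 1] conjI allI impI)
    fix \<epsilon> :: real assume \<epsilon>: "0 < \<epsilon>"
    let ?A = "sqrt a" and ?B = "sqrt b" and ?\<theta> = "(sqrt b + \<epsilon>) / (sqrt a + \<epsilon>)"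
    have pos: "?A + \<epsilon> > 0" "?B + \<epsilon> > 0" using \<epsilon> nn by (auto intro: add_nonneg_pos)
    have "v \<le> c + k * (4 * ?\<theta> * a + 4 / ?\<theta> * b)" using pos by (intro le) auto
    also have "?\<theta> * a = (?B + \<epsilon>) * (?A * (?A / (?A + \<epsilon>)))" using nn by simp
    also have "4 * \<dots> = 4 * ((?B + \<epsilon>) * (?A * (?A / (?A + \<epsilon>))))" by simp
    finally have 1: "v \<le> c + k * (4 * ?\<theta> * a + 4 / ?\<theta> * b)" using pos by (intro le) auto
    have "?\<theta> * a = (?B + \<epsilon>) * (?A * (?A / (?A + \<epsilon>)))" using nn by simp
    also have "\<dots> \<le> (?B + \<epsilon>) * (?A * 1)" using pos nn \<epsilon> by (intro mult_left_mono) (auto simp: divide_le_eq)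
    finally have 2: "?\<theta> * a \<le> (?B + \<epsilon>) * ?A" by simp
    have "1 / ?\<theta> * b = (?A + \<epsilon>) * (?B * (?B / (?B + \<epsilon>)))" using nn by simp
    also have "\<dots> \<le> (?A + \<epsilon>) * (?B * 1)" using pos nn \<epsilon> by (intro mult_left_mono) (auto simp: divide_le_eq)
    finally have 3: "1 / ?\<theta> * b \<le> (?A + \<epsilon>) * ?B" by simp
    have "4 * ?\<theta> * a + 4 / ?\<theta> * b = 4 * (?\<theta> * a) + 4 * (1 / ?\<theta> * b)" by (simp only: mult.assoc times_divide_eq_left mult_1)
    also have "\<dots> \<le> 4 * ((?B + \<epsilon>) * ?A) + 4 * ((?A + \<epsilon>) * ?B)" using 2 3 by linarith
    also have "\<dots> = 8 * (?A * ?B) + 4 * \<epsilon> * (?A + ?B)" by (simp add: algebra_simps)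
    finally have "k * (4 * ?\<theta> * a + 4 / ?\<theta> * b) \<le> k * (8 * (?A * ?B) + 4 * \<epsilon> * (?A + ?B))"
      using nn by (intro mult_left_mono)
    then show "v \<le> c + k * (8 * (?A * ?B) + 4 * \<epsilon> * (?A + ?B))" using 1 by linarith
  qed simp
  ultimately have "v \<le> c + k * (8 * (sqrt a * sqrt b) + 4 * 0 * (sqrt a + sqrt b))"
    by (intro tendsto_lowerbound[where F = "at_right 0"]) auto
  then show ?thesis by simp
qed

lemma norm_diff_power4_le: "norm (s - t) ^ 4 \<le> 8 * (norm s ^ 4 + norm t ^ 4)" for s t :: "'a::real_normed_vector"
proof -
  have "norm (s - t) ^ 4 \<le> (norm s + norm t) ^ 4" by (intro power_mono norm_triangle_ineq4) auto
  also have "\<dots> \<le> 8 * (norm s ^ 4 + norm t ^ 4)"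
  proof -
    have sq: "(p + q)\<^sup>2 \<le> 2 * (p\<^sup>2 + q\<^sup>2)" for p q :: real
      using zero_le_power2[of "p - q"] by (simp add: power2_eq_square algebra_simps)
    have "(norm s + norm t) ^ 4 = ((norm s + norm t)\<^sup>2)\<^sup>2" by simp
    also have "\<dots> \<le> (2 * ((norm s)\<^sup>2 + (norm t)\<^sup>2))\<^sup>2" by (intro power_mono sq) auto
    also have "\<dots> = 4 * ((norm s)\<^sup>2 + (norm t)\<^sup>2)\<^sup>2" by (simp only: power_mult_distrib) simp
    also have "\<dots> \<le> 4 * (2 * (((norm s)\<^sup>2)\<^sup>2 + ((norm t)\<^sup>2)\<^sup>2))" by (intro mult_left_mono sq) auto
    finally show ?thesis by simp
  qed
  finally show ?thesis .
qed

context two_samples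
begin

lemma integrable_average_fst:
  fixes h :: "'a \<Rightarrow> real"
  assumes "h \<in> borel_measurable borel" "integrable P h"
  shows "integrable (samples n m) (\<lambda>z. (\<Sum>i<n. h (fst z i)) / real n)"
    and "n \<ge> 1 \<Longrightarrow> (\<integral>z. (\<Sum>i<n. h (fst z i)) / real n \<partial>samples n m) = (\<integral>x. h x \<partial>P)"
proof -
  note int = integrable_fst_sample[OF _ assms, of _ n m]
  have "integrable (samples n m) (\<lambda>z. \<Sum>i<n. h (fst z i))" by (intro Bochner_Integration.integrable_sum int(1)) auto
  then show "integrable (samples n m) (\<lambda>z. (\<Sum>i<n. h (fst z i)) / real n)" by simp
  show "(\<integral>z. (\<Sum>i<n. h (fst z i)) / real n \<partial>samples n m) = (\<integral>x. h x \<partial>P)" if "n \<ge> 1"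
    using that int by (simp add: Bochner_Integration.integral_sum)
qed

lemma integrable_average_snd:
  fixes h :: "'a \<Rightarrow> real"
  assumes "h \<in> borel_measurable borel" "integrable Q h"
  shows "integrable (samples n m) (\<lambda>z. (\<Sum>j<m. h (snd z j)) / real m)"
    and "m \<ge> 1 \<Longrightarrow> (\<integral>z. (\<Sum>j<m. h (snd z j)) / real m \<partial>samples n m) = (\<integral>x. h x \<partial>Q)"
proof -
  note int = integrable_snd_sample[OF _ assms, of _ m n]
  have "integrable (samples n m) (\<lambda>z. \<Sum>j<m. h (snd z j))" by (intro Bochner_Integration.integrable_sum int(1)) auto
  then show "integrable (samples n m) (\<lambda>z. (\<Sum>j<m. h (snd z j)) / real m)" by simp
  show "(\<integral>z. (\<Sum>j<m. h (snd z j)) / real m \<partial>samples n m) = (\<integral>x. h x \<partial>Q)" if "m \<ge> 1"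
    using that int by (simp add: Bochner_Integration.integral_sum)
qed

lemma integrable_transport_value_square:
  assumes n: "n \<ge> 1" and m: "m \<ge> 1" and P4: "integrable P (\<lambda>x. norm x ^ 4)" and Q4: "integrable Q (\<lambda>y. norm y ^ 4)"
  shows "integrable (samples n m) (\<lambda>z. (transport_value n m (\<lambda>i j. fst z i \<bullet> snd z j))\<^sup>2)"
proof (rule Bochner_Integration.integrable_bound)
  let ?A = "\<lambda>x. (\<Sum>i<n. norm (x i) ^ 4) / real n" and ?B = "\<lambda>y. (\<Sum>j<m. norm (y j) ^ 4) / real m"
  show "integrable (samples n m) (\<lambda>z. ?A (fst z) + ?B (snd z))"
    using integrable_average_fst(1)[OF _ P4] integrable_average_snd(1)[OF _ Q4] by auto
  have "(transport_value n m (\<lambda>i j. x i \<bullet> y j))\<^sup>2 \<le> ?A x + ?B y" for x y :: "nat \<Rightarrow> 'a"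
  proof -
    let ?a = "(\<Sum>i<n. (norm (x i))\<^sup>2) / real n" and ?b = "(\<Sum>j<m. (norm (y j))\<^sup>2) / real m"
    have "(transport_value n m (\<lambda>i j. x i \<bullet> y j))\<^sup>2 \<le> ((?a + ?b) / 2)\<^sup>2"
      using abs_transport_value_inner_le[OF n m, of x y] by (metis abs_ge_zero power2_abs power_mono)
    also have "\<dots> \<le> ?a\<^sup>2 + ?b\<^sup>2"
    proof -
      have "((p + q) / 2)\<^sup>2 \<le> p\<^sup>2 + q\<^sup>2" for p q :: real
      proof -
        have "((p + q) / 2)\<^sup>2 = (p\<^sup>2 + q\<^sup>2 + 2 * p * q) / 4" by (simp add: power_divide power2_sum)
        moreover have "(a + b + c) / 4 \<le> a + b" if "c \<le> a + b" "0 \<le> a" "0 \<le> b" for a b c :: real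
          using that by simp
        ultimately show ?thesis using sum_squares_bound[of p q] by (metis zero_le_power2)
      qed
      then show ?thesis .
    qed
    also have "\<dots> \<le> ?A x + ?B y"
      using average_power2_le[OF n, of "\<lambda>i. (norm (x i))\<^sup>2"] average_power2_le[OF m, of "\<lambda>j. (norm (y j))\<^sup>2"] by simp
    finally show ?thesis .
  qed
  moreover have "0 \<le> ?A x + ?B y" for x y :: "nat \<Rightarrow> 'a" by (intro add_nonneg_nonneg divide_nonneg_nonneg sum_nonneg) auto
  ultimately show "AE z in samples n m. norm ((transport_value n m (\<lambda>i j. fst z i \<bullet> snd z j))\<^sup>2) \<le> norm (?A (fst z) + ?B (snd z))"
    by (intro AE_I2) simp
qed measurable

lemma integrable_W_square:
  assumes n: "n \<ge> 1" and m: "m \<ge> 1" and P4: "integrable P (\<lambda>x. norm x ^ 4)" and Q4: "integrable Q (\<lambda>y. norm y ^ 4)"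
  shows "integrable (samples n m) (\<lambda>z. (empirical_W n m (fst z) (snd z))\<^sup>2)"
proof (rule Bochner_Integration.integrable_bound)
  let ?A = "\<lambda>x. (\<Sum>i<n. norm (x i) ^ 4) / real n" and ?B = "\<lambda>y. (\<Sum>j<m. norm (y j) ^ 4) / real m"
  let ?T = "\<lambda>x y. transport_value n m (\<lambda>i j. x i \<bullet> y j)"
  show "integrable (samples n m) (\<lambda>z. 3 * (?A (fst z) + ?B (snd z) + 4 * (?T (fst z) (snd z))\<^sup>2))"
    by (intro integrable_mult_right Bochner_Integration.integrable_add integrable_average_fst(1)[OF _ P4]
        integrable_average_snd(1)[OF _ Q4] integrable_transport_value_square[OF assms]) auto
  have "(empirical_W n m x y)\<^sup>2 \<le> 3 * (?A x + ?B y + 4 * (?T x y)\<^sup>2)" for x y :: "nat \<Rightarrow> 'a"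
  proof -
    have "(p + q - 2 * r)\<^sup>2 \<le> 3 * (p\<^sup>2 + q\<^sup>2 + 4 * r\<^sup>2)" for p q r :: real
      using zero_le_power2[of "p - q"] zero_le_power2[of "p + 2 * r"] zero_le_power2[of "q + 2 * r"]
      by (simp add: power2_eq_square algebra_simps)
    from this[of "(\<Sum>i<n. (norm (x i))\<^sup>2) / real n" "(\<Sum>j<m. (norm (y j))\<^sup>2) / real m" "?T x y"]
    show ?thesis
      unfolding empirical_W_eq[OF n m]
      using average_power2_le[OF n, of "\<lambda>i. (norm (x i))\<^sup>2"] average_power2_le[OF m, of "\<lambda>j. (norm (y j))\<^sup>2"] by simp
  qed
  then have "norm ((empirical_W n m x y)\<^sup>2) \<le> norm (3 * (?A x + ?B y + 4 * (?T x y)\<^sup>2))" for x y :: "nat \<Rightarrow> 'a"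
    unfolding real_norm_def abs_power2 by (rule order_trans[OF _ abs_ge_self])
  then show "AE z in samples n m. norm ((empirical_W n m (fst z) (snd z))\<^sup>2) \<le> norm (3 * (?A (fst z) + ?B (snd z) + 4 * (?T (fst z) (snd z))\<^sup>2))"
    by (intro AE_I2)
qed (use empirical_W_measurable[OF n m] in measurable)

text \<open>The constant of part (i) is produced by optimizing over the parameter \<open>\<theta>\<close>.\<close>

lemma variance_constant:
  assumes M: "prob_space M"
    and X_indep: "prob_space.indep_vars M (\<lambda>_. borel) X (UNIV :: nat set)" and X_law: "\<And>i. distr M borel (X i) = P"
    and P4: "integrable P (\<lambda>x. norm x ^ 4)" and \<theta>: "\<theta> > 0"
  shows "(\<integral>\<^sup>+s. \<integral>\<^sup>+t. ennreal (norm (s - t) ^ 2 * (4 * norm s ^ 2 + 4 * norm t ^ 2) + 4 * \<theta> * norm (s - t) ^ 4) \<partial>P \<partial>P)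
    = ennreal (8 * (\<integral>\<omega>. norm (X 0 \<omega> - X 1 \<omega>) ^ 2 * norm (X 0 \<omega>) ^ 2 \<partial>M) + 4 * \<theta> * (\<integral>\<omega>. norm (X 0 \<omega> - X 1 \<omega>) ^ 4 \<partial>M))"
proof -
  interpret M: prob_space M by (rule M)
  interpret PP: pair_sigma_finite P P ..
  have rv [measurable]: "X i \<in> borel_measurable M" for i using X_indep by (simp add: M.indep_vars_def)
  have "M.indep_vars (\<lambda>_. borel) X {0, 1}" by (rule M.indep_vars_subset[OF X_indep]) simp
  then have law: "distr M (PiM {0, 1} (\<lambda>_. borel)) (\<lambda>\<omega>. \<lambda>i\<in>{0, 1}. X i \<omega>) = PiM {0, 1} (\<lambda>_. P)"
    by (subst (asm) M.indep_vars_iff_distr_eq_PiM') (auto simp: X_law)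
  interpret Pi: product_sigma_finite "\<lambda>_::nat. P" ..
  have fub: "(\<integral>\<^sup>+s. \<integral>\<^sup>+t. ennreal (h s t) \<partial>P \<partial>P) = (\<integral>\<^sup>+\<omega>. ennreal (h (X 0 \<omega>) (X 1 \<omega>)) \<partial>M)"
    if h [measurable]: "(\<lambda>w. h (fst w) (snd w)) \<in> borel_measurable (borel \<Otimes>\<^sub>M borel)" for h :: "'a \<Rightarrow> 'a \<Rightarrow> real"
  proof -
    have "(\<integral>\<^sup>+s. \<integral>\<^sup>+t. ennreal (h s t) \<partial>P \<partial>P) = (\<integral>\<^sup>+w. ennreal (h (fst w) (snd w)) \<partial>(P \<Otimes>\<^sub>M P))"
      by (subst P.nn_integral_fst[symmetric]) auto
    also have "\<dots> = (\<integral>\<^sup>+w. ennreal (h (w 0) (w 1)) \<partial>PiM {0, 1::nat} (\<lambda>_. P))"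
      by (rule Pi.product_nn_integral_pair[of "\<lambda>s t. ennreal (h s t)", symmetric]) (auto simp: split_def)
    also have "\<dots> = (\<integral>\<^sup>+\<omega>. ennreal (h (X 0 \<omega>) (X 1 \<omega>)) \<partial>M)"
    proof -
      have "(\<lambda>w. (w 0, w 1)) \<in> measurable (PiM {0, 1::nat} (\<lambda>_. borel :: 'a measure)) (borel \<Otimes>\<^sub>M borel)" by measurable
      from measurable_compose[OF this h]
      show ?thesis unfolding law[symmetric] by (subst nn_integral_distr) auto
    qed
    finally show ?thesis .
  qed
  have X4: "integrable M (\<lambda>\<omega>. norm (X i \<omega>) ^ 4)" for i
    using P4 unfolding X_law[symmetric, of i] by (subst (asm) integrable_distr_eq) auto
  let ?\<alpha> = "\<lambda>\<omega>. norm (X 0 \<omega> - X 1 \<omega>) ^ 2 * norm (X 0 \<omega>) ^ 2" and ?\<beta> = "\<lambda>\<omega>. norm (X 0 \<omega> - X 1 \<omega>) ^ 4"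
  have i\<beta>: "integrable M ?\<beta>"
    by (rule Bochner_Integration.integrable_bound[of _ "\<lambda>\<omega>. 8 * (norm (X 0 \<omega>) ^ 4 + norm (X 1 \<omega>) ^ 4)"])
       (use X4 norm_diff_power4_le in auto)
  have i\<alpha>: "integrable M ?\<alpha>"
  proof (rule Bochner_Integration.integrable_bound[of _ "\<lambda>\<omega>. ?\<beta> \<omega> + norm (X 0 \<omega>) ^ 4"])
    have "p\<^sup>2 * q\<^sup>2 \<le> p ^ 4 + q ^ 4" for p q :: real
      using zero_le_power2[of "p\<^sup>2 - q\<^sup>2"] zero_le_power2[of "p * q"] by (simp add: power2_eq_square power4_eq_xxxx algebra_simps)
    then show "AE \<omega> in M. norm (?\<alpha> \<omega>) \<le> norm (?\<beta> \<omega> + norm (X 0 \<omega>) ^ 4)" by (intro AE_I2) simp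
  qed (use i\<beta> X4 in auto)
  \<comment> \<open>By symmetry in the two copies the terms with \<open>4 * norm s ^ 2\<close> and
    \<open>4 * norm t ^ 2\<close> contribute equally, which gives the leading factor 8.\<close>
  have sym: "(\<integral>\<^sup>+s. \<integral>\<^sup>+t. ennreal (norm (s - t) ^ 2 * norm t ^ 2) \<partial>P \<partial>P) = (\<integral>\<^sup>+s. \<integral>\<^sup>+t. ennreal (norm (s - t) ^ 2 * norm s ^ 2) \<partial>P \<partial>P)"
    by (subst PP.Fubini') (auto simp: norm_minus_commute)
  have A: "(\<integral>\<^sup>+s. \<integral>\<^sup>+t. ennreal (norm (s - t) ^ 2 * norm s ^ 2) \<partial>P \<partial>P) = ennreal (\<integral>\<omega>. ?\<alpha> \<omega> \<partial>M)"
    by (subst fub, measurable) (rule nn_integral_eq_integral[OF i\<alpha>], simp)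
  have B: "(\<integral>\<^sup>+s. \<integral>\<^sup>+t. ennreal (norm (s - t) ^ 4) \<partial>P \<partial>P) = ennreal (\<integral>\<omega>. ?\<beta> \<omega> \<partial>M)"
    by (subst fub, measurable) (rule nn_integral_eq_integral[OF i\<beta>], simp)
  have "(\<integral>\<^sup>+s. \<integral>\<^sup>+t. ennreal (norm (s - t) ^ 2 * (4 * norm s ^ 2 + 4 * norm t ^ 2) + 4 * \<theta> * norm (s - t) ^ 4) \<partial>P \<partial>P)
      = (\<integral>\<^sup>+s. \<integral>\<^sup>+t. 4 * ennreal (norm (s - t) ^ 2 * norm s ^ 2) + (4 * ennreal (norm (s - t) ^ 2 * norm t ^ 2) + ennreal (4 * \<theta>) * ennreal (norm (s - t) ^ 4)) \<partial>P \<partial>P)"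
  proof (intro nn_integral_cong)
    fix s t :: 'a
    have "norm (s - t) ^ 2 * (4 * norm s ^ 2 + 4 * norm t ^ 2) + 4 * \<theta> * norm (s - t) ^ 4
        = 4 * (norm (s - t) ^ 2 * norm s ^ 2) + (4 * (norm (s - t) ^ 2 * norm t ^ 2) + (4 * \<theta>) * norm (s - t) ^ 4)"
      by (simp add: algebra_simps)
    then show "ennreal (norm (s - t) ^ 2 * (4 * norm s ^ 2 + 4 * norm t ^ 2) + 4 * \<theta> * norm (s - t) ^ 4)
        = 4 * ennreal (norm (s - t) ^ 2 * norm s ^ 2) + (4 * ennreal (norm (s - t) ^ 2 * norm t ^ 2) + ennreal (4 * \<theta>) * ennreal (norm (s - t) ^ 4))"
      using \<theta> by (simp add: ennreal_mult' ennreal_plus)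
  qed
  also have "\<dots> = 4 * (\<integral>\<^sup>+s. \<integral>\<^sup>+t. ennreal (norm (s - t) ^ 2 * norm s ^ 2) \<partial>P \<partial>P)
      + (4 * (\<integral>\<^sup>+s. \<integral>\<^sup>+t. ennreal (norm (s - t) ^ 2 * norm t ^ 2) \<partial>P \<partial>P) + ennreal (4 * \<theta>) * (\<integral>\<^sup>+s. \<integral>\<^sup>+t. ennreal (norm (s - t) ^ 4) \<partial>P \<partial>P))"
    by (simp add: nn_integral_add nn_integral_cmult)
  also have "\<dots> = ennreal (4 * (\<integral>\<omega>. ?\<alpha> \<omega> \<partial>M)) + (ennreal (4 * (\<integral>\<omega>. ?\<alpha> \<omega> \<partial>M)) + ennreal (4 * \<theta> * (\<integral>\<omega>. ?\<beta> \<omega> \<partial>M)))"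
    unfolding sym A B using \<theta> by (simp add: ennreal_mult')
  also have "\<dots> = ennreal (8 * (\<integral>\<omega>. ?\<alpha> \<omega> \<partial>M) + 4 * \<theta> * (\<integral>\<omega>. ?\<beta> \<omega> \<partial>M))"
    using \<theta> by (simp flip: ennreal_plus)
  finally show ?thesis .
qed

lemma distr_transfer:
  fixes F :: "(nat \<Rightarrow> 'a) \<Rightarrow> (nat \<Rightarrow> 'a) \<Rightarrow> real"
  assumes M: "prob_space M"
    and T: "T \<in> measurable M (samples n m)" "distr M (samples n m) T = samples n m"
    and F: "(\<lambda>z. F (fst z) (snd z)) \<in> borel_measurable (samples n m)"
    and eq: "\<And>\<omega>. F (fst (T \<omega>)) (snd (T \<omega>)) = Z \<omega>"
    and int: "integrable (samples n m) (\<lambda>z. (F (fst z) (snd z))\<^sup>2)"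
  shows "square_integrable M Z"
    and "ennreal (prob_space.variance M Z) = pos_var (samples n m) (\<lambda>z. F (fst z) (snd z))"
proof -
  interpret M: prob_space M by (rule M)
  interpret S: prob_space "samples n m" by (rule prob_space_samples)
  have Z: "Z = (\<lambda>\<omega>. F (fst (T \<omega>)) (snd (T \<omega>)))" using eq by auto
  have Zm: "Z \<in> borel_measurable M" unfolding Z using measurable_compose[OF T(1) F] by simp
  have Zi: "integrable M (\<lambda>\<omega>. (Z \<omega>)\<^sup>2)"
    unfolding Z using integrable_distr[OF T(1), of "\<lambda>z. (F (fst z) (snd z))\<^sup>2"] int unfolding T(2) by simp
  show "square_integrable M Z" using Zm Zi by (simp add: square_integrable_def)
  have "ennreal (M.variance Z) = pos_var M Z" by (rule M.pos_var_eq_variance[OF Zm Zi, symmetric])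
  also have "\<dots> = pos_var (distr M (samples n m) T) (\<lambda>z. F (fst z) (snd z))"
    unfolding Z by (rule pos_var_distr[symmetric])
      (auto intro!: T(1) F prob_space_imp_sigma_finite M.prob_space_axioms S.prob_space_axioms M.prob_space_distr)
  finally show "ennreal (M.variance Z) = pos_var (samples n m) (\<lambda>z. F (fst z) (snd z))" unfolding T(2) .
qed

end

text \<open>Points of the canonical product space are \<open>undefined\<close> beyond their index
  set; the functional only looks at the first \<open>n\<close> and \<open>m\<close>
  positions.\<close>

lemma empirical_W_restrict:
  assumes "n \<ge> 1" "m \<ge> 1"
  shows "empirical_W n m (restrict x {..<n}) (restrict y {..<m}) = empirical_W n m x y"
proof -
  have "transport_value n m (\<lambda>i j. restrict x {..<n} i \<bullet> restrict y {..<m} j) = transport_value n m (\<lambda>i j. x i \<bullet> y j)"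
    by (intro transport_value_cong) auto
  then show ?thesis unfolding empirical_W_eq[OF assms] by simp
qed

theorem variance_empirical_W_le:
  fixes P Q :: "'a::euclidean_space measure" and M :: "'w measure" and X Y :: "nat \<Rightarrow> 'w \<Rightarrow> 'a"
  assumes PQ: "two_samples P Q" and M: "prob_space M"
    and X_indep: "prob_space.indep_vars M (\<lambda>_. borel) X UNIV" and X_law: "\<And>i. distr M borel (X i) = P"
    and Y_indep: "prob_space.indep_vars M (\<lambda>_. borel) Y UNIV" and Y_law: "\<And>j. distr M borel (Y j) = Q"
    and XY_indep: "prob_space.indep_var M
          (\<Pi>\<^sub>M i\<in>UNIV. borel) (\<lambda>\<omega> i. X i \<omega>) (\<Pi>\<^sub>M j\<in>UNIV. borel) (\<lambda>\<omega> j. Y j \<omega>)"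
    and P4: "integrable P (\<lambda>x. norm x ^ 4)" and Q4: "integrable Q (\<lambda>y. norm y ^ 4)"
    and n: "n \<ge> 1" and m: "m \<ge> 1"
  shows "square_integrable M (\<lambda>\<omega>. empirical_W n m (\<lambda>i. X i \<omega>) (\<lambda>j. Y j \<omega>))"
    and "prob_space.variance M (\<lambda>\<omega>. empirical_W n m (\<lambda>i. X i \<omega>) (\<lambda>j. Y j \<omega>))
      \<le> 8 * (prob_space.expectation M (\<lambda>\<omega>. norm (X 0 \<omega> - X 1 \<omega>) ^ 2 * norm (X 0 \<omega>) ^ 2)
             + sqrt (prob_space.expectation M (\<lambda>\<omega>. norm (X 0 \<omega> - X 1 \<omega>) ^ 4)) * sqrt (\<integral>y. norm y ^ 4 \<partial>Q)) / real n
        + 8 * (prob_space.expectation M (\<lambda>\<omega>. norm (Y 0 \<omega> - Y 1 \<omega>) ^ 2 * norm (Y 0 \<omega>) ^ 2)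
             + sqrt (prob_space.expectation M (\<lambda>\<omega>. norm (Y 0 \<omega> - Y 1 \<omega>) ^ 4)) * sqrt (\<integral>x. norm x ^ 4 \<partial>P)) / real m"
proof -
  interpret two_samples P Q by (rule PQ)
  interpret QP: two_samples Q P by (rule two_samples_swap)
  interpret M: prob_space M by (rule M)
  let ?T = "\<lambda>\<omega>. (\<lambda>i\<in>{..<n}. X i \<omega>, \<lambda>j\<in>{..<m}. Y j \<omega>)"
  let ?Z = "\<lambda>\<omega>. empirical_W n m (\<lambda>i. X i \<omega>) (\<lambda>j. Y j \<omega>)"
  note T = distr_samples[OF M X_indep X_law Y_indep Y_law XY_indep n m]
  have restrict: "empirical_W n m (fst (?T \<omega>)) (snd (?T \<omega>)) = ?Z \<omega>" for \<omega>
    using empirical_W_restrict[OF n m, of "\<lambda>i. X i \<omega>" "\<lambda>j. Y j \<omega>"] by simp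
  note transfer = distr_transfer[OF M T(2,1) empirical_W_measurable[OF n m] restrict integrable_W_square[OF n m P4 Q4]]
  show "square_integrable M ?Z" by (rule transfer(1))
  let ?\<alpha>P = "M.expectation (\<lambda>\<omega>. norm (X 0 \<omega> - X 1 \<omega>) ^ 2 * norm (X 0 \<omega>) ^ 2)"
    and ?\<alpha>Q = "M.expectation (\<lambda>\<omega>. norm (Y 0 \<omega> - Y 1 \<omega>) ^ 2 * norm (Y 0 \<omega>) ^ 2)"
    and ?\<beta>P = "M.expectation (\<lambda>\<omega>. norm (X 0 \<omega> - X 1 \<omega>) ^ 4)"
    and ?\<beta>Q = "M.expectation (\<lambda>\<omega>. norm (Y 0 \<omega> - Y 1 \<omega>) ^ 4)"
    and ?qP = "\<integral>x. norm x ^ 4 \<partial>P" and ?qQ = "\<integral>y. norm y ^ 4 \<partial>Q"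
  have nn: "?\<alpha>P \<ge> 0" "?\<alpha>Q \<ge> 0" "?\<beta>P \<ge> 0" "?\<beta>Q \<ge> 0" "?qP \<ge> 0" "?qQ \<ge> 0" by auto
  have q: "(\<integral>\<^sup>+y. ennreal (norm y ^ 4) \<partial>Q) = ennreal ?qQ" "(\<integral>\<^sup>+x. ennreal (norm x ^ 4) \<partial>P) = ennreal ?qP"
    using P4 Q4 by (auto intro!: nn_integral_eq_integral)
  have W_swap: "(\<lambda>(y :: nat \<Rightarrow> 'a) x. empirical_W n m x y) = empirical_W m n"
  proof (intro ext)
    fix y x :: "nat \<Rightarrow> 'a"
    have "transport_value n m (\<lambda>i j. x i \<bullet> y j) = transport_value m n (\<lambda>j i. y j \<bullet> x i)"
      by (subst transport_value_swap[OF n m]) (simp add: inner_commute)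
    then show "empirical_W n m x y = empirical_W m n y x"
      unfolding empirical_W_eq[OF n m] empirical_W_eq[OF m n] by simp
  qed
  \<comment> \<open>The two samples get separate weights, which are then optimized one after the
    other by \<open>le_sqrt_mult_if_le_AM_GM\<close>.\<close>
  have bound: "M.variance ?Z \<le> 1 / real n * (8 * ?\<alpha>P + (4 * \<theta> * ?\<beta>P + 4 / \<theta> * ?qQ)) + 1 / real m * (8 * ?\<alpha>Q + (4 * \<theta>' * ?\<beta>Q + 4 / \<theta>' * ?qP))"
    (is "_ \<le> ?R") if \<theta>: "\<theta> > 0" "\<theta>' > 0" for \<theta> \<theta>'
  proof -
    have "ennreal (M.variance ?Z) \<le> resample_energy n m (empirical_W n m) + QP.resample_energy m n (empirical_W m n)"
      using pos_var_le_resample_energy[OF empirical_W_measurable[OF n m]] unfolding transfer(2) W_swap .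
    also have "\<dots> \<le> ennreal (1 / real n) * (ennreal (8 * ?\<alpha>P + 4 * \<theta> * ?\<beta>P) + ennreal (4 / \<theta>) * ennreal ?qQ)
        + ennreal (1 / real m) * (ennreal (8 * ?\<alpha>Q + 4 * \<theta>' * ?\<beta>Q) + ennreal (4 / \<theta>') * ennreal ?qP)"
      using resample_energy_W[OF n m \<theta>(1)] QP.resample_energy_W[OF m n \<theta>(2)]
      unfolding variance_constant[OF M X_indep X_law P4 \<theta>(1)] QP.variance_constant[OF M Y_indep Y_law Q4 \<theta>(2)] q
      by (rule add_mono)
    also have "\<dots> = ennreal ?R"
      using \<theta> nn by (simp add: add.assoc flip: ennreal_mult ennreal_plus)
    finally show ?thesis using \<theta> nn by (subst (asm) ennreal_le_iff) auto
  qed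
  have "M.variance ?Z \<le> (1 / real n * (8 * ?\<alpha>P) + 1 / real m * (8 * ?\<alpha>Q + (4 * \<theta>' * ?\<beta>Q + 4 / \<theta>' * ?qP)))
      + 1 / real n * (8 * (sqrt ?\<beta>P * sqrt ?qQ))" if \<theta>': "\<theta>' > 0" for \<theta>'
    using bound[OF _ \<theta>'] nn by (intro le_sqrt_mult_if_le_AM_GM) (simp_all add: algebra_simps)
  then have "M.variance ?Z \<le> (1 / real n * (8 * ?\<alpha>P) + 1 / real n * (8 * (sqrt ?\<beta>P * sqrt ?qQ)) + 1 / real m * (8 * ?\<alpha>Q))
      + 1 / real m * (8 * (sqrt ?\<beta>Q * sqrt ?qP))"
    using nn by (intro le_sqrt_mult_if_le_AM_GM) (simp_all add: algebra_simps)
  then show "M.variance ?Z \<le> 8 * (?\<alpha>P + sqrt ?\<beta>P * sqrt ?qQ) / real n + 8 * (?\<alpha>Q + sqrt ?\<beta>Q * sqrt ?qP) / real m"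
    by (simp add: distrib_left add_divide_distrib)
qed

section \<open>Dual potentials\<close>

lemma finite_Max_diff_le:
  fixes p q :: "'i \<Rightarrow> real"
  assumes "finite I" "I \<noteq> {}" "\<And>i. i \<in> I \<Longrightarrow> p i \<le> q i + L"
  shows "Max (p ` I) \<le> Max (q ` I) + L"
  using assms by (subst Max_le_iff) (auto intro: order_trans[OF assms(3)] Max_ge)

context two_samples
begin

lemma integral_swap_samples:
  fixes h :: "_ \<Rightarrow> real"
  assumes [measurable]: "h \<in> borel_measurable (samples n m)"
  shows "(\<integral>z. h z \<partial>samples n m) = (\<integral>z. h (snd z, fst z) \<partial>two_samples.samples Q P m n)"
proof -
  interpret AB: pair_prob_space "PiM {..<n} (\<lambda>_. P)" "PiM {..<m} (\<lambda>_. Q)" by (rule pair_prob_space_samples)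
  interpret QP: two_samples Q P by (rule two_samples_swap)
  have [measurable]: "h \<in> borel_measurable (PiM {..<n} (\<lambda>_. P) \<Otimes>\<^sub>M PiM {..<m} (\<lambda>_. Q))"
    using assms by (simp add: samples_def)
  show ?thesis
    unfolding samples_def QP.samples_def
    by (subst AB.distr_pair_swap, subst integral_distr) (auto simp: split_def)
qed

lemma frequency_snd:
  assumes m: "m \<ge> 1" and C: "C \<in> sets borel"
  shows "(\<integral>z. \<bar>(\<Sum>j<m. indicator C (snd z j)) / real m - measure Q C\<bar> \<partial>samples n m) \<le> 1 / sqrt (real m)"
proof -
  interpret QP: two_samples Q P by (rule two_samples_swap)
  have [measurable]: "(\<lambda>z. (\<Sum>j<m. indicator C (snd z j)) / real m :: real) \<in> borel_measurable (samples n m)"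
    using C by (intro average_snd_measurable) auto
  show ?thesis using QP.frequency_fst(1)[OF m C] by (subst integral_swap_samples) auto
qed

lemma frequency_diff_integrable:
  assumes n: "n \<ge> 1" and C: "C \<in> sets borel"
  shows "integrable (samples n m) (\<lambda>z. \<bar>(\<Sum>i<n. indicator C (fst z i)) / real n - measure P C\<bar>)"
proof -
  interpret S: prob_space "samples n m" by (rule prob_space_samples)
  have "integrable P (indicator C :: _ \<Rightarrow> real)"
    using C by (intro P.integrable_const_bound[of _ 1]) (auto simp: indicator_def)
  then show ?thesis using integrable_average_fst(1)[of "indicator C" n m] C by auto
qed

lemma frequency_diff_integrable_snd:
  assumes m: "m \<ge> 1" and C: "C \<in> sets borel"
  shows "integrable (samples n m) (\<lambda>z. \<bar>(\<Sum>j<m. indicator C (snd z j)) / real m - measure Q C\<bar>)"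
proof -
  interpret S: prob_space "samples n m" by (rule prob_space_samples)
  have "integrable Q (indicator C :: _ \<Rightarrow> real)"
    using C by (intro Q.integrable_const_bound[of _ 1]) (auto simp: indicator_def)
  then show ?thesis using integrable_average_snd(1)[of "indicator C" n m] C by auto
qed

text \<open>\<open>h\<close> composed with \<open>c\<close> takes finitely many values, so its mean
  and its sample average differ through the cell frequencies only. The value at \<open>c 0\<close>
  can be subtracted because frequencies and masses both sum to 1. Hence only the oscillation of
  \<open>h\<close> enters; for dual potentials this is bounded, whereas their values contain an
  arbitrary constant.\<close>

lemma integral_finite_range_le:
  fixes h :: "'a \<Rightarrow> real"
  assumes c [measurable]: "c \<in> borel_measurable borel" and fin: "finite (range c)" and n: "n \<ge> 1"
    and L: "\<And>k. k \<in> range c \<Longrightarrow> \<bar>h k - h (c 0)\<bar> \<le> L"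
  shows "(\<integral>x. h (c x) \<partial>P) \<le> (\<Sum>i<n. h (c (x i))) / real n
    + L * (\<Sum>k\<in>range c. \<bar>(\<Sum>i<n. indicator (c -` {k}) (x i)) / real n - measure P (c -` {k})\<bar>)"
    and "integrable P (\<lambda>x. h (c x))" and "(\<lambda>x. h (c x)) \<in> borel_measurable borel"
proof -
  let ?k0 = "c 0" and ?freq = "\<lambda>k. (\<Sum>i<n. indicator (c -` {k}) (x i)) / real n"
  have C [measurable]: "c -` {k} \<in> sets borel" for k
    using measurable_sets_borel[OF c, of "{k}"] by simp
  have rep: "h (c x) = h ?k0 + (\<Sum>k\<in>range c. (h k - h ?k0) * indicator (c -` {k}) x)" for x
  proof -
    have "(\<Sum>k\<in>range c. (h k - h ?k0) * indicator (c -` {k}) x) = (\<Sum>k\<in>range c. if c x = k then h k - h ?k0 else 0)"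
      by (intro sum.cong) (auto simp: indicator_def)
    also have "\<dots> = h (c x) - h ?k0" using fin by (subst sum.delta') auto
    finally show ?thesis by simp
  qed
  have fun_rep: "(\<lambda>x. h (c x)) = (\<lambda>x. h ?k0 + (\<Sum>k\<in>range c. (h k - h ?k0) * indicator (c -` {k}) x))"
    using rep by (rule ext)
  have ind: "integrable P (\<lambda>x. indicator (c -` {k}) x :: real)" for k
    by (intro P.integrable_const_bound[of _ 1]) (auto simp: indicator_def)
  show "integrable P (\<lambda>x. h (c x))" "(\<lambda>x. h (c x)) \<in> borel_measurable borel"
    unfolding fun_rep using ind by auto
  have "(\<integral>x. h (c x) \<partial>P) = h ?k0 + (\<Sum>k\<in>range c. (h k - h ?k0) * measure P (c -` {k}))"
    unfolding fun_rep using ind by (simp add: P.prob_space[simplified])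
  moreover have "(\<Sum>i<n. h (c (x i))) / real n = h ?k0 + (\<Sum>k\<in>range c. (h k - h ?k0) * ?freq k)"
  proof -
    have "(\<Sum>i<n. h (c (x i))) = (\<Sum>i<n. h ?k0) + (\<Sum>i<n. \<Sum>k\<in>range c. (h k - h ?k0) * indicator (c -` {k}) (x i))"
      by (simp only: sum.distrib[symmetric] rep[symmetric])
    also have "(\<Sum>i<n. \<Sum>k\<in>range c. (h k - h ?k0) * indicator (c -` {k}) (x i)) = (\<Sum>k\<in>range c. (h k - h ?k0) * (\<Sum>i<n. indicator (c -` {k}) (x i)))"
      by (subst sum.swap) (simp add: sum_distrib_left)
    finally show ?thesis using n by (simp add: add_divide_distrib sum_divide_distrib[of _ "range c"])
  qed
  moreover have "(\<Sum>k\<in>range c. (h k - h ?k0) * measure P (c -` {k})) - (\<Sum>k\<in>range c. (h k - h ?k0) * ?freq k)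
      \<le> L * (\<Sum>k\<in>range c. \<bar>?freq k - measure P (c -` {k})\<bar>)"
  proof -
    have "(\<Sum>k\<in>range c. (h k - h ?k0) * measure P (c -` {k})) - (\<Sum>k\<in>range c. (h k - h ?k0) * ?freq k)
        = (\<Sum>k\<in>range c. (h k - h ?k0) * (measure P (c -` {k}) - ?freq k))"
      by (simp add: sum_subtractf right_diff_distrib)
    also have "\<dots> \<le> (\<Sum>k\<in>range c. L * \<bar>?freq k - measure P (c -` {k})\<bar>)"
    proof (intro sum_mono)
      fix k assume "k \<in> range c"
      have "(h k - h ?k0) * (measure P (c -` {k}) - ?freq k) \<le> \<bar>h k - h ?k0\<bar> * \<bar>measure P (c -` {k}) - ?freq k\<bar>"
        by (metis abs_ge_self abs_mult)
      also have "\<dots> \<le> L * \<bar>measure P (c -` {k}) - ?freq k\<bar>"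
        using L[OF \<open>k \<in> range c\<close>] by (intro mult_right_mono) auto
      finally show "(h k - h ?k0) * (measure P (c -` {k}) - ?freq k) \<le> L * \<bar>?freq k - measure P (c -` {k})\<bar>"
        by (simp add: abs_minus_commute)
    qed
    finally show ?thesis by (simp add: sum_distrib_left)
  qed
  ultimately show "(\<integral>x. h (c x) \<partial>P) \<le> (\<Sum>i<n. h (c (x i))) / real n
    + L * (\<Sum>k\<in>range c. \<bar>(\<Sum>i<n. indicator (c -` {k}) (x i)) / real n - measure P (c -` {k})\<bar>)" by linarith
qed

end

section \<open>Quantization and the expected duality gap\<close>

text \<open>The share of one variable in an AM-GM bound, with weight \<open>t\<close>, for the
  change of the inner product under quantization. For fixed \<open>t\<close> the first term is small
  for a fine quantizer; the second is small with \<open>t\<close>.\<close>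

definition quantization_error :: "real \<Rightarrow> ('a \<Rightarrow> 'a) \<Rightarrow> 'a::euclidean_space \<Rightarrow> real" where
  "quantization_error t c x = (norm (x - c x))\<^sup>2 / (2 * t) + t * ((norm x)\<^sup>2 + (norm (c x))\<^sup>2) / 2"

lemma inner_quantization:
  assumes t: "t > 0"
  shows "\<bar>x \<bullet> y - c x \<bullet> d y\<bar> \<le> quantization_error t c x + quantization_error t d y"
proof -
  have amgm: "norm p * norm q \<le> (norm p)\<^sup>2 / (2 * t) + t * (norm q)\<^sup>2 / 2" for p q :: 'a
  proof -
    have "0 \<le> (norm p - t * norm q)\<^sup>2 / (2 * t)" using t by simp
    also have "\<dots> = (norm p)\<^sup>2 / (2 * t) + t * (norm q)\<^sup>2 / 2 - norm p * norm q"
      using t by (simp add: power2_eq_square field_simps)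
    finally show ?thesis by simp
  qed
  have "x \<bullet> y - c x \<bullet> d y = (x - c x) \<bullet> y + (y - d y) \<bullet> c x"
    by (simp add: inner_diff_left inner_diff_right inner_commute)
  then have "\<bar>x \<bullet> y - c x \<bullet> d y\<bar> \<le> norm (x - c x) * norm y + norm (y - d y) * norm (c x)"
    by (simp only:) (intro order_trans[OF abs_triangle_ineq] add_mono Cauchy_Schwarz_ineq2)
  also have "\<dots> \<le> ((norm (x - c x))\<^sup>2 / (2 * t) + t * (norm y)\<^sup>2 / 2) + ((norm (y - d y))\<^sup>2 / (2 * t) + t * (norm (c x))\<^sup>2 / 2)"
    by (intro add_mono amgm)
  also have "\<dots> \<le> quantization_error t c x + quantization_error t d y"
    using t by (simp add: quantization_error_def field_simps)
  finally show ?thesis .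
qed

text \<open>In the application \<open>f\<close> and \<open>g\<close> are the real parts of the
  extended-valued potentials, and \<open>A\<close> and \<open>B\<close> the sets where these are
  finite; elsewhere the real part is the default value 0 and feasibility may fail. Minimality refers
  to real-valued measurable pairs that are feasible everywhere, the kind of competitor that
  quantization produces.\<close>

locale dual_potentials = two_samples P Q for P Q :: "'a::euclidean_space measure" +
  fixes f g :: "'a \<Rightarrow> real" and A B :: "'a set"
  assumes P4: "integrable P (\<lambda>x. norm x ^ 4)" and Q4: "integrable Q (\<lambda>y. norm y ^ 4)"
    and f_measurable [measurable]: "f \<in> borel_measurable borel" and g_measurable [measurable]: "g \<in> borel_measurable borel"
    and f_integrable: "integrable P f" and g_integrable: "integrable Q g"
    and A_borel: "A \<in> sets borel" and B_borel: "B \<in> sets borel"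
    and AE_A: "AE x in P. x \<in> A" and AE_B: "AE y in Q. y \<in> B"
    and feasible: "\<And>x y. x \<in> A \<Longrightarrow> y \<in> B \<Longrightarrow> x \<bullet> y \<le> f x + g y"
    and minimal: "\<And>F G. F \<in> borel_measurable borel \<Longrightarrow> G \<in> borel_measurable borel \<Longrightarrow> integrable P F \<Longrightarrow> integrable Q G \<Longrightarrow>
      (\<And>x y. x \<bullet> y \<le> F x + G y) \<Longrightarrow> (\<integral>x. f x \<partial>P) + (\<integral>y. g y \<partial>Q) \<le> (\<integral>x. F x \<partial>P) + (\<integral>y. G y \<partial>Q)"
begin

lemma dual_potentials_swap: "dual_potentials Q P g f B A"
proof (intro dual_potentials.intro two_samples_swap, unfold_locales)
  show "y \<bullet> x \<le> g y + f x" if "y \<in> B" "x \<in> A" for x y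
    using feasible[OF that(2,1)] by (simp add: inner_commute)
  show "(\<integral>y. g y \<partial>Q) + (\<integral>x. f x \<partial>P) \<le> (\<integral>y. G y \<partial>Q) + (\<integral>x. F x \<partial>P)"
    if *: "G \<in> borel_measurable borel" "F \<in> borel_measurable borel" "integrable Q G" "integrable P F"
      "\<And>y x. y \<bullet> x \<le> G y + F x" for F G
  proof -
    have "x \<bullet> y \<le> F x + G y" for x y using *(5)[of y x] by (simp add: inner_commute add.commute)
    from minimal[OF *(2,1,4,3) this] show ?thesis by simp
  qed
qed (use P4 Q4 f_integrable g_integrable A_borel B_borel AE_A AE_B in auto)

lemma P2: "integrable P (\<lambda>x. (norm x)\<^sup>2)"
proof (rule Bochner_Integration.integrable_bound[of _ "\<lambda>x. 1 + norm x ^ 4"])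
  have "r\<^sup>2 \<le> 1 + r ^ 4" for r :: real
  proof -
    have "r ^ 4 = (r\<^sup>2)\<^sup>2" by simp
    then show ?thesis using sum_squares_bound[of 1 "r\<^sup>2"] zero_le_power2[of r] by (simp only: one_power2 mult_1_right)
  qed
  then show "AE x in P. norm ((norm x)\<^sup>2) \<le> norm (1 + norm x ^ 4)" by (intro AE_I2) simp
qed (use P4 in auto)

definition gap :: "nat \<Rightarrow> nat \<Rightarrow> (nat \<Rightarrow> 'a) \<Rightarrow> (nat \<Rightarrow> 'a) \<Rightarrow> real" where
  "gap n m x y = (\<Sum>i<n. f (x i)) / real n + (\<Sum>j<m. g (y j)) / real m - transport_value n m (\<lambda>i j. x i \<bullet> y j)"

text \<open>The dual solution for the quantized sample, composed with the quantizers and raised by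
  the quantization errors, is feasible for the population problem, so minimality applies to it.
  Passing from its means to sample averages costs the frequency deviations, and returning to the
  unquantized points costs the errors once more, now along the sample.\<close>

lemma quantized_bound:
  fixes c d :: "'a \<Rightarrow> 'a"
  assumes n: "n \<ge> 1" and m: "m \<ge> 1" and t: "t > 0"
    and c [measurable]: "c \<in> borel_measurable borel" and d [measurable]: "d \<in> borel_measurable borel"
    and fin: "finite (range c)" "finite (range d)"
    and K: "\<And>x. norm (c x) \<le> K" "\<And>y. norm (d y) \<le> K"
    and ec: "integrable P (quantization_error t c)" and ed: "integrable Q (quantization_error t d)"
  shows "(\<integral>x. f x \<partial>P) + (\<integral>y. g y \<partial>Q) \<le> transport_value n m (\<lambda>i j. x i \<bullet> y j)
      + (\<Sum>i<n. quantization_error t c (x i)) / real n + (\<Sum>j<m. quantization_error t d (y j)) / real m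
      + (\<integral>x. quantization_error t c x \<partial>P) + (\<integral>y. quantization_error t d y \<partial>Q)
      + 2 * K\<^sup>2 * (\<Sum>k\<in>range c. \<bar>(\<Sum>i<n. indicator (c -` {k}) (x i)) / real n - measure P (c -` {k})\<bar>)
      + 2 * K\<^sup>2 * (\<Sum>l\<in>range d. \<bar>(\<Sum>j<m. indicator (d -` {l}) (y j)) / real m - measure Q (d -` {l})\<bar>)"
proof -
  interpret QP: two_samples Q P by (rule two_samples_swap)
  let ?c = "\<lambda>i j. c (x i) \<bullet> d (y j)"
  obtain a u v where a: "plan n m a" and val: "transport_value n m ?c = (\<Sum>i<n. \<Sum>j<m. a i j * ?c i j)"
    and uv: "\<And>i j. i < n \<Longrightarrow> j < m \<Longrightarrow> ?c i j \<le> u i + v j"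
    and dual: "transport_value n m ?c = (\<Sum>i<n. u i) / real n + (\<Sum>j<m. v j) / real m"
    by (rule transport_duality[OF n m, of ?c]) blast
  \<comment> \<open>\<open>\<psi>\<close> maximizes over the whole range of \<open>c\<close> and not
    over the sample points only, since the pair has to be feasible at all points of the space.
    Finiteness of the range makes the maximum exist.\<close>
  define \<phi> where "\<phi> k = Max ((\<lambda>j. k \<bullet> d (y j) - v j) ` {..<m})" for k
  define \<psi> where "\<psi> l = Max ((\<lambda>k. k \<bullet> l - \<phi> k) ` range c)" for l
  have m0: "{..<m} \<noteq> {}" using m by (auto simp: lessThan_empty_iff)
  have osc: "(k - k') \<bullet> l \<le> 2 * K\<^sup>2" if "norm k \<le> K" "norm k' \<le> K" "norm l \<le> K" for k k' l :: 'a
  proof -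
    have "norm (k - k') \<le> 2 * K" using norm_triangle_ineq4[of k k'] that by linarith
    then have "norm (k - k') * norm l \<le> 2 * K * K" using that by (intro mult_mono) (auto intro: order_trans[OF norm_ge_zero])
    then show ?thesis using norm_cauchy_schwarz[of "k - k'" l] by (simp add: power2_eq_square)
  qed
  \<comment> \<open>A maximum of affine functions with slopes of norm at most \<open>K\<close>
    oscillates by at most \<open>2 * K\<^sup>2\<close> on the ball of radius \<open>K\<close>,
    whatever the sample is.\<close>
  have \<phi>_osc: "\<phi> k \<le> \<phi> k' + 2 * K\<^sup>2" if "norm k \<le> K" "norm k' \<le> K" for k k'
    unfolding \<phi>_def using osc[OF that K(2)] m0
    by (intro finite_Max_diff_le) (auto simp: inner_diff_left algebra_simps)
  have \<psi>_osc: "\<psi> l \<le> \<psi> l' + 2 * K\<^sup>2" if "norm l \<le> K" "norm l' \<le> K" for l l'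
    unfolding \<psi>_def using osc[OF that K(1)] fin
    by (intro finite_Max_diff_le) (auto simp: inner_diff_left inner_commute algebra_simps)
  have \<phi>_abs: "\<bar>\<phi> k - \<phi> (c 0)\<bar> \<le> 2 * K\<^sup>2" if "k \<in> range c" for k
  proof -
    have "norm k \<le> K" using that K by auto
    then show ?thesis using \<phi>_osc[of k "c 0"] \<phi>_osc[of "c 0" k] K(1)[of 0] by linarith
  qed
  have \<psi>_abs: "\<bar>\<psi> l - \<psi> (d 0)\<bar> \<le> 2 * K\<^sup>2" if "l \<in> range d" for l
  proof -
    have "norm l \<le> K" using that K by auto
    then show ?thesis using \<psi>_osc[of l "d 0"] \<psi>_osc[of "d 0" l] K(2)[of 0] by linarith
  qed
  have \<phi>_le: "\<phi> (c (x i)) \<le> u i" if "i < n" for i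
    unfolding \<phi>_def using m0 uv[OF that] by (subst Max_le_iff) (auto simp: algebra_simps)
  have \<psi>_le: "\<psi> (d (y j)) \<le> v j" if j: "j < m" for j
    unfolding \<psi>_def
  proof (subst Max_le_iff)
    have "k \<bullet> d (y j) - v j \<le> \<phi> k" for k unfolding \<phi>_def using j by (intro Max_ge) auto
    then show "\<forall>a\<in>(\<lambda>k. k \<bullet> d (y j) - \<phi> k) ` range c. a \<le> v j" by (auto simp: algebra_simps)
  qed (use fin in auto)
  have \<psi>_ge: "c x \<bullet> l - \<phi> (c x) \<le> \<psi> l" for x l
    unfolding \<psi>_def using fin by (intro Max_ge) auto
  note I\<phi> = integral_finite_range_le[where h = \<phi>, OF c fin(1) n \<phi>_abs]
    and I\<psi> = QP.integral_finite_range_le[where h = \<psi>, OF d fin(2) m \<psi>_abs]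
  have "(\<integral>x. f x \<partial>P) + (\<integral>y. g y \<partial>Q)
      \<le> (\<integral>x. \<phi> (c x) + quantization_error t c x \<partial>P) + (\<integral>y. \<psi> (d y) + quantization_error t d y \<partial>Q)"
  proof (rule minimal)
    have [measurable]: "quantization_error t c \<in> borel_measurable borel" "quantization_error t d \<in> borel_measurable borel"
      unfolding quantization_error_def by measurable
    show "(\<lambda>x. \<phi> (c x) + quantization_error t c x) \<in> borel_measurable borel"
      using I\<phi>(3) by measurable
    show "(\<lambda>y. \<psi> (d y) + quantization_error t d y) \<in> borel_measurable borel"
      using I\<psi>(3) by measurable
    show "integrable P (\<lambda>x. \<phi> (c x) + quantization_error t c x)" using I\<phi>(2) ec by auto
    show "integrable Q (\<lambda>y. \<psi> (d y) + quantization_error t d y)" using I\<psi>(2) ed by auto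
    show "p \<bullet> q \<le> \<phi> (c p) + quantization_error t c p + (\<psi> (d q) + quantization_error t d q)" for p q
      using inner_quantization[OF t, of p q c d] \<psi>_ge[of p "d q"] by linarith
  qed
  also have "\<dots> = (\<integral>x. \<phi> (c x) \<partial>P) + (\<integral>x. quantization_error t c x \<partial>P) + (\<integral>y. \<psi> (d y) \<partial>Q) + (\<integral>y. quantization_error t d y \<partial>Q)"
    using I\<phi>(2) I\<psi>(2) ec ed by simp
  finally have 1: "(\<integral>x. f x \<partial>P) + (\<integral>y. g y \<partial>Q) \<le> (\<integral>x. \<phi> (c x) \<partial>P) + (\<integral>x. quantization_error t c x \<partial>P) + (\<integral>y. \<psi> (d y) \<partial>Q) + (\<integral>y. quantization_error t d y \<partial>Q)" .
  have 2: "(\<Sum>i<n. \<phi> (c (x i))) / real n + (\<Sum>j<m. \<psi> (d (y j))) / real m \<le> transport_value n m ?c"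
    unfolding dual using \<phi>_le \<psi>_le by (intro add_mono divide_right_mono sum_mono) auto
  have "(\<Sum>i<n. \<Sum>j<m. a i j * (?c i j - x i \<bullet> y j)) \<le> (\<Sum>i<n. quantization_error t c (x i)) / real n + (\<Sum>j<m. quantization_error t d (y j)) / real m"
    using inner_quantization[OF t, of _ _ c d] by (intro plan_weak_duality a) (smt (verit))
  then have 3: "transport_value n m ?c \<le> transport_value n m (\<lambda>i j. x i \<bullet> y j)
      + (\<Sum>i<n. quantization_error t c (x i)) / real n + (\<Sum>j<m. quantization_error t d (y j)) / real m"
    unfolding val using plan_le_transport_value[OF n m a, of "\<lambda>i j. x i \<bullet> y j"]
    by (simp add: right_diff_distrib sum_subtractf)
  show ?thesis using 1 2 3 I\<phi>(1)[of x] I\<psi>(1)[of y] by linarith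
qed

end

text \<open>Simple functions that converge pointwise to the identity and are bounded by
  \<open>2 * norm x\<close> have small mean square distance by dominated convergence. The same bound
  gives \<open>(norm x)\<^sup>2 + (norm (c x))\<^sup>2 \<le> 5 * (norm x)\<^sup>2\<close>, hence the
  coefficient \<open>5 * t / 2\<close>.\<close>

lemma (in two_samples) quantizer_exists:
  assumes P2: "integrable P (\<lambda>x. (norm x)\<^sup>2)" and t: "t > 0" and \<eta>: "\<eta> > 0"
  obtains c K where "c \<in> borel_measurable borel" "finite (range c)" "\<And>x. norm (c x) \<le> K"
    "integrable P (quantization_error t c)"
    "(\<integral>x. quantization_error t c x \<partial>P) \<le> \<eta> + 5 * t / 2 * (\<integral>x. (norm x)\<^sup>2 \<partial>P)"
proof -
  obtain s where "\<forall>i. simple_function borel (s i)" "\<forall>x\<in>space borel. (\<lambda>i. s i x) \<longlonglongrightarrow> x"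
    "\<forall>i. \<forall>x\<in>space borel. dist (s i x) 0 \<le> 2 * dist x (0::'a)"
    using borel_measurable_implies_sequence_metric[of "\<lambda>x::'a. x" borel 0] by auto
  then have s: "\<And>i. simple_function borel (s i)" "\<And>x. (\<lambda>i. s i x) \<longlonglongrightarrow> x" "\<And>i x. norm (s i x) \<le> 2 * norm x"
    by simp_all
  have sm [measurable]: "s i \<in> borel_measurable borel" for i
    using s(1) by (rule borel_measurable_simple_function)
  have s2: "(norm (s i x))\<^sup>2 \<le> 4 * (norm x)\<^sup>2" for i x
    using power_mono[OF s(3)[of i x], of 2] by (simp add: power_mult_distrib)
  have d2: "(norm (x - s i x))\<^sup>2 \<le> 9 * (norm x)\<^sup>2" for i x
  proof -
    have "norm (x - s i x) \<le> 3 * norm x" using norm_triangle_ineq4[of x "s i x"] s(3)[of i x] by linarith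
    from power_mono[OF this, of 2] show ?thesis by (simp add: power_mult_distrib)
  qed
  have intd: "integrable P (\<lambda>x. (norm (x - s i x))\<^sup>2)" for i
    by (rule Bochner_Integration.integrable_bound[of _ "\<lambda>x. 9 * (norm x)\<^sup>2"]) (use P2 d2 in auto)
  have ints: "integrable P (\<lambda>x. (norm (s i x))\<^sup>2)" for i
    by (rule Bochner_Integration.integrable_bound[of _ "\<lambda>x. 4 * (norm x)\<^sup>2"]) (use P2 s2 in auto)
  have "(\<lambda>i. \<integral>x. (norm (x - s i x))\<^sup>2 \<partial>P) \<longlonglongrightarrow> (\<integral>x. 0 \<partial>P)"
  proof (rule integral_dominated_convergence[where w = "\<lambda>x. 9 * (norm x)\<^sup>2"])
    have "(\<lambda>i. (norm (x - s i x))\<^sup>2) \<longlonglongrightarrow> (norm (x - x))\<^sup>2" for x by (intro tendsto_intros s(2))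
    then show "AE x in P. (\<lambda>i. (norm (x - s i x))\<^sup>2) \<longlonglongrightarrow> 0" by simp
  qed (use P2 d2 in auto)
  then have "\<forall>\<^sub>F i in sequentially. (\<integral>x. (norm (x - s i x))\<^sup>2 \<partial>P) < 2 * t * \<eta>"
    using t \<eta> by (intro order_tendstoD(2)[of _ "\<integral>x. 0 \<partial>P"]) auto
  then obtain i where i: "(\<integral>x. (norm (x - s i x))\<^sup>2 \<partial>P) < 2 * t * \<eta>" by (auto simp: eventually_sequentially)
  have fin: "finite (range (s i))" using simple_functionD(1)[OF s(1)[of i]] by simp
  then obtain K where K: "\<And>x. norm (s i x) \<le> K"
    using finite_imp_bounded[OF fin] unfolding bounded_iff by auto
  have int: "integrable P (quantization_error t (s i))"
    unfolding quantization_error_def using intd ints P2 by auto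
  have "(\<integral>x. quantization_error t (s i) x \<partial>P) \<le> (\<integral>x. (norm (x - s i x))\<^sup>2 / (2 * t) + 5 * t / 2 * (norm x)\<^sup>2 \<partial>P)"
  proof (rule integral_mono[OF int])
    show "integrable P (\<lambda>x. (norm (x - s i x))\<^sup>2 / (2 * t) + 5 * t / 2 * (norm x)\<^sup>2)" using intd P2 by auto
    show "quantization_error t (s i) x \<le> (norm (x - s i x))\<^sup>2 / (2 * t) + 5 * t / 2 * (norm x)\<^sup>2" for x
      using mult_left_mono[OF s2[of i x], of t] t unfolding quantization_error_def by (simp add: algebra_simps)
  qed
  also have "\<dots> = (\<integral>x. (norm (x - s i x))\<^sup>2 \<partial>P) / (2 * t) + 5 * t / 2 * (\<integral>x. (norm x)\<^sup>2 \<partial>P)"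
    using intd P2 by simp
  also have "(\<integral>x. (norm (x - s i x))\<^sup>2 \<partial>P) / (2 * t) \<le> \<eta>"
    using i t by (simp add: divide_le_eq mult_ac)
  finally show thesis using that[OF sm fin K int] by simp
qed

context dual_potentials
begin

lemma gap_measurable [measurable]: "(\<lambda>z. gap n m (fst z) (snd z)) \<in> borel_measurable (samples n m)"
  unfolding gap_def
  by (intro borel_measurable_diff borel_measurable_add average_fst_measurable average_snd_measurable
      transport_value_samples_measurable f_measurable g_measurable)

lemma transport_value_integrable:
  assumes "n \<ge> 1" "m \<ge> 1"
  shows "integrable (samples n m) (\<lambda>z. transport_value n m (\<lambda>i j. fst z i \<bullet> snd z j))"
proof -
  interpret S: prob_space "samples n m" by (rule prob_space_samples)
  show ?thesis
    by (rule S.square_integrable_imp_integrable[OF _ integrable_transport_value_square[OF assms P4 Q4]]) measurable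
qed

lemma gap_integrable:
  assumes "n \<ge> 1" "m \<ge> 1"
  shows "integrable (samples n m) (\<lambda>z. gap n m (fst z) (snd z))"
  unfolding gap_def
  by (intro Bochner_Integration.integrable_diff Bochner_Integration.integrable_add integrable_average_fst(1) integrable_average_snd(1)
      transport_value_integrable f_measurable g_measurable f_integrable g_integrable assms)

lemma AE_samples: "AE z in samples n m. (\<forall>i<n. fst z i \<in> A) \<and> (\<forall>j<m. snd z j \<in> B)"
  using AE_fst_sample[OF AE_A A_borel, where n = n and m = m] AE_snd_sample[OF AE_B B_borel, where n = n and m = m] by auto

lemma gap_nonneg:
  assumes n: "n \<ge> 1" and m: "m \<ge> 1" and "\<And>i. i < n \<Longrightarrow> x i \<in> A" "\<And>j. j < m \<Longrightarrow> y j \<in> B"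
  shows "0 \<le> gap n m x y"
proof -
  obtain a where a: "plan n m a" and val: "transport_value n m (\<lambda>i j. x i \<bullet> y j) = (\<Sum>i<n. \<Sum>j<m. a i j * (x i \<bullet> y j))"
    by (rule transport_duality[OF n m, of "\<lambda>i j. x i \<bullet> y j"]) blast
  have "transport_value n m (\<lambda>i j. x i \<bullet> y j) \<le> (\<Sum>i<n. f (x i)) / real n + (\<Sum>j<m. g (y j)) / real m"
    unfolding val using assms feasible by (intro plan_weak_duality a) auto
  then show ?thesis by (simp add: gap_def)
qed

text \<open>The weight \<open>t\<close> is fixed before the quantizers, and these before the sample
  sizes: for given quantizers there are finitely many cells, and their frequency deviations decay
  like the inverse square root of the sample size.\<close>

lemma expectation_gap_small:
  assumes \<epsilon>: "\<epsilon> > 0"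
  shows "\<exists>N\<ge>1. \<forall>n\<ge>N. \<forall>m\<ge>N. (\<integral>z. gap n m (fst z) (snd z) \<partial>samples n m) \<le> \<epsilon>"
proof -
  interpret QP: dual_potentials Q P g f B A by (rule dual_potentials_swap)
  let ?MP = "\<integral>x. (norm x)\<^sup>2 \<partial>P" and ?MQ = "\<integral>y. (norm y)\<^sup>2 \<partial>Q"
  \<comment> \<open>The factor 20 makes the parts of the errors proportional to \<open>t\<close> add
    up to at most \<open>\<epsilon> / 8\<close>. With \<open>\<epsilon> / 16\<close> for each
    quantizer the errors total \<open>\<epsilon> / 4\<close>. They are paid twice, under the laws
    and along the sample, and the frequency deviations take the other
    \<open>\<epsilon> / 2\<close>.\<close>
  define t where "t = \<epsilon> / (20 * (?MP + ?MQ + 1))"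
  have M0: "?MP \<ge> 0" "?MQ \<ge> 0" by auto
  have pos: "?MP + ?MQ + 1 > 0" using M0 by linarith
  then have t: "t > 0" unfolding t_def using \<epsilon> by (intro divide_pos_pos mult_pos_pos) simp_all
  have tM: "5 * t / 2 * ?MP + 5 * t / 2 * ?MQ \<le> \<epsilon> / 8"
  proof -
    have "5 * (\<epsilon> / (20 * D)) / 2 * a + 5 * (\<epsilon> / (20 * D)) / 2 * b = \<epsilon> / 8 * ((a + b) / D)" for a b D :: real
      by (simp add: add_divide_distrib distrib_left)
    from this[of "?MP + ?MQ + 1" ?MP ?MQ]
    have "5 * t / 2 * ?MP + 5 * t / 2 * ?MQ = \<epsilon> / 8 * ((?MP + ?MQ) / (?MP + ?MQ + 1))"
      unfolding t_def .
    also have "\<dots> \<le> \<epsilon> / 8 * 1" using \<epsilon> pos by (intro mult_left_mono) (simp_all add: divide_le_eq)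
    finally show ?thesis by simp
  qed
  have \<epsilon>16: "\<epsilon> / 16 > 0" using \<epsilon> by simp
  obtain c Kc where c: "c \<in> borel_measurable borel" "finite (range c)" "\<And>x. norm (c x) \<le> Kc"
    "integrable P (quantization_error t c)" "(\<integral>x. quantization_error t c x \<partial>P) \<le> \<epsilon> / 16 + 5 * t / 2 * ?MP"
    by (rule quantizer_exists[OF P2 t \<epsilon>16]) blast
  obtain d Kd where d: "d \<in> borel_measurable borel" "finite (range d)" "\<And>x. norm (d x) \<le> Kd"
    "integrable Q (quantization_error t d)" "(\<integral>x. quantization_error t d x \<partial>Q) \<le> \<epsilon> / 16 + 5 * t / 2 * ?MQ"
    by (rule QP.quantizer_exists[OF QP.P2 t \<epsilon>16]) blast
  define K where "K = max Kc Kd"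
  have K: "norm (c x) \<le> K" "norm (d y) \<le> K" for x y using c(3)[of x] d(3)[of y] by (auto simp: K_def)
  define L where "L = 2 * K\<^sup>2 * (real (card (range c)) + real (card (range d)))"
  have L0: "L \<ge> 0" by (simp add: L_def)
  obtain N0 :: nat where N0: "(2 * L / \<epsilon>)\<^sup>2 < real N0" using reals_Archimedean2 by blast
  define N where "N = max 1 N0"
  have N: "N \<ge> 1" "L / sqrt (real n) \<le> \<epsilon> / 2" if "n \<ge> N" for n
  proof -
    show "N \<ge> 1" by (simp add: N_def)
    have "(2 * L / \<epsilon>)\<^sup>2 \<le> real n" using N0 that by (simp add: N_def)
    then have "2 * L / \<epsilon> \<le> sqrt (real n)" by (rule real_le_rsqrt)
    moreover have "real n > 0" using that by (simp add: N_def)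
    ultimately show "L / sqrt (real n) \<le> \<epsilon> / 2" using \<epsilon> by (simp add: field_simps)
  qed
  have Ccell: "c -` {k} \<in> sets borel" "d -` {k} \<in> sets borel" for k
    using measurable_sets_borel[OF c(1), of "{k}"] measurable_sets_borel[OF d(1), of "{k}"] by auto
  have em: "quantization_error t c \<in> borel_measurable borel" "quantization_error t d \<in> borel_measurable borel"
    using c(4) d(4) by (auto dest: borel_measurable_integrable)
  have "(\<integral>z. gap n m (fst z) (snd z) \<partial>samples n m) \<le> \<epsilon>" if nN: "n \<ge> N" and mN: "m \<ge> N" for n m
  proof -
    have n: "n \<ge> 1" and m: "m \<ge> 1" using nN mN by (auto simp: N_def)
    interpret S: prob_space "samples n m" by (rule prob_space_samples)
    let ?ep = "\<integral>x. quantization_error t c x \<partial>P" and ?eq = "\<integral>y. quantization_error t d y \<partial>Q"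
    let ?avc = "\<lambda>z. (\<Sum>i<n. quantization_error t c (fst z i)) / real n"
      and ?avd = "\<lambda>z. (\<Sum>j<m. quantization_error t d (snd z j)) / real m"
    let ?fc = "\<lambda>k z. \<bar>(\<Sum>i<n. indicator (c -` {k}) (fst z i)) / real n - measure P (c -` {k})\<bar>"
      and ?fd = "\<lambda>l z. \<bar>(\<Sum>j<m. indicator (d -` {l}) (snd z j)) / real m - measure Q (d -` {l})\<bar>"
    let ?J = "(\<integral>x. f x \<partial>P) + (\<integral>y. g y \<partial>Q)"
    let ?W = "\<lambda>z. transport_value n m (\<lambda>i j. fst z i \<bullet> snd z j)"
    have intc: "integrable (samples n m) (\<lambda>z. \<Sum>k\<in>range c. ?fc k z)" "integrable (samples n m) (\<lambda>z. \<Sum>l\<in>range d. ?fd l z)"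
      using frequency_diff_integrable[OF n Ccell(1)] frequency_diff_integrable_snd[OF m Ccell(2)]
      by (auto intro!: Bochner_Integration.integrable_sum)
    have inte: "integrable (samples n m) ?avc" "integrable (samples n m) ?avd" "integrable (samples n m) ?W"
      using integrable_average_fst(1)[OF em(1) c(4)] integrable_average_snd(1)[OF em(2) d(4)] transport_value_integrable[OF n m] by auto
    have Ec: "(\<integral>z. (\<Sum>k\<in>range c. ?fc k z) \<partial>samples n m) \<le> real (card (range c)) / sqrt (real n)"
    proof -
      have "(\<integral>z. (\<Sum>k\<in>range c. ?fc k z) \<partial>samples n m) = (\<Sum>k\<in>range c. \<integral>z. ?fc k z \<partial>samples n m)"
        using frequency_diff_integrable[OF n Ccell(1)] by (intro Bochner_Integration.integral_sum) auto
      also have "\<dots> \<le> (\<Sum>k\<in>range c. 1 / sqrt (real n))" by (intro sum_mono frequency_fst(1)[OF n Ccell(1)])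
      finally show ?thesis by simp
    qed
    have Ed: "(\<integral>z. (\<Sum>l\<in>range d. ?fd l z) \<partial>samples n m) \<le> real (card (range d)) / sqrt (real m)"
    proof -
      have "(\<integral>z. (\<Sum>l\<in>range d. ?fd l z) \<partial>samples n m) = (\<Sum>l\<in>range d. \<integral>z. ?fd l z \<partial>samples n m)"
        using frequency_diff_integrable_snd[OF m Ccell(2)] by (intro Bochner_Integration.integral_sum) auto
      also have "\<dots> \<le> (\<Sum>l\<in>range d. 1 / sqrt (real m))" by (intro sum_mono frequency_snd[OF m Ccell(2)])
      finally show ?thesis by simp
    qed
    have "(\<integral>z. ?J \<partial>samples n m) \<le> (\<integral>z. ?W z + ?avc z + ?avd z + ?ep + ?eq
        + 2 * K\<^sup>2 * (\<Sum>k\<in>range c. ?fc k z) + 2 * K\<^sup>2 * (\<Sum>l\<in>range d. ?fd l z) \<partial>samples n m)"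
    proof (rule integral_mono)
      show "integrable (samples n m) (\<lambda>z. ?W z + ?avc z + ?avd z + ?ep + ?eq
        + 2 * K\<^sup>2 * (\<Sum>k\<in>range c. ?fc k z) + 2 * K\<^sup>2 * (\<Sum>l\<in>range d. ?fd l z))"
        by (intro Bochner_Integration.integrable_add integrable_mult_right intc inte) simp_all
      show "?J \<le> ?W z + ?avc z + ?avd z + ?ep + ?eq
        + 2 * K\<^sup>2 * (\<Sum>k\<in>range c. ?fc k z) + 2 * K\<^sup>2 * (\<Sum>l\<in>range d. ?fd l z)" for z
        by (rule quantized_bound[OF n m t c(1) d(1) c(2) d(2) K c(4) d(4)])
    qed simp
    also have "\<dots> = (\<integral>z. ?W z \<partial>samples n m) + ?ep + ?eq + ?ep + ?eq
        + 2 * K\<^sup>2 * (\<integral>z. (\<Sum>k\<in>range c. ?fc k z) \<partial>samples n m) + 2 * K\<^sup>2 * (\<integral>z. (\<Sum>l\<in>range d. ?fd l z) \<partial>samples n m)"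
    proof -
      have split: "(\<integral>z. p z + q z + r z + a + b + k1 * u z + k2 * v z \<partial>samples n m)
          = (\<integral>z. p z \<partial>samples n m) + (\<integral>z. q z \<partial>samples n m) + (\<integral>z. r z \<partial>samples n m) + a + b + k1 * (\<integral>z. u z \<partial>samples n m) + k2 * (\<integral>z. v z \<partial>samples n m)"
        if "integrable (samples n m) p" "integrable (samples n m) q" "integrable (samples n m) r" "integrable (samples n m) u" "integrable (samples n m) v"
        for p q r u v :: "(nat \<Rightarrow> 'a) \<times> (nat \<Rightarrow> 'a) \<Rightarrow> real" and a b k1 k2 :: real
        using that by (simp add: S.prob_space)
      show ?thesis
        unfolding split[OF inte(3,1,2) intc] integrable_average_fst(2)[OF em(1) c(4) n] integrable_average_snd(2)[OF em(2) d(4) m] by simp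
    qed
    finally have J: "?J \<le> (\<integral>z. ?W z \<partial>samples n m) + 2 * ?ep + 2 * ?eq
        + 2 * K\<^sup>2 * (\<integral>z. (\<Sum>k\<in>range c. ?fc k z) \<partial>samples n m) + 2 * K\<^sup>2 * (\<integral>z. (\<Sum>l\<in>range d. ?fd l z) \<partial>samples n m)"
      by (simp add: S.prob_space)
    have "2 * K\<^sup>2 * (\<integral>z. (\<Sum>k\<in>range c. ?fc k z) \<partial>samples n m) + 2 * K\<^sup>2 * (\<integral>z. (\<Sum>l\<in>range d. ?fd l z) \<partial>samples n m)
        \<le> 2 * K\<^sup>2 * (real (card (range c)) / sqrt (real N)) + 2 * K\<^sup>2 * (real (card (range d)) / sqrt (real N))"
    proof (intro add_mono mult_left_mono)
      have "real (card (range c)) / sqrt (real n) \<le> real (card (range c)) / sqrt (real N)"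
        using nN N_def by (intro divide_left_mono) auto
      with Ec show "(\<integral>z. (\<Sum>k\<in>range c. ?fc k z) \<partial>samples n m) \<le> real (card (range c)) / sqrt (real N)" by linarith
      have "real (card (range d)) / sqrt (real m) \<le> real (card (range d)) / sqrt (real N)"
        using mN N_def by (intro divide_left_mono) auto
      with Ed show "(\<integral>z. (\<Sum>l\<in>range d. ?fd l z) \<partial>samples n m) \<le> real (card (range d)) / sqrt (real N)" by linarith
    qed auto
    also have "\<dots> = L / sqrt (real N)" by (simp add: L_def add_divide_distrib algebra_simps)
    also have "\<dots> \<le> \<epsilon> / 2" by (rule N(2)) simp
    finally have fr: "2 * K\<^sup>2 * (\<integral>z. (\<Sum>k\<in>range c. ?fc k z) \<partial>samples n m) + 2 * K\<^sup>2 * (\<integral>z. (\<Sum>l\<in>range d. ?fd l z) \<partial>samples n m) \<le> \<epsilon> / 2" .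
    have "(\<integral>z. gap n m (fst z) (snd z) \<partial>samples n m) = ?J - (\<integral>z. ?W z \<partial>samples n m)"
      unfolding gap_def
      using integrable_average_fst[OF f_measurable f_integrable, of n m] integrable_average_snd(1)[OF g_measurable g_integrable, of n m]
        integrable_average_snd(2)[OF g_measurable g_integrable m, of n] n inte(3)
      by simp
    also have "\<dots> \<le> \<epsilon>" using J fr c(5) d(5) tM by linarith
    finally show ?thesis .
  qed
  then show ?thesis using N(1)[of N] by blast
qed

lemma A_nonempty: "A \<noteq> {}" and B_nonempty: "B \<noteq> {}"
  using eventually_happens'[OF P.ae_filter_bot AE_A] eventually_happens'[OF Q.ae_filter_bot AE_B] by auto

text \<open>Since \<open>f x = x \<bullet> y - g y\<close> on an optimal coupling, \<open>f\<close> inherits two moments from the four moments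
  of \<open>P\<close> and \<open>Q\<close>. Only almost optimal couplings are at hand, which the truncation at level \<open>K\<close> allows for.\<close>

lemma f_square_integrable: "integrable P (\<lambda>x. (f x)\<^sup>2)"
proof -
  obtain x0 y0 where x0: "x0 \<in> A" and y0: "y0 \<in> B" using A_nonempty B_nonempty by blast
  \<comment> \<open>The square of the positive part, cut at \<open>K\<close>: bounded, hence
    integrable, and equal to the full square once \<open>K\<close> is large. The negative part of
    \<open>f\<close> is controlled separately by the affine minorant
    \<open>x \<bullet> y0 - g y0\<close>.\<close>
  define h where "h K r = (min (max 0 r) K)\<^sup>2" for K r :: real
  define C0 where "C0 = 3 * norm x0 ^ 4 + 6 * (f x0)\<^sup>2"
  define C where "C = 3 * (\<integral>x. norm x ^ 4 \<partial>P) + C0 + 6 * (\<integral>y. norm y ^ 4 \<partial>Q)"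
  have [measurable]: "h K \<in> borel_measurable borel" for K unfolding h_def by measurable
  have trunc: "h K r \<le> 2 * w\<^sup>2 + 2 * K * \<gamma>" if "K > 0" "w \<ge> 0" "\<gamma> \<ge> 0" "r \<le> w + \<gamma>" for K r w \<gamma>
  proof -
    have "min (max 0 r) K \<le> w + min \<gamma> K" using that by auto
    then have "h K r \<le> (w + min \<gamma> K)\<^sup>2" unfolding h_def using that by (intro power_mono) auto
    also have "\<dots> \<le> 2 * w\<^sup>2 + 2 * (min \<gamma> K)\<^sup>2"
      using sum_squares_bound[of w "min \<gamma> K"] by (simp add: power2_sum)
    \<comment> \<open>Truncation replaces the square of the slack by a term linear in the slack, so
      that smallness of its mean is enough.\<close>
    also have "(min \<gamma> K)\<^sup>2 \<le> K * \<gamma>"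
      unfolding power2_eq_square using that by (intro mult_mono) auto
    finally show ?thesis by simp
  qed
  have pw: "h K (f x) \<le> 3 * norm x ^ 4 + 6 * norm y ^ 4 + C0 + 2 * K * (f x + g y - x \<bullet> y)"
    if K: "K > 0" and x: "x \<in> A" and y: "y \<in> B" for K x y
  proof -
    let ?w = "norm x * norm y + norm x0 * norm y + \<bar>f x0\<bar>"
    have "- g y \<le> f x0 - x0 \<bullet> y" using feasible[OF x0 y] by simp
    also have "\<dots> \<le> \<bar>f x0\<bar> + norm x0 * norm y" using Cauchy_Schwarz_ineq2[of x0 y] by linarith
    finally have "f x \<le> ?w + (f x + g y - x \<bullet> y)" using Cauchy_Schwarz_ineq2[of x y] by linarith
    then have "h K (f x) \<le> 2 * ?w\<^sup>2 + 2 * K * (f x + g y - x \<bullet> y)"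
      using feasible[OF x y] K by (intro trunc) auto
    also have "?w\<^sup>2 \<le> 3 * ((norm x * norm y)\<^sup>2 + (norm x0 * norm y)\<^sup>2 + (f x0)\<^sup>2)"
    proof -
      have "(p + q + r)\<^sup>2 \<le> 3 * (p\<^sup>2 + q\<^sup>2 + r\<^sup>2)" for p q r :: real
        using sum_squares_bound[of p q] sum_squares_bound[of p r] sum_squares_bound[of q r]
        by (simp add: power2_eq_square algebra_simps)
      from this[of "norm x * norm y" "norm x0 * norm y" "\<bar>f x0\<bar>"] show ?thesis by simp
    qed
    also have "2 * (3 * ((norm x * norm y)\<^sup>2 + (norm x0 * norm y)\<^sup>2 + (f x0)\<^sup>2)) \<le> 3 * norm x ^ 4 + 6 * norm y ^ 4 + C0"
    proof -
      have "2 * (p * q)\<^sup>2 \<le> p ^ 4 + q ^ 4" for p q :: real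
        using sum_squares_bound[of "p\<^sup>2" "q\<^sup>2"] by (simp add: power_mult_distrib)
      from this[of "norm x" "norm y"] this[of "norm x0" "norm y"] show ?thesis unfolding C0_def by simp
    qed
    finally show ?thesis by simp
  qed
  have avg: "(\<Sum>i<n. h K (f (x i))) / real n \<le> 3 * ((\<Sum>i<n. norm (x i) ^ 4) / real n) + C0 + 6 * ((\<Sum>j<m. norm (y j) ^ 4) / real m) + 2 * K * gap n m x y"
    if n: "n \<ge> 1" and m: "m \<ge> 1" and K: "K > 0" and x: "\<And>i. i < n \<Longrightarrow> x i \<in> A" and y: "\<And>j. j < m \<Longrightarrow> y j \<in> B" for n m K x y
  proof -
    obtain a where a: "plan n m a" and val: "transport_value n m (\<lambda>i j. x i \<bullet> y j) = (\<Sum>i<n. \<Sum>j<m. a i j * (x i \<bullet> y j))"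
      by (rule transport_duality[OF n m, of "\<lambda>i j. x i \<bullet> y j"]) blast
    \<comment> \<open>The bound \<open>pw\<close> is rearranged so that the inner product stands
      alone on the left; averaging over an optimal plan then produces the term
      \<open>2 * K * gap\<close>.\<close>
    have "(\<Sum>i<n. \<Sum>j<m. a i j * (2 * K * (x i \<bullet> y j)))
        \<le> (\<Sum>i<n. 2 * K * f (x i) + 3 * norm (x i) ^ 4 + C0 - h K (f (x i))) / real n + (\<Sum>j<m. 2 * K * g (y j) + 6 * norm (y j) ^ 4) / real m"
      using pw[OF K x y] by (intro plan_weak_duality a) (simp add: algebra_simps)
    moreover have "(\<Sum>i<n. \<Sum>j<m. a i j * (2 * K * (x i \<bullet> y j))) = 2 * K * transport_value n m (\<lambda>i j. x i \<bullet> y j)"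
      unfolding val by (simp add: sum_distrib_left mult_ac)
    moreover have "(\<Sum>i<n. 2 * K * f (x i) + 3 * norm (x i) ^ 4 + C0 - h K (f (x i))) / real n
        = 2 * K * ((\<Sum>i<n. f (x i)) / real n) + 3 * ((\<Sum>i<n. norm (x i) ^ 4) / real n) + C0 - (\<Sum>i<n. h K (f (x i))) / real n"
      using n by (simp add: sum.distrib sum_subtractf sum_distrib_left[symmetric] add_divide_distrib diff_divide_distrib)
    moreover have "(\<Sum>j<m. 2 * K * g (y j) + 6 * norm (y j) ^ 4) / real m
        = 2 * K * ((\<Sum>j<m. g (y j)) / real m) + 6 * ((\<Sum>j<m. norm (y j) ^ 4) / real m)"
      by (simp add: sum.distrib sum_distrib_left[symmetric] add_divide_distrib)
    ultimately show ?thesis unfolding gap_def by (simp only: right_diff_distrib distrib_left)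
  qed
  have hint: "integrable P (\<lambda>x. h K (f x))" if "K > 0" for K
    by (intro P.integrable_const_bound[of _ "K\<^sup>2"]) (use that in \<open>auto simp: h_def intro!: power_mono\<close>)
  have EK: "(\<integral>x. h K (f x) \<partial>P) \<le> C" if K: "K > 0" for K
  proof (rule field_le_epsilon)
    fix e :: real assume e: "e > 0"
    \<comment> \<open>The level \<open>K\<close> stays fixed while the sample size is chosen so
      large that the expected gap is at most \<open>e / (2 * K)\<close>. The resulting constant
      \<open>C\<close> is free of \<open>K\<close>.\<close>
    then have "e / (2 * K) > 0" using K by simp
    then obtain n where n: "n \<ge> 1" and gap: "(\<integral>z. gap n n (fst z) (snd z) \<partial>samples n n) \<le> e / (2 * K)"
      using expectation_gap_small by blast
    interpret S: prob_space "samples n n" by (rule prob_space_samples)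
    have hm: "(\<lambda>x. h K (f x)) \<in> borel_measurable borel" by measurable
    note i1 = integrable_average_fst[OF hm hint[OF K], of n n] and i2 = integrable_average_fst[OF _ P4, of n n]
      and i3 = integrable_average_snd[OF _ Q4, of n n] and i4 = gap_integrable[OF n n]
    have "(\<integral>x. h K (f x) \<partial>P) = (\<integral>z. (\<Sum>i<n. h K (f (fst z i))) / real n \<partial>samples n n)" using i1(2)[OF n] by simp
    also have "\<dots> \<le> (\<integral>z. 3 * ((\<Sum>i<n. norm (fst z i) ^ 4) / real n) + C0 + 6 * ((\<Sum>j<n. norm (snd z j) ^ 4) / real n) + 2 * K * gap n n (fst z) (snd z) \<partial>samples n n)"
    proof (rule integral_mono_AE[OF i1(1)])
      show "integrable (samples n n) (\<lambda>z. 3 * ((\<Sum>i<n. norm (fst z i) ^ 4) / real n) + C0 + 6 * ((\<Sum>j<n. norm (snd z j) ^ 4) / real n) + 2 * K * gap n n (fst z) (snd z))"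
        by (intro Bochner_Integration.integrable_add integrable_mult_right i2(1) i3(1) i4) simp_all
      show "AE z in samples n n. (\<Sum>i<n. h K (f (fst z i))) / real n \<le> 3 * ((\<Sum>i<n. norm (fst z i) ^ 4) / real n) + C0 + 6 * ((\<Sum>j<n. norm (snd z j) ^ 4) / real n) + 2 * K * gap n n (fst z) (snd z)"
        using AE_samples[of n n] by eventually_elim (intro avg[OF n n K], auto)
    qed
    also have "\<dots> = 3 * (\<integral>z. (\<Sum>i<n. norm (fst z i) ^ 4) / real n \<partial>samples n n) + C0
        + 6 * (\<integral>z. (\<Sum>j<n. norm (snd z j) ^ 4) / real n \<partial>samples n n) + 2 * K * (\<integral>z. gap n n (fst z) (snd z) \<partial>samples n n)"
    proof -
      have "(\<integral>z. 3 * p z + C0 + 6 * q z + 2 * K * r z \<partial>samples n n)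
          = 3 * (\<integral>z. p z \<partial>samples n n) + C0 + 6 * (\<integral>z. q z \<partial>samples n n) + 2 * K * (\<integral>z. r z \<partial>samples n n)"
        if "integrable (samples n n) p" "integrable (samples n n) q" "integrable (samples n n) r" for p q r :: "(nat \<Rightarrow> 'a) \<times> (nat \<Rightarrow> 'a) \<Rightarrow> real"
        using that by (simp add: S.prob_space)
      from this[OF i2(1) i3(1) i4] show ?thesis by simp
    qed
    also have "\<dots> \<le> C + e"
    proof -
      have "2 * K * (\<integral>z. gap n n (fst z) (snd z) \<partial>samples n n) \<le> 2 * K * (e / (2 * K))"
        using gap K by (intro mult_left_mono) auto
      then show ?thesis using i2(2) i3(2) n K by (simp add: C_def)
    qed
    finally show "(\<integral>x. h K (f x) \<partial>P) \<le> C + e" .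
  qed
  have "(\<integral>\<^sup>+x. ennreal ((max 0 (f x))\<^sup>2) \<partial>P) = (\<integral>\<^sup>+x. liminf (\<lambda>k. ennreal (h (real (Suc k)) (f x))) \<partial>P)"
  proof (intro nn_integral_cong lim_imp_Liminf[symmetric] sequentially_bot tendsto_ennrealI)
    fix x
    obtain k0 where "max 0 (f x) \<le> real k0" using real_arch_simple by blast
    then have "\<forall>\<^sub>F k in sequentially. h (real (Suc k)) (f x) = (max 0 (f x))\<^sup>2"
      unfolding eventually_sequentially h_def by (intro exI[of _ k0]) (auto simp: min_def)
    then show "(\<lambda>k. h (real (Suc k)) (f x)) \<longlonglongrightarrow> (max 0 (f x))\<^sup>2" by (rule tendsto_eventually)
  qed
  also have "\<dots> \<le> liminf (\<lambda>k. \<integral>\<^sup>+x. ennreal (h (real (Suc k)) (f x)) \<partial>P)"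
    by (intro nn_integral_liminf) measurable
  also have "\<dots> \<le> ennreal C"
  proof (intro Liminf_le sequentially_bot always_eventually allI)
    fix k
    have "(\<integral>\<^sup>+x. ennreal (h (real (Suc k)) (f x)) \<partial>P) = ennreal (\<integral>x. h (real (Suc k)) (f x) \<partial>P)"
      by (intro nn_integral_eq_integral hint) (auto simp: h_def)
    also have "\<dots> \<le> ennreal C" by (intro ennreal_leI EK) simp
    finally show "(\<integral>\<^sup>+x. ennreal (h (real (Suc k)) (f x)) \<partial>P) \<le> ennreal C" .
  qed
  finally have "integrable P (\<lambda>x. (max 0 (f x))\<^sup>2)"
    by (intro integrableI_bounded) (auto intro: le_less_trans)
  then have "integrable P (\<lambda>x. (max 0 (f x))\<^sup>2 + 2 * ((norm y0)\<^sup>2 * (norm x)\<^sup>2 + (g y0)\<^sup>2))"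
    using P2 by auto
  then show ?thesis
  proof (rule Bochner_Integration.integrable_bound)
    show "AE x in P. norm ((f x)\<^sup>2) \<le> norm ((max 0 (f x))\<^sup>2 + 2 * ((norm y0)\<^sup>2 * (norm x)\<^sup>2 + (g y0)\<^sup>2))"
      using AE_A
    proof eventually_elim
      case (elim x)
      have "(f x)\<^sup>2 \<le> (max 0 (f x))\<^sup>2 + 2 * ((norm y0)\<^sup>2 * (norm x)\<^sup>2 + (g y0)\<^sup>2)"
      proof (cases "f x \<ge> 0")
        case False
        have "- f x \<le> g y0 - x \<bullet> y0" using feasible[OF elim y0] by simp
        also have "\<dots> \<le> \<bar>g y0\<bar> + norm x * norm y0" using Cauchy_Schwarz_ineq2[of x y0] by linarith
        finally have "(- f x)\<^sup>2 \<le> (\<bar>g y0\<bar> + norm x * norm y0)\<^sup>2" using False by (intro power_mono) auto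
        also have "\<dots> \<le> 2 * ((norm y0)\<^sup>2 * (norm x)\<^sup>2 + (g y0)\<^sup>2)"
          using sum_squares_bound[of "\<bar>g y0\<bar>" "norm x * norm y0"] by (simp add: power2_sum power_mult_distrib mult_ac)
        finally show ?thesis by (simp add: add_increasing)
      qed (auto simp: max_def)
      then show ?case unfolding real_norm_def abs_power2 by (rule order_trans[OF _ abs_ge_self])
    qed
  qed simp
qed

end

section \<open>Shifting barycentres along chains\<close>

lemma path_weight_map_upt:
  "path_weight d (map h [0..<Suc N] @ [b]) = (\<Sum>k<N. d (h k) (h (Suc k))) + d (h N) b"
proof (induction N arbitrary: b)
  case 0
  then show ?case by simp
next
  case (Suc N)
  have "path_weight d (map h [0..<Suc (Suc N)] @ [b]) = path_weight d (map h [0..<Suc N] @ [h (Suc N), b])" by simp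
  also have "\<dots> = path_weight d (map h [0..<Suc N] @ [h (Suc N)]) + d (h (Suc N)) b" by (rule path_weight_snoc)
  finally show ?case using Suc.IH[of "h (Suc N)"] by simp
qed

text \<open>Shifting the barycentres along a chain of sample points gives a competitor for the sample in which
  \<open>x (h 0)\<close> is replaced by \<open>t\<close>.\<close>

lemma transport_value_shift_ge:
  fixes x z :: "nat \<Rightarrow> 'a::euclidean_space"
  assumes n: "n \<ge> 1"
    and val: "transport_value n m (\<lambda>i j. x i \<bullet> y j) = (\<Sum>i<n. x i \<bullet> z i) / real n"
      "\<And>x' \<sigma>. \<sigma> permutes {..<n} \<Longrightarrow> (\<Sum>i<n. x' (\<sigma> i) \<bullet> z i) / real n \<le> transport_value n m (\<lambda>i j. x' i \<bullet> y j)"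
    and inj: "inj_on h {..N}" and lt: "\<And>k. k \<le> N \<Longrightarrow> h k < n"
  shows "transport_value n m (\<lambda>i j. x i \<bullet> y j)
      + ((\<Sum>k<N. (x (h (Suc k)) - x (h k)) \<bullet> z (h k)) + (t - x (h N)) \<bullet> z (h N)) / real n
    \<le> transport_value n m (\<lambda>i j. (x(h 0 := t)) i \<bullet> y j)"
proof -
  define x' where "x' = x(h 0 := t)"
  define d where "d i k = (x' k - x i) \<bullet> z i" for i k
  let ?xs = "map h [0..<Suc N]"
  have xs: "?xs = h 0 # map h [1..<Suc N]"
    by (metis One_nat_def list.simps(9) upt_conv_Cons zero_less_Suc)
  have dist: "distinct ?xs" using inj by (simp add: distinct_map atLeast0LessThan lessThan_Suc_atMost del: upt_Suc)
  let ?\<sigma> = "cycle_of_list ?xs"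
  have set_xs: "set ?xs \<subseteq> {..<n}" using lt by (auto simp del: upt_Suc)
  have \<sigma>: "?\<sigma> permutes {..<n}" by (rule permutes_subset[OF cycle_permutes set_xs])
  have out: "?\<sigma> i = i" if "i \<notin> set ?xs" for i using cycle_permutes that by (metis permutes_def)
  have "(\<Sum>i<n. x' (?\<sigma> i) \<bullet> z i) - (\<Sum>i<n. x i \<bullet> z i) = (\<Sum>i<n. d i (?\<sigma> i))"
    by (simp add: d_def inner_diff_left sum_subtractf)
  also have "\<dots> = (\<Sum>i\<in>set ?xs. d i (?\<sigma> i))"
  \<comment> \<open>Off the chain the permutation is the identity and, as \<open>h 0\<close> lies on
    the chain, the points are unchanged.\<close>
  proof (rule sum.mono_neutral_right[OF finite_lessThan set_xs], intro ballI)
    fix i assume i: "i \<in> {..<n} - set ?xs"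
    then have "i \<noteq> h 0" unfolding xs by auto
    then show "d i (?\<sigma> i) = 0" using out i by (simp add: d_def x'_def del: upt_Suc)
  qed
  also have "\<dots> = path_weight d (?xs @ [h 0])"
    using sum_cycle[of "h 0" "map h [1..<Suc N]" d] dist unfolding xs[symmetric] by (metis append_Cons xs)
  also have "\<dots> = (\<Sum>k<N. d (h k) (h (Suc k))) + d (h N) (h 0)" by (rule path_weight_map_upt)
  also have "(\<Sum>k<N. d (h k) (h (Suc k))) = (\<Sum>k<N. (x (h (Suc k)) - x (h k)) \<bullet> z (h k))"
  proof (intro sum.cong refl)
    fix k assume "k \<in> {..<N}"
    \<comment> \<open>Injectivity of \<open>h\<close> keeps the replaced position out of the
      interior of the chain.\<close>
    then have "h (Suc k) \<noteq> h 0" using inj by (auto dest: inj_onD)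
    then show "d (h k) (h (Suc k)) = (x (h (Suc k)) - x (h k)) \<bullet> z (h k)" by (simp add: d_def x'_def)
  qed
  \<comment> \<open>The closing edge of the cycle leads back to the position \<open>h 0\<close>,
    which now carries \<open>t\<close>.\<close>
  also have "d (h N) (h 0) = (t - x (h N)) \<bullet> z (h N)" by (simp add: d_def x'_def)
  finally have "((\<Sum>k<N. (x (h (Suc k)) - x (h k)) \<bullet> z (h k)) + (t - x (h N)) \<bullet> z (h N)) / real n
      = (\<Sum>i<n. x' (?\<sigma> i) \<bullet> z i) / real n - (\<Sum>i<n. x i \<bullet> z i) / real n"
    unfolding diff_divide_distrib[symmetric] by simp
  then show ?thesis using val(2)[OF \<sigma>, of x'] unfolding val(1) x'_def by simp
qed

text \<open>Greedy choice: together with the prescribed start, at most \<open>N\<close> elements are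
  in use before any choice, and each set has at least \<open>N + 1\<close>.\<close>

lemma distinct_representatives:
  assumes fin: "\<And>k. k \<in> {1..N} \<Longrightarrow> finite (S k)" and card: "\<And>k. k \<in> {1..N} \<Longrightarrow> N + 1 \<le> card (S k)"
  obtains h where "h 0 = (i::'i)" "inj_on h {..N}" "\<And>k. k \<in> {1..N} \<Longrightarrow> h k \<in> S k"
proof -
  have "\<exists>h. h 0 = i \<and> inj_on h {..l} \<and> (\<forall>k\<in>{1..l}. h k \<in> S k)" if "l \<le> N" for l
    using that
  proof (induction l)
    case 0
    then show ?case by auto
  next
    case (Suc l)
    then obtain h where h: "h 0 = i" "inj_on h {..l}" "\<forall>k\<in>{1..l}. h k \<in> S k" by auto
    have "card (h ` {..l}) < card (S (Suc l))"
      using card_image_le[of "{..l}" h] card[of "Suc l"] Suc.prems by auto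
    then obtain w where w: "w \<in> S (Suc l)" "w \<notin> h ` {..l}"
      by (metis card_mono finite_atMost finite_imageI not_less subsetI)
    have "inj_on (h(Suc l := w)) {..Suc l}"
      using h(2) w(2) by (auto simp: inj_on_def atMost_Suc)
    moreover have "(h(Suc l := w)) 0 = i" "\<forall>k\<in>{1..Suc l}. (h(Suc l := w)) k \<in> S k"
      using h w(1) by (auto simp: atLeastAtMostSuc_conv)
    ultimately show ?case by blast
  qed
  from this[of N] show thesis using that by blast
qed

text \<open>Tested at distance \<open>R\<close> from \<open>p\<close> in the direction of
  \<open>z\<close>, the subgradient inequality reads
  \<open>R * norm z \<le> 2 * M + \<gamma>\<close>.\<close>

lemma approximate_subgradient_norm_le:
  fixes f :: "'a::euclidean_space \<Rightarrow> real"
  assumes R: "R > 0" and sub: "\<And>v. norm (v - p) \<le> R \<Longrightarrow> f p + (v - p) \<bullet> z - \<gamma> \<le> f v"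
    and bd: "\<And>v. norm (v - p) \<le> R \<Longrightarrow> \<bar>f v\<bar> \<le> M" and \<gamma>: "\<gamma> \<le> 1"
  shows "norm z \<le> (2 * M + 1) / R"
proof (cases "z = 0")
  case True
  have "0 \<le> M" using bd[of p] R by simp
  then show ?thesis using True R by simp
next
  case False
  let ?v = "p + (R / norm z) *\<^sub>R z"
  have nv: "norm (?v - p) \<le> R" using False R by simp
  have "(?v - p) \<bullet> z = R * norm z" using False by (simp add: dot_square_norm power2_eq_square)
  then have "R * norm z \<le> 2 * M + 1" using sub[OF nv] bd[OF nv] bd[of p] R \<gamma> by simp
  then show ?thesis using R by (simp add: pos_le_divide_eq mult.commute)
qed

text \<open>The points \<open>q k\<close> are equally spaced, so that the increments \<open>(q (k + 1) - q k) \<bullet> z k\<close>, which a shift of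
  the barycentres gains, coincide with \<open>(q k - q (k - 1)) \<bullet> z k\<close>, which the subgradient inequality at \<open>q (k - 1)\<close>
  bounds from below. Hence no differentiability of \<open>f\<close> is needed.\<close>

lemma chain_gain_ge:
  fixes f :: "'a::euclidean_space \<Rightarrow> real"
  assumes \<Omega>: "open \<Omega>" "convex \<Omega>" and cont: "continuous_on \<Omega> f" and u: "u \<in> \<Omega>" "u' \<in> \<Omega>" and \<epsilon>: "\<epsilon> > 0"
  obtains N r \<gamma> q where "N \<ge> 1" "r > 0" "0 < \<gamma>" "\<gamma> \<le> 1" "\<And>k. k \<le> N \<Longrightarrow> ball (q k) r \<subseteq> \<Omega>" "q 0 = u" "q N = u'"
    "\<And>p z. (\<And>k. k \<le> N \<Longrightarrow> p k \<in> ball (q k) r) \<Longrightarrow> p (Suc N) \<in> ball u' r \<Longrightarrow>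
      (\<And>v. v \<in> \<Omega> \<Longrightarrow> f (p 0) + (v - p 0) \<bullet> z 0 - 1 \<le> f v) \<Longrightarrow>
      (\<And>k v. k \<in> {1..N} \<Longrightarrow> v \<in> \<Omega> \<Longrightarrow> f (p k) + (v - p k) \<bullet> z k - \<gamma> \<le> f v) \<Longrightarrow>
      f (p (Suc N)) - f (p 0) - (\<Sum>k\<le>N. (p (Suc k) - p k) \<bullet> z k) \<le> \<epsilon>"
proof -
  let ?seg = "closed_segment u u'"
  have seg: "?seg \<subseteq> \<Omega>" using u \<Omega>(2) by (rule closed_segment_subset)
  \<comment> \<open>A closed tube around the segment stays in \<open>\<Omega>\<close>. Its
    compactness provides the bound \<open>M\<close> and a uniform modulus of continuity for
    \<open>f\<close>.\<close>
  obtain R where R: "R > 0" "(\<Union>s\<in>?seg. cball s R) \<subseteq> \<Omega>"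
    using compact_subset_open_imp_cball_epsilon_subset[OF compact_segment \<Omega>(1) seg] by blast
  define S where "S = (\<Union>s\<in>?seg. cball s R)"
  have S: "compact S" "S \<subseteq> \<Omega>" unfolding S_def using R by (auto intro: compact_minkowski_sum_cball)
  have contS: "continuous_on S f" using cont S(2) by (rule continuous_on_subset)
  obtain M where M: "\<And>v. v \<in> S \<Longrightarrow> \<bar>f v\<bar> \<le> M"
    using compact_imp_bounded[OF compact_continuous_image[OF contS S(1)]] unfolding bounded_iff by auto
  have M0: "0 \<le> M" using M[of u] R(1) unfolding S_def by force
  \<comment> \<open>A common bound for the vectors \<open>z k\<close>: the tube contains the ball of
    radius \<open>R / 2\<close> around each \<open>p k\<close>, because \<open>r \<le> R / 2\<close>
    below, and all slacks are at most 1.\<close>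
  define K where "K = (2 * M + 1) / (R / 2)"
  have K: "K > 0" unfolding K_def using M0 R(1) by (intro divide_pos_pos) auto
  have uc: "uniformly_continuous_on S f" using contS S(1) by (rule compact_uniformly_continuous)
  have mod: "\<exists>\<delta>>0. \<forall>v\<in>S. \<forall>w\<in>S. norm (v - w) < \<delta> \<longrightarrow> \<bar>f v - f w\<bar> < e" if "e > 0" for e
    using uc that unfolding uniformly_continuous_on_def dist_norm real_norm_def by blast
  obtain \<delta>0 where \<delta>0: "\<delta>0 > 0" "\<And>v w. v \<in> S \<Longrightarrow> w \<in> S \<Longrightarrow> norm (v - w) < \<delta>0 \<Longrightarrow> \<bar>f v - f w\<bar> < \<epsilon> / 8"
    using mod[of "\<epsilon> / 8"] \<epsilon> by auto
  \<comment> \<open>Step length: it keeps the change of \<open>f\<close> within the modulus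
    \<open>\<delta>0\<close>, and its product with \<open>K\<close> is at most
    \<open>\<epsilon> / 16\<close>.\<close>
  define s where "s = min (\<delta>0 / 2) (\<epsilon> / (16 * K))"
  have s: "s > 0" unfolding s_def using \<delta>0 \<epsilon> K by simp
  obtain N0 :: nat where N0: "norm (u' - u) / s < real N0" using reals_Archimedean2 by blast
  define N where "N = max 1 N0"
  have N: "N \<ge> 1" "norm (u' - u) / s < real N" using N0 by (auto simp: N_def)
  have Np: "real N > 0" using N(1) by simp
  define h where "h = (1 / real N) *\<^sub>R (u' - u)"
  have h: "norm h \<le> s"
  proof -
    have "norm (u' - u) \<le> real N * s" using N(2) s by (simp add: divide_less_eq)
    then show ?thesis unfolding h_def using Np by (simp add: divide_le_eq mult.commute)
  qed
  obtain \<delta>2 where \<delta>2: "\<delta>2 > 0" "\<And>v w. v \<in> S \<Longrightarrow> w \<in> S \<Longrightarrow> norm (v - w) < \<delta>2 \<Longrightarrow> \<bar>f v - f w\<bar> < \<epsilon> / (8 * real N)"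
    using mod[of "\<epsilon> / (8 * real N)"] \<epsilon> Np by auto
  \<comment> \<open>The radius is chosen after \<open>N\<close>, since displacements by
    \<open>r\<close> are paid at every step; the 48 makes \<open>3 * N * r * K\<close> at most
    \<open>\<epsilon> / 16\<close>.\<close>
  define r where "r = min (min (\<delta>0 / 2) \<delta>2) (min (R / 2) (\<epsilon> / (48 * real N * K)))"
  have r: "r > 0" "r \<le> \<delta>0 / 2" "r \<le> \<delta>2" "r \<le> R / 2" "r \<le> \<epsilon> / (48 * real N * K)"
    unfolding r_def using \<delta>0 \<delta>2 R(1) \<epsilon> K Np by auto
  have rK: "real N * (r * K) \<le> \<epsilon> / 48"
  proof -
    have "r * (real N * K) \<le> \<epsilon> / (48 * real N * K) * (real N * K)" using r(5) K Np by (intro mult_right_mono) auto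
    then show ?thesis using K Np by (simp add: mult_ac)
  qed
  have rK1: "r * K \<le> \<epsilon> / 48"
  proof -
    have "1 * (r * K) \<le> real N * (r * K)" using N(1) r(1) K by (intro mult_right_mono) auto
    then show ?thesis using rK by simp
  qed
  have hK: "norm h * K \<le> \<epsilon> / 16"
  proof -
    have "norm h * K \<le> \<epsilon> / (16 * K) * K" using h K by (intro mult_right_mono) (auto simp: s_def)
    then show ?thesis using K by simp
  qed
  define \<gamma> where "\<gamma> = min 1 (\<epsilon> / (8 * real N))"
  have \<gamma>: "0 < \<gamma>" "\<gamma> \<le> 1" "\<gamma> \<le> \<epsilon> / (8 * real N)" unfolding \<gamma>_def using \<epsilon> Np by auto
  define q where "q k = u + real k *\<^sub>R h" for k
  have q: "q 0 = u" "q N = u'" using Np by (simp_all add: q_def h_def)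
  have q_seg: "q k \<in> ?seg" if "k \<le> N" for k
    unfolding in_segment using that Np
    by (intro exI[of _ "real k / real N"]) (simp add: q_def h_def algebra_simps)
  have near_S: "w \<in> S" if "k \<le> N" "norm (w - q k) \<le> R" for k w
    unfolding S_def using q_seg[OF that(1)] that(2) by (auto simp: dist_norm norm_minus_commute intro!: bexI[of _ "q k"])
  show thesis
  proof (rule that[OF N(1) r(1) \<gamma>(1,2) _ q])
    show "ball (q k) r \<subseteq> \<Omega>" if k: "k \<le> N" for k
    proof
      fix w assume "w \<in> ball (q k) r"
      then show "w \<in> \<Omega>" using near_S[OF k, of w] r(4) R(1) S(2) by (auto simp: dist_norm norm_minus_commute)
    qed
  next
    fix p z
    assume p: "\<And>k. k \<le> N \<Longrightarrow> p k \<in> ball (q k) r" and pS: "p (Suc N) \<in> ball u' r"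
      and z0: "\<And>v. v \<in> \<Omega> \<Longrightarrow> f (p 0) + (v - p 0) \<bullet> z 0 - 1 \<le> f v"
      and zk: "\<And>k v. k \<in> {1..N} \<Longrightarrow> v \<in> \<Omega> \<Longrightarrow> f (p k) + (v - p k) \<bullet> z k - \<gamma> \<le> f v"
    have pd: "norm (p k - q k) < r" if "k \<le> N" for k using p[OF that] by (simp add: dist_norm norm_minus_commute)
    have td: "norm (p (Suc N) - q N) < r" using pS q(2) by (simp add: dist_norm norm_minus_commute)
    have p_in: "p k \<in> S" if "k \<le> N" for k using near_S[OF that, of "p k"] pd[OF that] r(4) R(1) by auto
    have q_in: "q k \<in> S" if "k \<le> N" for k using near_S[OF that, of "q k"] R(1) by simp
    have t_in: "p (Suc N) \<in> S" using near_S[of N "p (Suc N)"] td r(4) R(1) by auto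
    have zK: "norm (z k) \<le> K" if k: "k \<le> N" for k
      unfolding K_def
    proof (rule approximate_subgradient_norm_le[where p = "p k" and f = f and \<gamma> = "if k = 0 then 1 else \<gamma>"])
      have vS: "v \<in> S" if "norm (v - p k) \<le> R / 2" for v
      proof (rule near_S[OF k])
        have "norm (v - q k) \<le> norm (v - p k) + norm (p k - q k)" using norm_triangle_ineq[of "v - p k" "p k - q k"] by simp
        then show "norm (v - q k) \<le> R" using that pd[OF k] r(4) by simp
      qed
      show "\<bar>f v\<bar> \<le> M" if "norm (v - p k) \<le> R / 2" for v using M vS[OF that] by blast
      show "f (p k) + (v - p k) \<bullet> z k - (if k = 0 then 1 else \<gamma>) \<le> f v" if "norm (v - p k) \<le> R / 2" for v
        using z0[of v] zk[of k v] vS[OF that] S(2) k by (cases "k = 0") auto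
      show "(if k = 0 then 1 else \<gamma>) \<le> 1" using \<gamma> by simp
    qed (use R in simp)
    have cs: "w \<bullet> z k \<ge> - (b * K)" if "norm w \<le> b" "k \<le> N" for w b k
    proof -
      have "norm w * norm (z k) \<le> b * K" using that zK[OF that(2)] by (intro mult_mono) (auto intro: order_trans[OF norm_ge_zero])
      then show ?thesis using Cauchy_Schwarz_ineq2[of w "z k"] by linarith
    qed
    have q_step: "q (Suc k) = q k + h" for k by (simp add: q_def algebra_simps)
    \<comment> \<open>At the starting point the slack is only bounded by 1, too much for a
      telescoping sum. This edge and the last one are short and are bounded through \<open>K\<close>
      alone.\<close>
    have first: "(p 1 - p 0) \<bullet> z 0 \<ge> - ((norm h + 2 * r) * K)"
    proof (rule cs)
      have "p 1 - p 0 = (p 1 - q 1) + h - (p 0 - q 0)" using q_step[of 0] by simp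
      note arg_cong[where f = norm, OF this]
      then have "norm (p 1 - p 0) \<le> norm (p 1 - q 1) + norm h + norm (p 0 - q 0)"
        using norm_triangle_ineq4[of "p 1 - q 1 + h" "p 0 - q 0"] norm_triangle_ineq[of "p 1 - q 1" h] by linarith
      then show "norm (p 1 - p 0) \<le> norm h + 2 * r" using pd[of 0] pd[of 1] N(1) by simp
    qed simp
    have last: "(p (Suc N) - p N) \<bullet> z N \<ge> - (2 * r * K)"
    proof (rule cs)
      have "norm (p (Suc N) - p N) \<le> norm (p (Suc N) - q N) + norm (p N - q N)"
        using norm_triangle_ineq4[of "p (Suc N) - q N" "p N - q N"] by simp
      then show "norm (p (Suc N) - p N) \<le> 2 * r" using pd[of N] td by simp
    qed simp
    have mid: "(p (Suc k) - p k) \<bullet> z k \<ge> f (q k) - f (q (k - 1)) - (3 * (r * K) + \<epsilon> / (4 * real N))" if k: "k \<in> {1..<N}" for k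
    proof -
      have kN: "k \<le> N" "Suc k \<le> N" "k - 1 \<le> N" "k \<in> {1..N}" using k by auto
      have step: "q k = q (k - 1) + h" using q_step[of "k - 1"] k by simp
      have "p (Suc k) - p k = (p (Suc k) - q (Suc k)) + (q k - p k) + h" by (simp add: q_step)
      then have "(p (Suc k) - p k) \<bullet> z k = (p (Suc k) - q (Suc k)) \<bullet> z k + (q k - p k) \<bullet> z k + h \<bullet> z k"
        by (metis inner_add_left)
      moreover have "h \<bullet> z k = (q k - p k) \<bullet> z k - (q (k - 1) - p k) \<bullet> z k"
        by (simp add: step inner_add_left inner_diff_left)
      moreover have "(p (Suc k) - q (Suc k)) \<bullet> z k \<ge> - (r * K)" using pd[OF kN(2)] by (intro cs kN) simp
      moreover have "(q k - p k) \<bullet> z k \<ge> - (r * K)" using pd[OF kN(1)] by (intro cs kN) (simp add: norm_minus_commute)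
      moreover have "f (p k) + (q (k - 1) - p k) \<bullet> z k - \<gamma> \<le> f (q (k - 1))"
        using zk[OF kN(4)] q_in[OF kN(3)] S(2) by auto
      moreover have "\<bar>f (p k) - f (q k)\<bar> < \<epsilon> / (8 * real N)"
        using pd[OF kN(1)] r(3) by (intro \<delta>2(2) p_in q_in kN) simp
      moreover have "\<epsilon> / (8 * real N) + \<epsilon> / (8 * real N) = \<epsilon> / (4 * real N)" by simp
      ultimately show ?thesis using \<gamma>(3) by linarith
    qed
    have "(\<Sum>k\<in>{1..<N}. (p (Suc k) - p k) \<bullet> z k) \<ge> (\<Sum>k\<in>{1..<N}. f (q k) - f (q (k - 1)) - (3 * (r * K) + \<epsilon> / (4 * real N)))"
      using mid by (rule sum_mono)
    moreover have "(\<Sum>k\<in>{1..<N}. f (q k) - f (q (k - 1)) - (3 * (r * K) + \<epsilon> / (4 * real N)))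
        = f (q (N - 1)) - f (q 0) - real (N - 1) * (3 * (r * K) + \<epsilon> / (4 * real N))"
    proof -
      have "(\<Sum>k\<in>{1..<N}. f (q k) - f (q (k - 1))) = (\<Sum>k<N - 1. f (q (Suc k)) - f (q k))"
        by (rule sum.reindex_bij_witness[of _ Suc "\<lambda>k. k - 1"]) auto
      also have "\<dots> = f (q (N - 1)) - f (q 0)" by (rule sum_lessThan_telescope)
      finally show ?thesis by (simp add: sum_subtractf)
    qed
    moreover have "real (N - 1) * (3 * (r * K) + \<epsilon> / (4 * real N)) \<le> \<epsilon> / 16 + \<epsilon> / 4"
    proof -
      have "real (N - 1) * (3 * (r * K) + \<epsilon> / (4 * real N)) \<le> real N * (3 * (r * K) + \<epsilon> / (4 * real N))"
        using r(1) K \<epsilon> by (intro mult_right_mono) auto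
      also have "\<dots> = 3 * (real N * (r * K)) + \<epsilon> / 4" using Np by (simp add: algebra_simps)
      finally show ?thesis using rK by simp
    qed
    moreover have "(\<Sum>k\<le>N. (p (Suc k) - p k) \<bullet> z k) = (p 1 - p 0) \<bullet> z 0 + (\<Sum>k\<in>{1..<N}. (p (Suc k) - p k) \<bullet> z k) + (p (Suc N) - p N) \<bullet> z N"
    proof -
      have "{..N} = insert 0 (insert N {1..<N})" using N(1) by auto
      then show ?thesis using N(1) by simp
    qed
    \<comment> \<open>The telescoping sum ends at \<open>q (N - 1)\<close>, as two edges were left
      out; the remaining step to the target is absorbed by the modulus
      \<open>\<delta>0\<close>.\<close>
    moreover have "\<bar>f (p (Suc N)) - f (q (N - 1))\<bar> < \<epsilon> / 8"
    proof (rule \<delta>0(2)[OF t_in q_in])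
      have "q N = q (N - 1) + h" using q_step[of "N - 1"] N(1) by simp
      then have "p (Suc N) - q (N - 1) = (p (Suc N) - q N) + h" by simp
      then have "norm (p (Suc N) - q (N - 1)) \<le> norm (p (Suc N) - q N) + norm h" by (metis norm_triangle_ineq)
      then show "norm (p (Suc N) - q (N - 1)) < \<delta>0" using td h r(2) by (auto simp: s_def)
    qed simp
    moreover have "\<bar>f (p 0) - f (q 0)\<bar> < \<epsilon> / 8"
      using pd[of 0] r(1,2) \<delta>0(1) by (intro \<delta>0(2) p_in q_in) auto
    moreover have "(norm h + 2 * r) * K + 2 * r * K \<le> \<epsilon> / 16 + \<epsilon> / 12" using hK rK1 by (simp add: algebra_simps)
    ultimately show "f (p (Suc N)) - f (p 0) - (\<Sum>k\<le>N. (p (Suc k) - p k) \<bullet> z k) \<le> \<epsilon>"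
      using first last \<epsilon> by linarith
  qed
qed

lemma tail_integral_tendsto_0:
  fixes G :: "'a \<Rightarrow> real"
  assumes G: "integrable N G" and nn: "\<And>x. 0 \<le> G x"
  shows "(\<lambda>k. \<integral>x. (if G x > real k then G x else 0) \<partial>N) \<longlonglongrightarrow> 0"
proof -
  have [measurable]: "G \<in> borel_measurable N" using G by auto
  have "(\<lambda>k. \<integral>x. (if G x > real k then G x else 0) \<partial>N) \<longlonglongrightarrow> (\<integral>x. 0 \<partial>N)"
  proof (rule integral_dominated_convergence[where w = G])
    show "AE x in N. (\<lambda>k. if G x > real k then G x else 0) \<longlonglongrightarrow> 0"
    proof (intro AE_I2 tendsto_eventually)
      fix x
      obtain k0 where "G x \<le> real k0" using real_arch_simple by blast
      then show "\<forall>\<^sub>F k in sequentially. (if G x > real k then G x else 0) = 0"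
        unfolding eventually_sequentially by (intro exI[of _ k0]) auto
    qed
  qed (use G nn in auto)
  then show ?thesis by simp
qed

section \<open>Chains fixed before sampling\<close>

text \<open>\<open>\<Omega>\<close> stands for the interior of the convex support. Continuity of
  \<open>f\<close> makes fine chains inside it nearly lossless, positive mass of its balls lets
  sample points follow them, and full mass puts almost every pair of an old and a new point into
  \<open>\<Omega> \<times> \<Omega>\<close>.\<close>

locale regular_potentials = dual_potentials P Q f g A B
  for P Q :: "'a::euclidean_space measure" and f g :: "'a \<Rightarrow> real" and A B :: "'a set" +
  fixes \<Omega> :: "'a set"
  assumes \<Omega>_open: "open \<Omega>" and \<Omega>_convex: "convex \<Omega>" and \<Omega>_subset: "\<Omega> \<subseteq> A" and AE_\<Omega>: "AE x in P. x \<in> \<Omega>"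
    and f_continuous: "continuous_on \<Omega> f"
    and ball_positive: "\<And>q r. r > 0 \<Longrightarrow> ball q r \<subseteq> \<Omega> \<Longrightarrow> 0 < measure P (ball q r)"
begin

text \<open>A certificate that depends on the pair \<open>w\<close> only: length, radius and
  tolerance are fixed before any sample is drawn, and the final implication covers all points
  \<open>p\<close> and vectors \<open>z\<close> that a sample may supply later. Index 0 has
  tolerance 1 instead of \<open>\<gamma>\<close>, as the starting point is prescribed and cannot be
  selected.\<close>

definition chain :: "real \<Rightarrow> 'a \<times> 'a \<Rightarrow> nat \<times> real \<times> real \<times> (nat \<Rightarrow> 'a) \<Rightarrow> bool" where
  "chain \<epsilon> w = (\<lambda>(N, r, \<gamma>, q). N \<ge> 1 \<and> r > 0 \<and> 0 < \<gamma> \<and> \<gamma> \<le> 1 \<and> (\<forall>k\<le>N. ball (q k) r \<subseteq> \<Omega>) \<and> q 0 = fst w \<and>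
    (\<forall>p z. (\<forall>k\<le>N. p k \<in> ball (q k) r) \<longrightarrow> p (Suc N) \<in> ball (snd w) r \<longrightarrow>
      (\<forall>v\<in>\<Omega>. f (p 0) + (v - p 0) \<bullet> z 0 - 1 \<le> f v) \<longrightarrow>
      (\<forall>k\<in>{1..N}. \<forall>v\<in>\<Omega>. f (p k) + (v - p k) \<bullet> z k - \<gamma> \<le> f v) \<longrightarrow>
      f (p (Suc N)) - f (p 0) - (\<Sum>k\<le>N. (p (Suc k) - p k) \<bullet> z k) \<le> \<epsilon>))"

lemma chain_exists:
  assumes "\<epsilon> > 0" "w \<in> \<Omega> \<times> \<Omega>" shows "\<exists>c. chain \<epsilon> w c"
proof -
  have w: "fst w \<in> \<Omega>" "snd w \<in> \<Omega>" using assms(2) by auto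
  obtain N r \<gamma> q where c: "N \<ge> 1" "r > 0" "0 < \<gamma>" "\<gamma> \<le> 1" "\<And>k. k \<le> N \<Longrightarrow> ball (q k) r \<subseteq> \<Omega>" "q 0 = fst w" "q N = snd w"
    "\<And>p z. (\<And>k. k \<le> N \<Longrightarrow> p k \<in> ball (q k) r) \<Longrightarrow> p (Suc N) \<in> ball (snd w) r \<Longrightarrow>
      (\<And>v. v \<in> \<Omega> \<Longrightarrow> f (p 0) + (v - p 0) \<bullet> z 0 - 1 \<le> f v) \<Longrightarrow>
      (\<And>k v. k \<in> {1..N} \<Longrightarrow> v \<in> \<Omega> \<Longrightarrow> f (p k) + (v - p k) \<bullet> z k - \<gamma> \<le> f v) \<Longrightarrow>
      f (p (Suc N)) - f (p 0) - (\<Sum>k\<le>N. (p (Suc k) - p k) \<bullet> z k) \<le> \<epsilon>"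
    by (rule chain_gain_ge[OF \<Omega>_open \<Omega>_convex f_continuous w assms(1)]) blast
  have "chain \<epsilon> w (N, r, \<gamma>, q)"
    unfolding chain_def prod.case using c(1-6) by (intro conjI allI impI c(8)) auto
  then show ?thesis by blast
qed

definition patch :: "'a \<times> 'a \<Rightarrow> nat \<times> real \<times> real \<times> (nat \<Rightarrow> 'a) \<Rightarrow> ('a \<times> 'a) set" where
  "patch w c = ball (fst w) (fst (snd c)) \<times> ball (snd w) (fst (snd c))"

text \<open>\<open>\<Omega> \<times> \<Omega>\<close> is open rather than compact, so Lindelof first
  reduces the patches to countably many, and continuity of the measure then leaves finitely many up
  to mass \<open>\<eta>\<close>. Finiteness lets the errors of all chains become small
  simultaneously.\<close>

lemma finite_cover:
  assumes c: "\<And>w. w \<in> \<Omega> \<times> \<Omega> \<Longrightarrow> chain \<epsilon> w (c w)" and \<eta>: "\<eta> > 0"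
  obtains D where "finite D" "D \<subseteq> \<Omega> \<times> \<Omega>" "emeasure (P \<Otimes>\<^sub>M P) (- (\<Union>w\<in>D. patch w (c w))) \<le> ennreal \<eta>"
proof -
  interpret PP: pair_prob_space P P ..
  have sets_PP: "sets (P \<Otimes>\<^sub>M P) = sets borel" by (metis borel_prod sets_P sets_pair_measure_cong)
  have space_PP: "space (P \<Otimes>\<^sub>M P) = UNIV" by (simp add: space_pair_measure)
  let ?F = "(\<lambda>w. patch w (c w)) ` (\<Omega> \<times> \<Omega>)"
  have op: "open (patch w (c w))" for w unfolding patch_def by (intro open_Times open_ball)
  obtain F' where F': "F' \<subseteq> ?F" "countable F'" "\<Union>F' = \<Union>?F"
    by (rule Lindelof[of ?F]) (use op in auto)
  obtain C where C: "countable C" "C \<subseteq> \<Omega> \<times> \<Omega>" "F' = (\<lambda>w. patch w (c w)) ` C"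
    using F'(1,2) countable_subset_image[of F' "\<lambda>w. patch w (c w)" "\<Omega> \<times> \<Omega>"] by auto
  have cover: "\<Omega> \<times> \<Omega> \<subseteq> (\<Union>w\<in>C. patch w (c w))"
  proof
    fix w assume w: "w \<in> \<Omega> \<times> \<Omega>"
    have "0 < fst (snd (c w))" using c[OF w] unfolding chain_def by (auto simp: split_beta)
    then have "w \<in> patch w (c w)" unfolding patch_def by (cases w) auto
    then have "w \<in> \<Union>?F" using w by blast
    then show "w \<in> (\<Union>w\<in>C. patch w (c w))" using F'(3) C(3) by auto
  qed
  have \<Omega>_sets: "\<Omega> \<in> sets P" using \<Omega>_open by simp
  have "emeasure P \<Omega> = 1" using AE_\<Omega> by (intro P.emeasure_eq_1_AE \<Omega>_sets)
  then have "emeasure (P \<Otimes>\<^sub>M P) (\<Omega> \<times> \<Omega>) = 1"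
    using \<Omega>_sets by (simp add: P.emeasure_pair_measure_Times)
  then have "AE z in P \<Otimes>\<^sub>M P. z \<in> \<Omega> \<times> \<Omega>" by (intro PP.P.AE_prob_1) (simp add: measure_def)
  then have AE_cover: "AE z in P \<Otimes>\<^sub>M P. z \<in> (\<Union>w\<in>C. patch w (c w))"
    by eventually_elim (use cover in blast)
  have Cne: "C \<noteq> {}"
    using eventually_happens'[OF PP.P.ae_filter_bot AE_cover] by auto
  define e where "e = from_nat_into C"
  have e: "range e = C" unfolding e_def using Cne C(1) by (rule range_from_nat_into)
  define U where "U k = (\<Union>s<k. patch (e s) (c (e s)))" for k :: nat
  have U_sets: "U k \<in> sets (P \<Otimes>\<^sub>M P)" for k
    unfolding sets_PP U_def using op by (intro borel_open open_UN) auto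
  have "(\<lambda>k. PP.P.prob (U k)) \<longlonglongrightarrow> PP.P.prob (\<Union>k. U k)"
  proof (intro PP.P.finite_Lim_measure_incseq)
    show "range U \<subseteq> PP.P.events" using U_sets by blast
    show "incseq U" unfolding incseq_def U_def by (intro allI impI UN_mono) auto
  qed
  moreover have "PP.P.prob (\<Union>k. U k) = 1"
  proof -
    have "(\<Union>k. U k) = (\<Union>w\<in>C. patch w (c w))" unfolding U_def e[symmetric] by auto
    then have "AE z in P \<Otimes>\<^sub>M P. z \<in> (\<Union>k. U k)" using AE_cover by (simp only:)
    moreover have "(\<Union>k. U k) \<in> PP.P.events" using U_sets by (intro sets.countable_UN) auto
    ultimately show ?thesis using PP.P.prob_eq_1 by blast
  qed
  ultimately have "(\<lambda>k. PP.P.prob (U k)) \<longlonglongrightarrow> 1" by simp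
  then have "\<forall>\<^sub>F k in sequentially. PP.P.prob (U k) > 1 - \<eta>" using \<eta> by (intro order_tendstoD(1)) auto
  then obtain k where k: "PP.P.prob (U k) > 1 - \<eta>" by (auto simp: eventually_sequentially)
  show thesis
  proof
    show "finite (e ` {..<k})" "e ` {..<k} \<subseteq> \<Omega> \<times> \<Omega>" using e C(2) by auto
    have "PP.P.prob (- U k) = 1 - PP.P.prob (U k)"
      using PP.P.prob_compl[OF U_sets[of k]] by (simp add: space_PP Compl_eq_Diff_UNIV)
    then have "PP.P.prob (- U k) \<le> \<eta>" using k by simp
    then show "emeasure (P \<Otimes>\<^sub>M P) (- (\<Union>w\<in>e ` {..<k}. patch w (c w))) \<le> ennreal \<eta>"
      by (simp add: U_def PP.P.emeasure_eq_measure ennreal_leI)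
  qed
qed

text \<open>\<open>\<rho> i\<close> is the slack of index \<open>i\<close>: averaging feasibility
  over row \<open>i\<close> makes \<open>z i\<close> a subgradient of \<open>f\<close> at
  \<open>x i\<close> up to \<open>\<rho> i\<close>, and the slacks sum to \<open>n * gap\<close>. By
  Markov at most \<open>n * \<beta> / 2\<close> indices have slack above \<open>\<gamma>\<close>,
  while each ball of the chain after the starting one contains at least \<open>n * \<beta>\<close>
  sample points. At least \<open>N + 1\<close> usable ones remain in each, which suffices for
  distinct representatives.\<close>

lemma resample_gap_chain_le:
  fixes x y b z
  assumes n: "n \<ge> 1" and m: "m \<ge> 1" and chain: "chain \<epsilon> w (N, r, \<gamma>, q)" and \<beta>: "\<beta> > 0"
    and x: "\<And>i. i < n \<Longrightarrow> x i \<in> A" and y: "\<And>j. j < m \<Longrightarrow> y j \<in> B"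
    and b: "\<And>i j. i < n \<Longrightarrow> j < m \<Longrightarrow> 0 \<le> b i j" "\<And>i. i < n \<Longrightarrow> (\<Sum>j<m. b i j) = 1"
      "\<And>h. (\<Sum>i<n. \<Sum>j<m. b i j * h j) / real n = (\<Sum>j<m. h j) / real m"
      "\<And>i. i < n \<Longrightarrow> z i = (\<Sum>j<m. b i j *\<^sub>R y j)"
    and val: "transport_value n m (\<lambda>i j. x i \<bullet> y j) = (\<Sum>i<n. x i \<bullet> z i) / real n"
      "\<And>x' \<sigma>. \<sigma> permutes {..<n} \<Longrightarrow> (\<Sum>i<n. x' (\<sigma> i) \<bullet> z i) / real n \<le> transport_value n m (\<lambda>i j. x' i \<bullet> y j)"
  defines "\<rho> \<equiv> \<lambda>i. f (x i) + (\<Sum>j<m. b i j * g (y j)) - x i \<bullet> z i"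
  assumes large: "real N + 1 \<le> real n * \<beta> / 2" and gap_small: "gap n m x y \<le> \<gamma> * \<beta> / 2"
    and freq: "\<And>k. k \<in> {1..N} \<Longrightarrow> \<beta> \<le> (\<Sum>i<n. indicator (ball (q k) r) (x i)) / real n"
    and i: "i < n" and \<rho>i: "\<rho> i \<le> 1" and w: "(x i, t) \<in> patch w (N, r, \<gamma>, q)"
  shows "real n * (gap n m (x(i := t)) y - gap n m x y) \<le> \<epsilon>"
proof -
  have c: "N \<ge> 1" "r > 0" "0 < \<gamma>" "\<gamma> \<le> 1" "\<And>k. k \<le> N \<Longrightarrow> ball (q k) r \<subseteq> \<Omega>" "q 0 = fst w"
    using chain unfolding chain_def by auto
  have gain: "f (p (Suc N)) - f (p 0) - (\<Sum>k\<le>N. (p (Suc k) - p k) \<bullet> v k) \<le> \<epsilon>"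
    if "\<forall>k\<le>N. p k \<in> ball (q k) r" "p (Suc N) \<in> ball (snd w) r" "\<forall>u\<in>\<Omega>. f (p 0) + (u - p 0) \<bullet> v 0 - 1 \<le> f u"
      "\<forall>k\<in>{1..N}. \<forall>u\<in>\<Omega>. f (p k) + (u - p k) \<bullet> v k - \<gamma> \<le> f u" for p v
    using chain that unfolding chain_def prod.case by blast
  have sub: "f (x l) + (u - x l) \<bullet> z l - \<rho> l \<le> f u" if l: "l < n" and u: "u \<in> A" for l u
  proof -
    have "u \<bullet> z l - (\<Sum>j<m. b l j * g (y j)) = (\<Sum>j<m. b l j * (u \<bullet> y j - g (y j)))"
      using b(4)[OF l] by (simp add: inner_sum_right sum_subtractf right_diff_distrib)
    also have "\<dots> \<le> (\<Sum>j<m. b l j * f u)"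
      using b(1)[OF l] feasible[OF u y] by (intro sum_mono mult_left_mono) (auto simp: algebra_simps)
    also have "\<dots> = f u" using b(2)[OF l] by (simp flip: sum_distrib_right)
    finally show ?thesis by (simp add: \<rho>_def inner_diff_left)
  qed
  have \<rho>0: "0 \<le> \<rho> l" if "l < n" for l using sub[OF that x[OF that]] by simp
  have \<rho>_sum: "(\<Sum>l<n. \<rho> l) = real n * gap n m x y"
  proof -
    have "(\<Sum>l<n. \<rho> l) / real n = gap n m x y"
      unfolding \<rho>_def gap_def val(1) b(3)[symmetric] by (simp add: sum.distrib sum_subtractf add_divide_distrib diff_divide_distrib)
    then show ?thesis using n by (simp add: divide_eq_eq mult.commute)
  qed
  let ?bad = "{l\<in>{..<n}. \<rho> l > \<gamma>}"
  have bad: "real (card ?bad) \<le> real n * \<beta> / 2"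
  proof -
    have "\<gamma> * real (card ?bad) = (\<Sum>l\<in>?bad. \<gamma>)" by simp
    also have "\<dots> \<le> (\<Sum>l\<in>?bad. \<rho> l)" by (intro sum_mono) auto
    also have "\<dots> \<le> (\<Sum>l<n. \<rho> l)" using \<rho>0 by (intro sum_mono2) auto
    also have "\<dots> \<le> real n * (\<gamma> * \<beta> / 2)" unfolding \<rho>_sum using gap_small by (intro mult_left_mono) auto
    finally have "\<gamma> * real (card ?bad) \<le> \<gamma> * (real n * \<beta> / 2)" by (simp add: mult_ac)
    then show ?thesis using c(3) by (simp only: mult_le_cancel_left_pos)
  qed
  define S where "S k = {l\<in>{..<n}. x l \<in> ball (q k) r \<and> \<rho> l \<le> \<gamma>}" for k
  have cardS: "N + 1 \<le> card (S k)" if k: "k \<in> {1..N}" for k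
  proof -
    let ?in = "{l\<in>{..<n}. x l \<in> ball (q k) r}"
    have "(\<Sum>l<n. indicator (ball (q k) r) (x l)) = (\<Sum>l\<in>?in. (1::real))"
      by (rule sum.mono_neutral_cong_right) (auto simp: indicator_def)
    then have "real n * \<beta> \<le> real (card ?in)" using freq[OF k] n by (simp add: le_divide_eq mult.commute)
    moreover have "?in \<subseteq> S k \<union> ?bad" by (auto simp: S_def)
    then have "card ?in \<le> card (S k) + card ?bad"
      by (intro order_trans[OF card_mono card_Un_le]) (auto simp: S_def)
    ultimately have "real N + 1 \<le> real (card (S k))" using bad large by linarith
    then show ?thesis by linarith
  qed
  obtain h where h: "h 0 = i" "inj_on h {..N}" "\<And>k. k \<in> {1..N} \<Longrightarrow> h k \<in> S k"
    using distinct_representatives[of N S i] cardS by (auto simp: S_def)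
  have hlt: "h k < n" if "k \<le> N" for k using h(1,3) that i by (cases "k = 0") (auto simp: S_def)
  \<comment> \<open>Positions 0 to \<open>N\<close> are sample points and position
    \<open>N + 1\<close> is the new point; since \<open>h 0 = i\<close>, the chain starts at the
    index that is resampled.\<close>
  define p where "p k = (if k \<le> N then x (h k) else t)" for k
  let ?G = "(\<Sum>k<N. (x (h (Suc k)) - x (h k)) \<bullet> z (h k)) + (t - x (h N)) \<bullet> z (h N)"
  have a: "f (p (Suc N)) - f (p 0) - (\<Sum>k\<le>N. (p (Suc k) - p k) \<bullet> z (h k)) \<le> \<epsilon>"
  proof (rule gain; (intro allI impI ballI)?)
    show "p k \<in> ball (q k) r" if "k \<le> N" for k
    proof (cases "k = 0")
      case True
      then show ?thesis using w h(1) c(6) by (simp add: p_def patch_def)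
    next
      case False
      then show ?thesis using h(3)[of k] that by (simp add: p_def S_def)
    qed
    show "p (Suc N) \<in> ball (snd w) r" using w by (simp add: p_def patch_def)
    show "f (p 0) + (u - p 0) \<bullet> z (h 0) - 1 \<le> f u" if "u \<in> \<Omega>" for u
      using sub[OF i, of u] that \<Omega>_subset \<rho>i by (auto simp: p_def h(1))
    show "f (p k) + (u - p k) \<bullet> z (h k) - \<gamma> \<le> f u" if "k \<in> {1..N}" "u \<in> \<Omega>" for k u
    proof -
      have "\<rho> (h k) \<le> \<gamma>" using h(3)[OF that(1)] by (simp add: S_def)
      then show ?thesis using sub[OF hlt, of k u] that \<Omega>_subset by (auto simp: p_def)
    qed
  qed
  have e: "(\<Sum>k\<le>N. (p (Suc k) - p k) \<bullet> z (h k)) = ?G"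
    by (simp add: p_def lessThan_Suc_atMost[symmetric])
  have le: "transport_value n m (\<lambda>i j. x i \<bullet> y j) + ?G / real n \<le> transport_value n m (\<lambda>k j. (x(i := t)) k \<bullet> y j)"
    using transport_value_shift_ge[OF n val h(2) hlt, of t] unfolding h(1) by simp
  have d: "gap n m (x(i := t)) y - gap n m x y = (f t - f (x i)) / real n
      - (transport_value n m (\<lambda>k j. (x(i := t)) k \<bullet> y j) - transport_value n m (\<lambda>i j. x i \<bullet> y j))"
    using i unfolding gap_def by (simp add: sum.remove[of _ i] diff_divide_distrib add_divide_distrib)
  have pp: "p (Suc N) = t" "p 0 = x i" using h(1) by (simp_all add: p_def)
  have "(f t - f (x i) - ?G) / real n \<le> \<epsilon> / real n"
    using a unfolding e pp by (intro divide_right_mono) auto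
  then have "gap n m (x(i := t)) y - gap n m x y \<le> \<epsilon> / real n"
    using le unfolding d by (simp add: diff_divide_distrib)
  then show ?thesis using n by (simp add: le_divide_eq mult.commute)
qed

end

section \<open>Splitting the resampling energy of the gap\<close>

definition tail_part :: "real \<Rightarrow> real \<Rightarrow> real" where "tail_part K s = (if s > K then s else 0)"

lemma tail_part_measurable [measurable]: "tail_part K \<in> borel_measurable borel"
  unfolding tail_part_def by measurable

lemma tail_part_nonneg: "s \<ge> 0 \<Longrightarrow> tail_part K s \<ge> 0" and le_tail_part: "K \<ge> 0 \<Longrightarrow> s \<le> K + tail_part K s"
  by (auto simp: tail_part_def)

lemma integrable_tail_part:
  fixes h :: "'a \<Rightarrow> real"
  assumes "integrable N h" "\<And>x. h x \<ge> 0"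
  shows "integrable N (\<lambda>x. tail_part K (h x))"
proof (rule Bochner_Integration.integrable_bound[OF assms(1)])
  show "AE x in N. norm (tail_part K (h x)) \<le> norm (h x)" using assms(2) by (intro AE_I2) (simp add: tail_part_def)
qed (use assms(1) in measurable)

context regular_potentials
begin

text \<open>Half of the smallest mass, so that frequencies deviating by less than this amount still
  stay above it.\<close>

definition chain_mass :: "nat \<times> real \<times> real \<times> (nat \<Rightarrow> 'a) \<Rightarrow> real" where
  "chain_mass = (\<lambda>(N, r, \<gamma>, q). Min ((\<lambda>k. measure P (ball (q k) r)) ` {1..N}) / 2)"

text \<open>Normalized so that, for a nonnegative gap, a value below 1 implies both the frequency
  bounds and the gap bound that the chain needs. It thus dominates the indicator of failure and is
  linear in quantities whose means tend to 0.\<close>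

definition chain_error :: "nat \<Rightarrow> nat \<Rightarrow> nat \<times> real \<times> real \<times> (nat \<Rightarrow> 'a) \<Rightarrow> (nat \<Rightarrow> 'a) \<Rightarrow> (nat \<Rightarrow> 'a) \<Rightarrow> real" where
  "chain_error n m c x y = (case c of (N, r, \<gamma>, q) \<Rightarrow>
     (\<Sum>k\<in>{1..N}. \<bar>(\<Sum>i<n. indicator (ball (q k) r) (x i)) / real n - measure P (ball (q k) r)\<bar>) / chain_mass c
       + 2 / (\<gamma> * chain_mass c) * gap n m x y)"

lemma chain_mass:
  assumes "chain \<epsilon> w (N, r, \<gamma>, q)"
  shows "0 < chain_mass (N, r, \<gamma>, q)" "k \<in> {1..N} \<Longrightarrow> 2 * chain_mass (N, r, \<gamma>, q) \<le> measure P (ball (q k) r)"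
proof -
  have c: "N \<ge> 1" "r > 0" "\<And>k. k \<le> N \<Longrightarrow> ball (q k) r \<subseteq> \<Omega>" using assms unfolding chain_def by auto
  have "0 < Min ((\<lambda>k. measure P (ball (q k) r)) ` {1..N})"
  proof (subst Min_gr_iff)
    have "0 < measure P (ball (q k) r)" if "k \<in> {1..N}" for k
      using that by (intro ball_positive c) simp
    then show "\<forall>a\<in>(\<lambda>k. measure P (ball (q k) r)) ` {1..N}. 0 < a" by blast
  qed (use c in auto)
  then show "0 < chain_mass (N, r, \<gamma>, q)" by (simp add: chain_mass_def)
  show "2 * chain_mass (N, r, \<gamma>, q) \<le> measure P (ball (q k) r)" if "k \<in> {1..N}"
    using that by (simp add: chain_mass_def)
qed

lemma chain_error_nonneg:
  assumes "chain \<epsilon> w c" "0 \<le> gap n m x y"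
  shows "0 \<le> chain_error n m c x y"
proof -
  obtain N r \<gamma> q where c: "c = (N, r, \<gamma>, q)" by (cases c) auto
  have "\<gamma> > 0" using assms(1) unfolding c chain_def by auto
  then show ?thesis
    using chain_mass(1)[OF assms(1)[unfolded c]] assms(2) unfolding c chain_error_def prod.case
    by (intro add_nonneg_nonneg mult_nonneg_nonneg divide_nonneg_nonneg sum_nonneg) auto
qed

lemma chain_error_less_1:
  assumes ch: "chain \<epsilon> w (N, r, \<gamma>, q)" and gap: "0 \<le> gap n m x y" and less: "chain_error n m (N, r, \<gamma>, q) x y < 1"
  shows "gap n m x y \<le> \<gamma> * chain_mass (N, r, \<gamma>, q) / 2"
    and "k \<in> {1..N} \<Longrightarrow> chain_mass (N, r, \<gamma>, q) \<le> (\<Sum>i<n. indicator (ball (q k) r) (x i)) / real n"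
proof -
  let ?\<beta> = "chain_mass (N, r, \<gamma>, q)"
  let ?d = "\<lambda>k. \<bar>(\<Sum>i<n. indicator (ball (q k) r) (x i)) / real n - measure P (ball (q k) r)\<bar>"
  have \<beta>: "?\<beta> > 0" by (rule chain_mass(1)[OF ch])
  have \<gamma>: "\<gamma> > 0" using ch unfolding chain_def by auto
  have e: "(\<Sum>k\<in>{1..N}. ?d k) / ?\<beta> + 2 / (\<gamma> * ?\<beta>) * gap n m x y < 1"
    using less unfolding chain_error_def prod.case .
  have s0: "0 \<le> (\<Sum>k\<in>{1..N}. ?d k) / ?\<beta>" using \<beta> by (intro divide_nonneg_nonneg sum_nonneg) auto
  have g0: "0 \<le> 2 / (\<gamma> * ?\<beta>) * gap n m x y" using \<beta> \<gamma> gap by simp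
  have "2 / (\<gamma> * ?\<beta>) * gap n m x y < 1" using e s0 by linarith
  then show "gap n m x y \<le> \<gamma> * ?\<beta> / 2" using \<beta> \<gamma> by (simp add: field_simps)
  show "?\<beta> \<le> (\<Sum>i<n. indicator (ball (q k) r) (x i)) / real n" if k: "k \<in> {1..N}"
  proof -
    have "?d k \<le> (\<Sum>k\<in>{1..N}. ?d k)" using k by (intro member_le_sum) auto
    moreover have "(\<Sum>k\<in>{1..N}. ?d k) / ?\<beta> < 1" using e g0 by linarith
    then have "(\<Sum>k\<in>{1..N}. ?d k) < ?\<beta>" using \<beta> by (simp add: divide_less_eq)
    ultimately show ?thesis using chain_mass(2)[OF ch k] by linarith
  qed
qed

text \<open>Squaring \<open>\<bar>f t\<bar> + \<bar>f (x i)\<bar> + norm (t - x i) * norm (z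
  i)\<close> gives the factor 3; in the product, AM-GM contributes 1/2 and
  \<open>norm_diff_power4_le\<close> contributes 8, whence 12.\<close>

definition moment_bound :: "'a \<Rightarrow> real" where
  "moment_bound x = 3 * (f x)\<^sup>2 + 12 * norm x ^ 4"

lemma moment_bound_nonneg: "0 \<le> moment_bound x" by (simp add: moment_bound_def)

lemma moment_bound_measurable [measurable]: "moment_bound \<in> borel_measurable borel"
  unfolding moment_bound_def by measurable

lemma moment_bound_integrable: "integrable P moment_bound"
  unfolding moment_bound_def using f_square_integrable P4 by auto

text \<open>For a covered pair with small slack and small chain errors the positive increment is at
  most \<open>\<epsilon> / n\<close>. Otherwise the crude bound applies, cut at level
  \<open>K\<close>: the two moment bounds, and with weight \<open>3 / 2\<close> the fourth power of
  the barycentre, contribute at most \<open>K\<close> each plus a tail, in total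
  \<open>7 / 2 * K\<close>. Summation over \<open>i\<close> removes all quantities that depend on
  the plan.\<close>

lemma resample_gap_pointwise:
  assumes n: "n \<ge> 1" and m: "m \<ge> 1" and \<epsilon>: "\<epsilon> > 0" and K: "K \<ge> 0"
    and D: "finite D" and c: "\<And>w. w \<in> D \<Longrightarrow> chain \<epsilon> w (c w)"
    and large: "\<And>w. w \<in> D \<Longrightarrow> real (fst (c w)) + 1 \<le> real n * chain_mass (c w) / 2"
    and x: "\<And>i. i < n \<Longrightarrow> x i \<in> A" and y: "\<And>j. j < m \<Longrightarrow> y j \<in> B"
  defines "U \<equiv> (\<Union>w\<in>D. patch w (c w))"
  shows "(\<Sum>i<n. \<integral>\<^sup>+t. ennreal ((max 0 (gap n m (x(i := t)) y - gap n m x y))\<^sup>2) \<partial>P)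
    \<le> ennreal (1 / (real n)\<^sup>2) * (ennreal (real n * (\<epsilon>\<^sup>2 + 7 / 2 * K * ((\<Sum>w\<in>D. chain_error n m (c w) x y) + gap n m x y)
            + (\<Sum>i<n. tail_part K (moment_bound (x i))) / real n + 3 / 2 * ((\<Sum>j<m. tail_part K (norm (y j) ^ 4)) / real m)))
        + of_nat n * (\<integral>\<^sup>+t. ennreal (tail_part K (moment_bound t)) \<partial>P)
        + ennreal (7 / 2 * K) * (\<Sum>i<n. \<integral>\<^sup>+t. indicator (- U) (x i, t) \<partial>P))"
proof (rule transport_barycentres[OF n m, of y x])
  fix b z
  assume b: "\<And>i j. i < n \<Longrightarrow> j < m \<Longrightarrow> 0 \<le> b i j" "\<And>i. i < n \<Longrightarrow> (\<Sum>j<m. b i j) = 1"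
      "\<And>h. (\<Sum>i<n. \<Sum>j<m. b i j * h j) / real n = (\<Sum>j<m. h j) / real m"
      "\<And>i. i < n \<Longrightarrow> z i = (\<Sum>j<m. b i j *\<^sub>R y j)"
    and val: "transport_value n m (\<lambda>i j. x i \<bullet> y j) = (\<Sum>i<n. x i \<bullet> z i) / real n"
      "\<And>x' \<sigma>. \<sigma> permutes {..<n} \<Longrightarrow> (\<Sum>i<n. x' (\<sigma> i) \<bullet> z i) / real n \<le> transport_value n m (\<lambda>i j. x' i \<bullet> y j)"
  define \<rho> where "\<rho> i = f (x i) + (\<Sum>j<m. b i j * g (y j)) - x i \<bullet> z i" for i
  \<comment> \<open>The tail is taken at the points \<open>y j\<close> and then averaged over the
    row. In this form the sum over the rows is an average over the second sample, whereas a tail of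
    \<open>norm (z i) ^ 4\<close> would still depend on the plan.\<close>
  define \<tau> where "\<tau> i = (\<Sum>j<m. b i j * tail_part K (norm (y j) ^ 4))" for i
  define E where "E = (\<Sum>w\<in>D. chain_error n m (c w) x y)"
  let ?gap = "gap n m x y"
  have gap0: "0 \<le> ?gap" by (rule gap_nonneg[OF n m x y])
  have ce0: "0 \<le> chain_error n m (c w) x y" if "w \<in> D" for w using chain_error_nonneg[OF c[OF that] gap0] .
  have E0: "0 \<le> E" unfolding E_def using ce0 by (intro sum_nonneg)
  have \<rho>0: "0 \<le> \<rho> i" if i: "i < n" for i
  proof -
    have "x i \<bullet> z i - (\<Sum>j<m. b i j * g (y j)) = (\<Sum>j<m. b i j * (x i \<bullet> y j - g (y j)))"
      using b(4)[OF i] by (simp add: inner_sum_right sum_subtractf right_diff_distrib)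
    also have "\<dots> \<le> (\<Sum>j<m. b i j * f (x i))"
      using b(1)[OF i] feasible[OF x[OF i] y] by (intro sum_mono mult_left_mono) (auto simp: algebra_simps)
    also have "\<dots> = f (x i)" using b(2)[OF i] by (simp flip: sum_distrib_right)
    finally show ?thesis by (simp add: \<rho>_def)
  qed
  have \<rho>_sum: "(\<Sum>i<n. \<rho> i) = real n * ?gap"
  proof -
    have "(\<Sum>i<n. \<rho> i) / real n = ?gap"
      unfolding \<rho>_def gap_def val(1) b(3)[symmetric] by (simp add: sum.distrib sum_subtractf add_divide_distrib diff_divide_distrib)
    then show ?thesis using n by (simp add: divide_eq_eq mult.commute)
  qed
  have \<tau>0: "0 \<le> \<tau> i" if "i < n" for i
    unfolding \<tau>_def using b(1)[OF that] by (intro sum_nonneg mult_nonneg_nonneg tail_part_nonneg) auto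
  have \<tau>_sum: "(\<Sum>i<n. \<tau> i) = real n * ((\<Sum>j<m. tail_part K (norm (y j) ^ 4)) / real m)"
    using b(3)[of "\<lambda>j. tail_part K (norm (y j) ^ 4)"] n unfolding \<tau>_def by (simp add: divide_eq_eq mult.commute)
  have z4: "norm (z i) ^ 4 \<le> K + \<tau> i" if i: "i < n" for i
  proof -
    have "norm (z i) ^ 4 \<le> (\<Sum>j<m. b i j * norm (y j) ^ 4)"
      unfolding b(4)[OF i] using b(1,2)[OF i] by (rule norm_convex_combination_power4_le)
    also have "\<dots> \<le> (\<Sum>j<m. b i j * (K + tail_part K (norm (y j) ^ 4)))"
      using b(1)[OF i] le_tail_part[OF K] by (intro sum_mono mult_left_mono) auto
    also have "\<dots> = K * (\<Sum>j<m. b i j) + \<tau> i"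
      by (simp add: \<tau>_def distrib_left sum.distrib sum_distrib_left mult.commute)
    finally show ?thesis using b(2)[OF i] by simp
  qed
  let ?T = "\<lambda>i t. max 0 (gap n m (x(i := t)) y - ?gap)"
  let ?C = "\<lambda>i. \<epsilon>\<^sup>2 + 7 / 2 * K * (E + \<rho> i) + tail_part K (moment_bound (x i)) + 3 / 2 * \<tau> i"
  have C0: "0 \<le> ?C i" if "i < n" for i
    using K E0 \<rho>0[OF that] \<tau>0[OF that] tail_part_nonneg[OF moment_bound_nonneg, of K "x i"] by simp
  have crude: "(real n * ?T i t)\<^sup>2 \<le> moment_bound t + moment_bound (x i) + 3 / 2 * norm (z i) ^ 4" if i: "i < n" for i t
  proof -
    have "gap n m (x(i := t)) y - ?gap = (f t - f (x i)) / real n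
        - (transport_value n m (\<lambda>k j. (x(i := t)) k \<bullet> y j) - transport_value n m (\<lambda>i j. x i \<bullet> y j))"
      using i unfolding gap_def by (simp add: sum.remove[of _ i] diff_divide_distrib add_divide_distrib)
    also have "\<dots> \<le> (f t - f (x i)) / real n - ((t - x i) \<bullet> z i) / real n"
      using transport_value_update_ge[OF i val, of t] by linarith
    also have "\<dots> \<le> (\<bar>f t\<bar> + \<bar>f (x i)\<bar> + norm (t - x i) * norm (z i)) / real n"
      unfolding diff_divide_distrib[symmetric] using Cauchy_Schwarz_ineq2[of "t - x i" "z i"] by (intro divide_right_mono) linarith+
    finally have d: "gap n m (x(i := t)) y - ?gap \<le> (\<bar>f t\<bar> + \<bar>f (x i)\<bar> + norm (t - x i) * norm (z i)) / real n" .
    have "real n * ?T i t \<le> \<bar>f t\<bar> + \<bar>f (x i)\<bar> + norm (t - x i) * norm (z i)"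
    proof -
      have "?T i t \<le> (\<bar>f t\<bar> + \<bar>f (x i)\<bar> + norm (t - x i) * norm (z i)) / real n"
        using d by (intro max.boundedI) (auto intro!: divide_nonneg_nonneg)
      then show ?thesis using n by (simp add: le_divide_eq mult.commute)
    qed
    then have "(real n * ?T i t)\<^sup>2 \<le> (\<bar>f t\<bar> + \<bar>f (x i)\<bar> + norm (t - x i) * norm (z i))\<^sup>2"
      by (intro power_mono) auto
    also have "\<dots> \<le> 3 * ((f t)\<^sup>2 + (f (x i))\<^sup>2 + (norm (t - x i) * norm (z i))\<^sup>2)"
    proof -
      have "(p + q + r)\<^sup>2 \<le> 3 * (p\<^sup>2 + q\<^sup>2 + r\<^sup>2)" for p q r :: real
        using sum_squares_bound[of p q] sum_squares_bound[of p r] sum_squares_bound[of q r]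
        by (simp add: power2_eq_square algebra_simps)
      from this[of "\<bar>f t\<bar>" "\<bar>f (x i)\<bar>" "norm (t - x i) * norm (z i)"] show ?thesis by simp
    qed
    also have "2 * (norm (t - x i) * norm (z i))\<^sup>2 \<le> norm (t - x i) ^ 4 + norm (z i) ^ 4"
      using sum_squares_bound[of "(norm (t - x i))\<^sup>2" "(norm (z i))\<^sup>2"] by (simp add: power_mult_distrib)
    then have "3 * ((f t)\<^sup>2 + (f (x i))\<^sup>2 + (norm (t - x i) * norm (z i))\<^sup>2)
        \<le> moment_bound t + moment_bound (x i) + 3 / 2 * norm (z i) ^ 4"
    proof -
      have "3 * (u + v + s) \<le> (3 * u + 12 * p) + (3 * v + 12 * q) + 3 / 2 * w"
        if "2 * s \<le> r + w" "r \<le> 8 * (p + q)" for u v s p q r w :: real using that by simp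
      then show ?thesis
        using \<open>2 * (norm (t - x i) * norm (z i))\<^sup>2 \<le> _\<close> norm_diff_power4_le[of t "x i"] unfolding moment_bound_def by blast
    qed
    finally show ?thesis .
  qed
  have pt: "(real n * ?T i t)\<^sup>2 \<le> ?C i + tail_part K (moment_bound t) + 7 / 2 * K * indicator (- U) (x i, t)" if i: "i < n" for i t
  proof (cases "(x i, t) \<in> U \<and> \<rho> i \<le> 1 \<and> E < 1")
    case True
    then obtain w where w: "w \<in> D" "(x i, t) \<in> patch w (c w)" by (auto simp: U_def)
    obtain N r \<gamma> q where cw: "c w = (N, r, \<gamma>, q)" by (cases "c w") auto
    note ch = c[OF w(1), unfolded cw]
    have "chain_error n m (c w) x y \<le> E" unfolding E_def using w(1) D ce0 by (intro member_le_sum) auto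
    then have less: "chain_error n m (N, r, \<gamma>, q) x y < 1" using True by (simp add: cw)
    have "real n * (gap n m (x(i := t)) y - ?gap) \<le> \<epsilon>"
    proof (rule resample_gap_chain_le[OF n m ch chain_mass(1)[OF ch] x y b val _ _ _ i])
      show "real N + 1 \<le> real n * chain_mass (N, r, \<gamma>, q) / 2" using large[OF w(1)] by (simp add: cw)
      show "f (x i) + (\<Sum>j<m. b i j * g (y j)) - x i \<bullet> z i \<le> 1" using True by (simp add: \<rho>_def)
      show "(x i, t) \<in> patch w (N, r, \<gamma>, q)" using w(2) by (simp add: cw)
    qed (use chain_error_less_1[OF ch gap0 less] in auto)
    then have "real n * ?T i t \<le> \<epsilon>" using \<epsilon> by (auto simp: max_def)
    then have "(real n * ?T i t)\<^sup>2 \<le> \<epsilon>\<^sup>2" by (intro power_mono) auto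
    moreover have "0 \<le> 7 / 2 * K * (E + \<rho> i)" "0 \<le> tail_part K (moment_bound (x i))" "0 \<le> 3 / 2 * \<tau> i"
      "0 \<le> tail_part K (moment_bound t)" "0 \<le> 7 / 2 * K * indicator (- U) (x i, t)"
      using K E0 \<rho>0[OF i] \<tau>0[OF i] tail_part_nonneg[OF moment_bound_nonneg] by auto
    ultimately show ?thesis by linarith
  next
    case False
    \<comment> \<open>Each way of being exceptional is detected by one summand:
      \<open>E \<ge> 1\<close>, \<open>\<rho> i > 1\<close>, or a pair outside \<open>U\<close>. The
      sum replaces an indicator by terms whose sums and means are known.\<close>
    then have "1 \<le> E + \<rho> i + indicator (- U) (x i, t)"
      using E0 \<rho>0[OF i] by (cases "(x i, t) \<in> U") (auto simp: indicator_def)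
    then have "7 / 2 * K * 1 \<le> 7 / 2 * K * (E + \<rho> i + indicator (- U) (x i, t))" using K by (intro mult_left_mono) auto
    then have bad: "7 / 2 * K \<le> 7 / 2 * K * (E + \<rho> i) + 7 / 2 * K * indicator (- U) (x i, t)" by (simp add: distrib_left)
    show ?thesis
      using crude[OF i, of t] z4[OF i] le_tail_part[OF K, of "moment_bound t"] le_tail_part[OF K, of "moment_bound (x i)"] bad zero_le_power2[of \<epsilon>]
      by linarith
  qed
  have U_open: "open U" unfolding U_def patch_def by (intro open_UN ballI open_Times open_ball)
  have [measurable]: "(\<lambda>t. indicator (- U) (s, t) :: ennreal) \<in> borel_measurable borel" for s
  proof -
    have "- U \<in> sets borel" using U_open by (intro borel_closed) auto
    moreover have "Pair s \<in> borel_measurable borel" by (intro borel_measurable_continuous_onI continuous_intros)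
    ultimately show ?thesis by measurable
  qed
  have "(\<Sum>i<n. \<integral>\<^sup>+t. ennreal ((?T i t)\<^sup>2) \<partial>P)
      \<le> (\<Sum>i<n. \<integral>\<^sup>+t. ennreal (1 / (real n)\<^sup>2) * (ennreal (?C i) + (ennreal (tail_part K (moment_bound t)) + ennreal (7 / 2 * K) * indicator (- U) (x i, t))) \<partial>P)"
  proof (intro sum_mono nn_integral_mono)
    fix i t assume "i \<in> {..<n}"
    then have i: "i < n" by simp
    have "(?T i t)\<^sup>2 = 1 / (real n)\<^sup>2 * (real n * ?T i t)\<^sup>2" using n by (simp add: power_mult_distrib)
    also have "\<dots> \<le> 1 / (real n)\<^sup>2 * (?C i + (tail_part K (moment_bound t) + 7 / 2 * K * indicator (- U) (x i, t)))"
      using pt[OF i, of t] by (intro mult_left_mono) (auto simp: add.assoc)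
    finally have "ennreal ((?T i t)\<^sup>2) \<le> ennreal (1 / (real n)\<^sup>2 * (?C i + (tail_part K (moment_bound t) + 7 / 2 * K * indicator (- U) (x i, t))))"
      by (rule ennreal_leI)
    also have "\<dots> = ennreal (1 / (real n)\<^sup>2) * (ennreal (?C i) + (ennreal (tail_part K (moment_bound t)) + ennreal (7 / 2 * K) * indicator (- U) (x i, t)))"
    proof -
      have "ennreal (a * (p + (q + k * indicator V v))) = ennreal a * (ennreal p + (ennreal q + ennreal k * indicator V v))"
        if "0 \<le> a" "0 \<le> p" "0 \<le> q" "0 \<le> k" for a p q k :: real and V and v :: "'a \<times> 'a"
        using that by (cases "v \<in> V") (simp_all add: ennreal_mult' ennreal_plus)
      note split = this
      show ?thesis by (rule split) (use C0[OF i] tail_part_nonneg[OF moment_bound_nonneg] K in simp_all)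
    qed
    finally show "ennreal ((?T i t)\<^sup>2) \<le> \<dots>" .
  qed
  also have "\<dots> = (\<Sum>i<n. ennreal (1 / (real n)\<^sup>2) * (ennreal (?C i) + ((\<integral>\<^sup>+t. ennreal (tail_part K (moment_bound t)) \<partial>P)
      + ennreal (7 / 2 * K) * (\<integral>\<^sup>+t. indicator (- U) (x i, t) \<partial>P))))"
  proof -
    have "(\<integral>\<^sup>+t. a * (C + (h t + k * d t)) \<partial>P) = a * (C + ((\<integral>\<^sup>+t. h t \<partial>P) + k * (\<integral>\<^sup>+t. d t \<partial>P)))"
      if [measurable]: "h \<in> borel_measurable borel" "d \<in> borel_measurable borel" for h d and a C k :: ennreal
      using P.emeasure_space_1 by (simp add: nn_integral_cmult nn_integral_add)
    then show ?thesis by (intro sum.cong refl) simp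
  qed
  also have "\<dots> = ennreal (1 / (real n)\<^sup>2) * (ennreal (\<Sum>i<n. ?C i) + of_nat n * (\<integral>\<^sup>+t. ennreal (tail_part K (moment_bound t)) \<partial>P)
      + ennreal (7 / 2 * K) * (\<Sum>i<n. \<integral>\<^sup>+t. indicator (- U) (x i, t) \<partial>P))"
  proof -
    have "(\<Sum>i<n. a * (p i + (I + k * d i))) = a * ((\<Sum>i<n. p i) + of_nat n * I + k * (\<Sum>i<n. d i))"
      for a I k :: ennreal and p d
      by (simp add: sum_distrib_left[symmetric] sum.distrib add.assoc)
    moreover have "(\<Sum>i<n. ennreal (?C i)) = ennreal (\<Sum>i<n. ?C i)" by (intro sum_ennreal C0) auto
    ultimately show ?thesis by simp
  qed
  also have "(\<Sum>i<n. ?C i) = real n * (\<epsilon>\<^sup>2 + 7 / 2 * K * (E + ?gap)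
      + (\<Sum>i<n. tail_part K (moment_bound (x i))) / real n + 3 / 2 * ((\<Sum>j<m. tail_part K (norm (y j) ^ 4)) / real m))"
  proof -
    have "(\<Sum>i<n. ?C i) = real n * \<epsilon>\<^sup>2 + 7 / 2 * K * (real n * E + (\<Sum>i<n. \<rho> i)) + (\<Sum>i<n. tail_part K (moment_bound (x i))) + 3 / 2 * (\<Sum>i<n. \<tau> i)"
      by (simp only: sum.distrib sum_distrib_left[symmetric]) (simp add: sum.distrib)
    then show ?thesis unfolding \<rho>_sum \<tau>_sum using n by (simp add: distrib_left mult_ac)
  qed
  finally show ?thesis unfolding E_def .
qed

lemma chain_error_expectation:
  assumes n: "n \<ge> 1" and m: "m \<ge> 1" and ch: "chain \<epsilon> w (N, r, \<gamma>, q)"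
  shows "integrable (samples n m) (\<lambda>z. chain_error n m (N, r, \<gamma>, q) (fst z) (snd z))"
    and "(\<integral>z. chain_error n m (N, r, \<gamma>, q) (fst z) (snd z) \<partial>samples n m)
      \<le> real N / chain_mass (N, r, \<gamma>, q) * (1 / sqrt (real n)) + 2 / (\<gamma> * chain_mass (N, r, \<gamma>, q)) * (\<integral>z. gap n m (fst z) (snd z) \<partial>samples n m)"
proof -
  let ?\<beta> = "chain_mass (N, r, \<gamma>, q)"
  let ?d = "\<lambda>k z. \<bar>(\<Sum>i<n. indicator (ball (q k) r) (fst z i)) / real n - measure P (ball (q k) r)\<bar>"
  have \<beta>: "?\<beta> > 0" by (rule chain_mass(1)[OF ch])
  have int: "integrable (samples n m) (\<lambda>z. ?d k z)" for k by (rule frequency_diff_integrable[OF n]) simp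
  have ints: "integrable (samples n m) (\<lambda>z. \<Sum>k\<in>{1..N}. ?d k z)" by (intro Bochner_Integration.integrable_sum int)
  note gi = gap_integrable[OF n m]
  have eq: "chain_error n m (N, r, \<gamma>, q) (fst z) (snd z) = (\<Sum>k\<in>{1..N}. ?d k z) / ?\<beta> + 2 / (\<gamma> * ?\<beta>) * gap n m (fst z) (snd z)" for z
    unfolding chain_error_def prod.case ..
  show "integrable (samples n m) (\<lambda>z. chain_error n m (N, r, \<gamma>, q) (fst z) (snd z))"
    unfolding eq using ints gi by simp
  have "(\<integral>z. (\<Sum>k\<in>{1..N}. ?d k z) \<partial>samples n m) = (\<Sum>k\<in>{1..N}. \<integral>z. ?d k z \<partial>samples n m)"
    by (intro Bochner_Integration.integral_sum int)
  also have "\<dots> \<le> (\<Sum>k\<in>{1..N}. 1 / sqrt (real n))" by (intro sum_mono frequency_fst(1)[OF n]) simp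
  finally have "(\<integral>z. (\<Sum>k\<in>{1..N}. ?d k z) \<partial>samples n m) / ?\<beta> \<le> real N * (1 / sqrt (real n)) / ?\<beta>"
    using \<beta> by (intro divide_right_mono) auto
  moreover have "(\<integral>z. p z / ?\<beta> + k * u z \<partial>samples n m) = (\<integral>z. p z \<partial>samples n m) / ?\<beta> + k * (\<integral>z. u z \<partial>samples n m)"
    if "integrable (samples n m) p" "integrable (samples n m) u" for p u and k :: real
    using that by simp
  note split = this[OF ints gi]
  ultimately show "(\<integral>z. chain_error n m (N, r, \<gamma>, q) (fst z) (snd z) \<partial>samples n m)
      \<le> real N / ?\<beta> * (1 / sqrt (real n)) + 2 / (\<gamma> * ?\<beta>) * (\<integral>z. gap n m (fst z) (snd z) \<partial>samples n m)"
    unfolding eq split by (simp only: times_divide_eq_left add_le_cancel_right)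
qed

text \<open>The tail of \<open>moment_bound\<close> is counted twice, once for the old point and
  once for the new one. The pair of both has law \<open>P \<Otimes>\<^sub>M P\<close>, so uncovered
  pairs contribute at most \<open>\<eta>\<close> times the coefficient
  \<open>7 / 2 * K\<close>.\<close>

lemma resample_energy_gap_le:
  assumes n: "n \<ge> 1" and m: "m \<ge> 1" and \<epsilon>: "\<epsilon> > 0" and K: "K \<ge> 0" and \<eta>: "\<eta> \<ge> 0"
    and D: "finite D" and c: "\<And>w. w \<in> D \<Longrightarrow> chain \<epsilon> w (c w)"
    and large: "\<And>w. w \<in> D \<Longrightarrow> real (fst (c w)) + 1 \<le> real n * chain_mass (c w) / 2"
    and cover: "emeasure (P \<Otimes>\<^sub>M P) (- (\<Union>w\<in>D. patch w (c w))) \<le> ennreal \<eta>"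
  shows "resample_energy n m (gap n m) \<le> ennreal ((\<epsilon>\<^sup>2
      + 7 / 2 * K * ((\<Sum>w\<in>D. \<integral>z. chain_error n m (c w) (fst z) (snd z) \<partial>samples n m) + (\<integral>z. gap n m (fst z) (snd z) \<partial>samples n m))
      + 2 * (\<integral>x. tail_part K (moment_bound x) \<partial>P) + 3 / 2 * (\<integral>y. tail_part K (norm y ^ 4) \<partial>Q) + 7 / 2 * K * \<eta>) / real n)"
proof -
  interpret S: prob_space "samples n m" by (rule prob_space_samples)
  define U where "U = (\<Union>w\<in>D. patch w (c w))"
  note cover = cover[folded U_def]
  let ?IG = "\<integral>x. tail_part K (moment_bound x) \<partial>P" and ?IY = "\<integral>y. tail_part K (norm y ^ 4) \<partial>Q"
  let ?Ec = "\<Sum>w\<in>D. \<integral>z. chain_error n m (c w) (fst z) (snd z) \<partial>samples n m"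
    and ?Eg = "\<integral>z. gap n m (fst z) (snd z) \<partial>samples n m"
  define H where "H z = \<epsilon>\<^sup>2 + 7 / 2 * K * ((\<Sum>w\<in>D. chain_error n m (c w) (fst z) (snd z)) + gap n m (fst z) (snd z))
      + (\<Sum>i<n. tail_part K (moment_bound (fst z i))) / real n + 3 / 2 * ((\<Sum>j<m. tail_part K (norm (snd z j) ^ 4)) / real m)" for z
  have ce_int: "integrable (samples n m) (\<lambda>z. chain_error n m (c w) (fst z) (snd z))" if "w \<in> D" for w
  proof -
    obtain N r \<gamma> q where cw: "c w = (N, r, \<gamma>, q)" by (cases "c w") auto
    show ?thesis unfolding cw by (rule chain_error_expectation(1)[OF n m c[OF that, unfolded cw]])
  qed
  have tG: "integrable P (\<lambda>x. tail_part K (moment_bound x))"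
    by (rule integrable_tail_part[OF moment_bound_integrable moment_bound_nonneg])
  have tY: "integrable Q (\<lambda>y. tail_part K (norm y ^ 4))" by (rule integrable_tail_part[OF Q4]) simp
  have mG: "(\<lambda>x. tail_part K (moment_bound x)) \<in> borel_measurable borel" "(\<lambda>y::'a. tail_part K (norm y ^ 4)) \<in> borel_measurable borel"
    by measurable
  note iG = integrable_average_fst[OF mG(1) tG, of n m] and iY = integrable_average_snd(1)[OF mG(2) tY, of n m]
    integrable_average_snd(2)[OF mG(2) tY m, of n]
  have ce_sum_int: "integrable (samples n m) (\<lambda>z. \<Sum>w\<in>D. chain_error n m (c w) (fst z) (snd z))"
    by (intro Bochner_Integration.integrable_sum ce_int)
  have H_int: "integrable (samples n m) H"
    unfolding H_def using ce_sum_int gap_integrable[OF n m] iG(1) iY(1)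
    by (intro Bochner_Integration.integrable_add integrable_mult_right) simp_all
  have H_eq: "(\<integral>z. H z \<partial>samples n m) = \<epsilon>\<^sup>2 + 7 / 2 * K * (?Ec + ?Eg) + ?IG + 3 / 2 * ?IY"
  proof -
    have "(\<integral>z. e + k * (p z + r z) + u z + l * v z \<partial>samples n m)
        = e + k * ((\<integral>z. p z \<partial>samples n m) + (\<integral>z. r z \<partial>samples n m)) + (\<integral>z. u z \<partial>samples n m) + l * (\<integral>z. v z \<partial>samples n m)"
      if "integrable (samples n m) p" "integrable (samples n m) r" "integrable (samples n m) u" "integrable (samples n m) v"
      for p r u v :: "(nat \<Rightarrow> 'a) \<times> (nat \<Rightarrow> 'a) \<Rightarrow> real" and e k l :: real
      using that by (simp add: S.prob_space)
    note split = this[OF ce_sum_int gap_integrable[OF n m] iG(1) iY(1)]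
    have "(\<integral>z. (\<Sum>w\<in>D. chain_error n m (c w) (fst z) (snd z)) \<partial>samples n m) = ?Ec"
      by (intro Bochner_Integration.integral_sum ce_int)
    then show ?thesis unfolding H_def split iG(2)[OF n] iY(2) by simp
  qed
  have H_nonneg: "AE z in samples n m. 0 \<le> H z"
    using AE_samples[of n m]
  proof eventually_elim
    case (elim z)
    have g0: "0 \<le> gap n m (fst z) (snd z)" using elim by (intro gap_nonneg n m) auto
    then have "0 \<le> chain_error n m (c w) (fst z) (snd z)" if "w \<in> D" for w using chain_error_nonneg[OF c[OF that]] by blast
    then show ?case
      unfolding H_def using g0 K
      by (intro add_nonneg_nonneg mult_nonneg_nonneg divide_nonneg_nonneg sum_nonneg tail_part_nonneg moment_bound_nonneg) auto
  qed
  have U_borel: "- U \<in> sets (borel \<Otimes>\<^sub>M borel)"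
  proof -
    have "open U" unfolding U_def patch_def by (intro open_UN ballI open_Times open_ball)
    then have "- U \<in> sets borel" by (intro borel_closed) auto
    then show ?thesis unfolding borel_prod .
  qed
  have ind_meas: "(\<lambda>w. indicator (- U) (fst w, snd w) :: ennreal) \<in> borel_measurable (borel \<Otimes>\<^sub>M borel)"
    using U_borel by simp
  have ind_meas': "(\<lambda>s. \<integral>\<^sup>+t. indicator (- U) (s, t) \<partial>P) \<in> borel_measurable borel"
    using ind_meas by measurable
  have "resample_energy n m (gap n m)
      \<le> (\<integral>\<^sup>+z. ennreal (1 / (real n)\<^sup>2) * (ennreal (real n * H z) + of_nat n * (\<integral>\<^sup>+t. ennreal (tail_part K (moment_bound t)) \<partial>P)
        + ennreal (7 / 2 * K) * (\<Sum>i<n. \<integral>\<^sup>+t. indicator (- U) (fst z i, t) \<partial>P)) \<partial>samples n m)"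
    unfolding resample_energy_def
  proof (rule nn_integral_mono_AE, use AE_samples[of n m] in eventually_elim)
    case (elim z)
    then show ?case
      unfolding H_def U_def by (intro resample_gap_pointwise[OF n m \<epsilon> K D c large]) auto
  qed
  also have "\<dots> = ennreal (1 / (real n)\<^sup>2) * ((\<integral>\<^sup>+z. ennreal (real n * H z) \<partial>samples n m) + of_nat n * (\<integral>\<^sup>+t. ennreal (tail_part K (moment_bound t)) \<partial>P)
        + ennreal (7 / 2 * K) * (\<integral>\<^sup>+z. (\<Sum>i<n. \<integral>\<^sup>+t. indicator (- U) (fst z i, t) \<partial>P) \<partial>samples n m))"
  proof -
    have [measurable]: "(\<lambda>z. \<Sum>i<n. \<integral>\<^sup>+t. indicator (- U) (fst z i, t) \<partial>P) \<in> borel_measurable (samples n m)"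
      using measurable_compose[OF fst_sample_measurable ind_meas'] by (intro borel_measurable_sum) auto
    have [measurable]: "H \<in> borel_measurable (samples n m)" using H_int by auto
    have "(\<integral>\<^sup>+z. a * (p z + C + k * d z) \<partial>samples n m) = a * ((\<integral>\<^sup>+z. p z \<partial>samples n m) + C + k * (\<integral>\<^sup>+z. d z \<partial>samples n m))"
      if [measurable]: "p \<in> borel_measurable (samples n m)" "d \<in> borel_measurable (samples n m)" for p d and a C k :: ennreal
      by (simp add: nn_integral_cmult nn_integral_add S.emeasure_space_1)
    then show ?thesis by simp
  qed
  also have "(\<integral>\<^sup>+z. (\<Sum>i<n. \<integral>\<^sup>+t. indicator (- U) (fst z i, t) \<partial>P) \<partial>samples n m) = of_nat n * emeasure (P \<Otimes>\<^sub>M P) (- U)"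
  proof -
    have "- U \<in> sets (P \<Otimes>\<^sub>M P)" using U_borel by (metis sets_P sets_pair_measure_cong)
    then have "(\<integral>\<^sup>+s. \<integral>\<^sup>+t. indicator (- U) (s, t) \<partial>P \<partial>P) = emeasure (P \<Otimes>\<^sub>M P) (- U)"
      by (simp add: P.emeasure_pair_measure)
    then show ?thesis using nn_integral_sample_pair[of "\<lambda>s t. indicator (- U) (s, t)" n m, OF ind_meas] by simp
  qed
  also have "(\<integral>\<^sup>+t. ennreal (tail_part K (moment_bound t)) \<partial>P) = ennreal ?IG"
    by (intro nn_integral_eq_integral tG AE_I2 tail_part_nonneg moment_bound_nonneg)
  also have "(\<integral>\<^sup>+z. ennreal (real n * H z) \<partial>samples n m) = ennreal (real n * (\<integral>z. H z \<partial>samples n m))"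
    using H_int H_nonneg by (subst nn_integral_eq_integral) auto
  also have "ennreal (1 / (real n)\<^sup>2) * (ennreal (real n * (\<integral>z. H z \<partial>samples n m)) + of_nat n * ennreal ?IG
        + ennreal (7 / 2 * K) * (of_nat n * emeasure (P \<Otimes>\<^sub>M P) (- U)))
      \<le> ennreal (1 / (real n)\<^sup>2) * (ennreal (real n * (\<integral>z. H z \<partial>samples n m)) + of_nat n * ennreal ?IG
        + ennreal (7 / 2 * K) * (of_nat n * ennreal \<eta>))"
    using cover by (intro mult_left_mono add_left_mono) auto
  also have "\<dots> = ennreal (1 / (real n)\<^sup>2 * (real n * (\<integral>z. H z \<partial>samples n m) + real n * ?IG + 7 / 2 * K * (real n * \<eta>)))"
  proof -
    have "0 \<le> (\<integral>z. H z \<partial>samples n m)" using H_nonneg by (rule integral_nonneg_AE)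
    moreover have "0 \<le> ?IG" by (intro integral_nonneg_AE AE_I2 tail_part_nonneg moment_bound_nonneg)
    moreover have "ennreal a * (ennreal (real n * h) + of_nat n * ennreal g' + ennreal k * (of_nat n * ennreal e))
        = ennreal (a * (real n * h + real n * g' + k * (real n * e)))" if "0 \<le> a" "0 \<le> h" "0 \<le> g'" "0 \<le> k" "0 \<le> e" for a h g' k e
      using that by (simp add: ennreal_of_nat_eq_real_of_nat flip: ennreal_mult ennreal_plus)
    ultimately show ?thesis using K \<eta> by simp
  qed
  also have "1 / (real n)\<^sup>2 * (real n * (\<integral>z. H z \<partial>samples n m) + real n * ?IG + 7 / 2 * K * (real n * \<eta>))
      = ((\<integral>z. H z \<partial>samples n m) + ?IG + 7 / 2 * K * \<eta>) / real n"
  proof -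
    have "1 / (a * a) * (a * h + a * g' + k * (a * e)) = (h + g' + k * e) / a" if "a > 0" for a h g' k e :: real
      using that by (simp add: field_simps)
    note cancel = this
    show ?thesis unfolding power2_eq_square by (rule cancel) (use n in simp)
  qed
  also have "(\<integral>z. H z \<partial>samples n m) + ?IG + 7 / 2 * K * \<eta>
      = \<epsilon>\<^sup>2 + 7 / 2 * K * (?Ec + ?Eg) + 2 * ?IG + 3 / 2 * ?IY + 7 / 2 * K * \<eta>"
    unfolding H_eq by simp
  finally show ?thesis .
qed

text \<open>The order of choices matters: the level \<open>K\<close> by the tails,
  \<open>\<epsilon>\<close> and the chains, the finite cover with a tolerance depending on
  \<open>K\<close>, and last the sample sizes, which must beat constants depending on
  \<open>K\<close> and on the cover. The shares are \<open>\<eta> / 8\<close> for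
  \<open>\<epsilon>\<^sup>2\<close>, \<open>\<eta> / 4\<close> for the tails,
  \<open>\<eta> / 8\<close> for uncovered pairs, and \<open>\<eta> / 4\<close> for the chain errors
  and the gap.\<close>

theorem resample_energy_gap_small:
  assumes \<eta>: "\<eta> > 0"
  shows "\<exists>N0\<ge>1. \<forall>n\<ge>N0. \<forall>m\<ge>N0. resample_energy n m (gap n m) \<le> ennreal (\<eta> / real n)"
proof -
  have "(\<lambda>k. 2 * (\<integral>x. tail_part (real k) (moment_bound x) \<partial>P) + 3 / 2 * (\<integral>y. tail_part (real k) (norm y ^ 4) \<partial>Q)) \<longlonglongrightarrow> 2 * 0 + 3 / 2 * 0"
    unfolding tail_part_def
    by (intro tendsto_intros tail_integral_tendsto_0 moment_bound_integrable moment_bound_nonneg Q4) simp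
  then have "\<forall>\<^sub>F k in sequentially. 2 * (\<integral>x. tail_part (real k) (moment_bound x) \<partial>P) + 3 / 2 * (\<integral>y. tail_part (real k) (norm y ^ 4) \<partial>Q) < \<eta> / 4"
    using \<eta> by (intro order_tendstoD(2)) auto
  then obtain k0 where k0: "\<And>k. k \<ge> k0 \<Longrightarrow> 2 * (\<integral>x. tail_part (real k) (moment_bound x) \<partial>P) + 3 / 2 * (\<integral>y. tail_part (real k) (norm y ^ 4) \<partial>Q) < \<eta> / 4"
    by (auto simp: eventually_sequentially)
  define K where "K = real (max 1 k0)"
  have K: "K \<ge> 1" and tails: "2 * (\<integral>x. tail_part K (moment_bound x) \<partial>P) + 3 / 2 * (\<integral>y. tail_part K (norm y ^ 4) \<partial>Q) < \<eta> / 4"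
    using k0[of "max 1 k0"] by (auto simp: K_def)
  define \<epsilon> where "\<epsilon> = sqrt (\<eta> / 8)"
  have \<epsilon>: "\<epsilon> > 0" "\<epsilon>\<^sup>2 = \<eta> / 8" using \<eta> by (auto simp: \<epsilon>_def)
  obtain c where c: "\<And>w. w \<in> \<Omega> \<times> \<Omega> \<Longrightarrow> chain \<epsilon> w (c w)" using chain_exists[OF \<epsilon>(1)] by metis
  \<comment> \<open>The 28, here and below, is 8 times the coefficient \<open>7 / 2\<close>.\<close>
  define \<eta>' where "\<eta>' = \<eta> / (28 * K)"
  have \<eta>': "\<eta>' > 0" "7 / 2 * K * \<eta>' = \<eta> / 8" using \<eta> K by (auto simp: \<eta>'_def)
  obtain D where D: "finite D" "D \<subseteq> \<Omega> \<times> \<Omega>" "emeasure (P \<Otimes>\<^sub>M P) (- (\<Union>w\<in>D. patch w (c w))) \<le> ennreal \<eta>'"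
    by (rule finite_cover[OF c \<eta>'(1)]) blast+
  have cD: "chain \<epsilon> w (c w)" if "w \<in> D" for w using c that D(2) by blast
  define \<beta> where "\<beta> w = chain_mass (c w)" for w
  define \<gamma> where "\<gamma> w = fst (snd (snd (c w)))" for w
  have \<beta>0: "\<beta> w > 0" if "w \<in> D" for w
  proof -
    obtain N r \<gamma> q where cw: "c w = (N, r, \<gamma>, q)" by (cases "c w") auto
    show ?thesis unfolding \<beta>_def cw by (rule chain_mass(1)[OF cD[OF that, unfolded cw]])
  qed
  have \<gamma>0: "\<gamma> w > 0" if "w \<in> D" for w using cD[OF that] unfolding chain_def \<gamma>_def by (auto split: prod.splits)
  define L1 where "L1 = (\<Sum>w\<in>D. real (fst (c w)) / \<beta> w)"
  \<comment> \<open>The extra 1 accounts for the gap that stands next to the chain errors, and keeps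
    \<open>L2\<close> positive even for an empty cover.\<close>
  define L2 where "L2 = (\<Sum>w\<in>D. 2 / (\<gamma> w * \<beta> w)) + 1"
  define L3 where "L3 = (\<Sum>w\<in>D. 2 * (real (fst (c w)) + 1) / \<beta> w)"
  have term0: "0 \<le> real (fst (c w)) / \<beta> w" "0 \<le> 2 / (\<gamma> w * \<beta> w)" "0 \<le> 2 * (real (fst (c w)) + 1) / \<beta> w" if "w \<in> D" for w
    using \<beta>0[OF that] \<gamma>0[OF that] by (auto intro!: divide_nonneg_nonneg)
  have L: "0 \<le> L1" "0 < L2" unfolding L1_def L2_def using term0 by (auto intro!: sum_nonneg add_nonneg_pos)
  define e where "e = \<eta> / (28 * K * L2)"
  have e: "e > 0" "7 / 2 * K * (L2 * e) = \<eta> / 8" using \<eta> K L by (auto simp: e_def)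
  obtain N1 where N1: "N1 \<ge> 1" "\<And>n m. n \<ge> N1 \<Longrightarrow> m \<ge> N1 \<Longrightarrow> (\<integral>z. gap n m (fst z) (snd z) \<partial>samples n m) \<le> e"
    using expectation_gap_small[OF e(1)] by blast
  obtain N2 :: nat where N2: "(28 * K * L1 / \<eta>)\<^sup>2 < real N2" using reals_Archimedean2 by blast
  obtain N3 :: nat where N3: "L3 < real N3" using reals_Archimedean2 by blast
  define N0 where "N0 = max N1 (max N2 N3)"
  have "resample_energy n m (gap n m) \<le> ennreal (\<eta> / real n)" if nN: "n \<ge> N0" and mN: "m \<ge> N0" for n m
  proof -
    have n: "n \<ge> 1" and m: "m \<ge> 1" using nN mN N1(1) by (auto simp: N0_def)
    let ?Eg = "\<integral>z. gap n m (fst z) (snd z) \<partial>samples n m"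
    have Eg: "?Eg \<le> e" using N1(2)[of n m] nN mN by (simp add: N0_def)
    have large: "real (fst (c w)) + 1 \<le> real n * chain_mass (c w) / 2" if w: "w \<in> D" for w
    proof -
      have "2 * (real (fst (c w)) + 1) / \<beta> w \<le> L3" unfolding L3_def using w D(1) term0 by (intro member_le_sum) auto
      also have "\<dots> \<le> real n" using N3 nN by (simp add: N0_def)
      finally show ?thesis using \<beta>0[OF w] by (simp add: divide_le_eq \<beta>_def)
    qed
    have "(\<Sum>w\<in>D. \<integral>z. chain_error n m (c w) (fst z) (snd z) \<partial>samples n m)
        \<le> (\<Sum>w\<in>D. real (fst (c w)) / \<beta> w * (1 / sqrt (real n)) + 2 / (\<gamma> w * \<beta> w) * ?Eg)"
    proof (rule sum_mono)
      fix w assume w: "w \<in> D"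
      obtain N r \<gamma>' q where cw: "c w = (N, r, \<gamma>', q)" by (cases "c w") auto
      show "(\<integral>z. chain_error n m (c w) (fst z) (snd z) \<partial>samples n m) \<le> real (fst (c w)) / \<beta> w * (1 / sqrt (real n)) + 2 / (\<gamma> w * \<beta> w) * ?Eg"
        using chain_error_expectation(2)[OF n m cD[OF w, unfolded cw]] by (simp add: \<beta>_def \<gamma>_def cw)
    qed
    also have "\<dots> = L1 * (1 / sqrt (real n)) + (L2 - 1) * ?Eg"
      unfolding L1_def L2_def by (simp only: sum.distrib sum_distrib_right[symmetric] add_diff_cancel_right')
    finally have "(\<Sum>w\<in>D. \<integral>z. chain_error n m (c w) (fst z) (snd z) \<partial>samples n m) + ?Eg \<le> L1 * (1 / sqrt (real n)) + L2 * ?Eg"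
      by (simp add: left_diff_distrib)
    also have "\<dots> \<le> L1 / sqrt (real n) + L2 * e" using Eg L by (intro add_mono mult_left_mono) auto
    finally have "7 / 2 * K * ((\<Sum>w\<in>D. \<integral>z. chain_error n m (c w) (fst z) (snd z) \<partial>samples n m) + ?Eg)
        \<le> 7 / 2 * K * (L1 / sqrt (real n) + L2 * e)" using K by (intro mult_left_mono) auto
    also have "\<dots> = 7 / 2 * K * (L1 / sqrt (real n)) + \<eta> / 8" unfolding e(2)[symmetric] by (rule distrib_left)
    also have "7 / 2 * K * (L1 / sqrt (real n)) \<le> \<eta> / 8"
    proof -
      have "(28 * K * L1 / \<eta>)\<^sup>2 \<le> real n" using N2 nN by (simp add: N0_def)
      then have "28 * K * L1 / \<eta> \<le> sqrt (real n)" by (rule real_le_rsqrt)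
      moreover have "sqrt (real n) > 0" using n by simp
      ultimately show ?thesis using \<eta> by (simp add: field_simps)
    qed
    finally have err: "7 / 2 * K * ((\<Sum>w\<in>D. \<integral>z. chain_error n m (c w) (fst z) (snd z) \<partial>samples n m) + ?Eg) \<le> \<eta> / 8 + \<eta> / 8" by simp
    have K0: "0 \<le> K" using K by simp
    have "resample_energy n m (gap n m) \<le> ennreal ((\<epsilon>\<^sup>2
      + 7 / 2 * K * ((\<Sum>w\<in>D. \<integral>z. chain_error n m (c w) (fst z) (snd z) \<partial>samples n m) + ?Eg)
      + 2 * (\<integral>x. tail_part K (moment_bound x) \<partial>P) + 3 / 2 * (\<integral>y. tail_part K (norm y ^ 4) \<partial>Q) + 7 / 2 * K * \<eta>') / real n)"
      by (rule resample_energy_gap_le[OF n m \<epsilon>(1) K0 less_imp_le[OF \<eta>'(1)] D(1) cD large D(3)])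
    also have "\<dots> \<le> ennreal (\<eta> / real n)"
      using err tails \<eta> unfolding \<epsilon>(2) \<eta>'(2) by (intro ennreal_leI divide_right_mono) auto
    finally show ?thesis .
  qed
  moreover have "N0 \<ge> 1" using N1(1) by (simp add: N0_def)
  ultimately show ?thesis by blast
qed

end

section \<open>Supports and potentials\<close>

text \<open>The convex support is an intersection of possibly uncountably many sets, so its full
  mass needs Lindelof, applied to the complements. Its frontier is Lebesgue null, being that of a
  convex set, hence null for \<open>P\<close>, and all mass sits in the interior. This interior lies
  in \<open>A\<close> because a convex set and its closure have the same interior.\<close>

lemma convex_support_interior:
  fixes P :: "'a::euclidean_space measure"
  assumes P: "prob_space P" "sets P = sets borel" and pos: "positive_density_in_interior P"
    and A: "convex A" "A \<in> sets borel" "AE x in P. x \<in> A"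
  defines "\<Omega> \<equiv> interior (convex_support P)"
  shows "open \<Omega>" "convex \<Omega>" "\<Omega> \<subseteq> A" "AE x in P. x \<in> \<Omega>"
    and "\<And>q r. r > 0 \<Longrightarrow> ball q r \<subseteq> \<Omega> \<Longrightarrow> 0 < measure P (ball q r)"
proof -
  interpret P: prob_space P by (rule P(1))
  obtain h where h: "h \<in> borel_measurable borel" "P = density lborel h" "\<And>x. x \<in> \<Omega> \<Longrightarrow> h x > 0"
    using pos unfolding positive_density_in_interior_def \<Omega>_def by auto
  let ?\<C> = "{C. closed C \<and> convex C \<and> emeasure P C = 1}"
  have S: "closed (convex_support P)" "convex (convex_support P)"
    unfolding convex_support_def by (auto intro: convex_Inter)
  show "open \<Omega>" "convex \<Omega>" unfolding \<Omega>_def using S by (auto intro: convex_interior)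
  have "emeasure P A = 1" using A P(2) by (intro P.emeasure_eq_1_AE) auto
  moreover have "emeasure P A \<le> emeasure P (closure A)" using P(2) by (intro emeasure_mono closure_subset) auto
  ultimately have "1 \<le> emeasure P (closure A)" by (simp only:)
  then have "emeasure P (closure A) = 1" by (intro antisym P.emeasure_le_1)
  then have "convex_support P \<subseteq> closure A"
    unfolding convex_support_def using A(1) by (intro Inter_lower) (auto intro: convex_closure)
  then have "\<Omega> \<subseteq> interior (closure A)" unfolding \<Omega>_def by (rule interior_mono)
  then show "\<Omega> \<subseteq> A" using convex_interior_closure[OF A(1)] interior_subset by blast
  have AE_S: "AE x in P. x \<in> convex_support P"
  proof -
    obtain F where F: "F \<subseteq> uminus ` ?\<C>" "countable F" "\<Union>F = \<Union>(uminus ` ?\<C>)"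
      by (rule Lindelof[of "uminus ` ?\<C>"]) auto
    have "AE x in P. x \<notin> U" if "U \<in> F" for U
    proof -
      have "U \<in> uminus ` ?\<C>" using F(1) that by (rule subsetD)
      then obtain C where "U = - C" "C \<in> ?\<C>" by (rule imageE)
      then have C: "U = - C" "emeasure P C = 1" by simp_all
      have "AE x in P. x \<in> C" using C(2) by (intro P.AE_prob_1) (simp add: measure_def)
      then show ?thesis by (simp add: C(1))
    qed
    then have "AE x in P. \<forall>U\<in>F. x \<notin> U" using F(2) by (subst AE_ball_countable) auto
    then show ?thesis
    proof eventually_elim
      case (elim x)
      then have "x \<notin> \<Union>(uminus ` ?\<C>)" unfolding F(3)[symmetric] by auto
      then show ?case unfolding convex_support_def by auto
    qed
  qed
  have "AE x in lborel. x \<notin> frontier (convex_support P)"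
  proof -
    have "frontier (convex_support P) \<in> null_sets lebesgue"
      using negligible_convex_frontier[OF S(2)] by (simp add: negligible_iff_null_sets)
    then have "frontier (convex_support P) \<in> null_sets lborel"
      by (subst (asm) null_sets_completion_iff) (auto intro: borel_closed frontier_closed)
    then show ?thesis by (rule AE_not_in)
  qed
  then have "AE x in P. x \<notin> frontier (convex_support P)"
    unfolding h(2) using h(1) by (subst AE_density) auto
  with AE_S show "AE x in P. x \<in> \<Omega>"
    by eventually_elim (use S(1) in \<open>auto simp: frontier_def \<Omega>_def closure_closed\<close>)
  show "0 < measure P (ball q r)" if r: "r > 0" and sub: "ball q r \<subseteq> \<Omega>" for q r
  proof (rule ccontr)
    assume "\<not> 0 < measure P (ball q r)"
    then have "measure P (ball q r) = 0" by (simp add: zero_less_measure_iff)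
    then have "ball q r \<in> null_sets P" using P(2) by (intro null_setsI) (auto simp: P.emeasure_eq_measure)
    then have "AE x in P. x \<notin> ball q r" by (rule AE_not_in)
    then have "AE x in lborel. 0 < h x \<longrightarrow> x \<notin> ball q r"
      unfolding h(2) using h(1) by (subst (asm) AE_density) auto
    then have "AE x in lborel. x \<notin> ball q r"
      by eventually_elim (use h(3) sub in blast)
    then have "ball q r \<in> null_sets lborel" by (subst AE_iff_null_sets) auto
    then have "negligible (ball q r)"
      unfolding negligible_iff_null_sets by (rule null_sets_completionI)
    then show False using open_not_negligible[of "ball q r"] r by auto
  qed
qed

lemma integrable_norm_power4:
  fixes P :: "'a::euclidean_space measure"
  assumes P: "prob_space P" "sets P = sets borel" and \<delta>: "\<delta> > 0" and int: "integrable P (\<lambda>x. norm x powr (4 + \<delta>))"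
  shows "integrable P (\<lambda>x. norm x ^ 4)"
proof (rule Bochner_Integration.integrable_bound[of _ "\<lambda>x. 1 + norm x powr (4 + \<delta>)"])
  interpret P: prob_space P by (rule P(1))
  show "integrable P (\<lambda>x. 1 + norm x powr (4 + \<delta>))" using int by auto
  show "(\<lambda>x. norm x ^ 4) \<in> borel_measurable P" unfolding measurable_cong_sets[OF P(2) refl] by measurable
  have "r ^ 4 \<le> 1 + r powr (4 + \<delta>)" if "r \<ge> 0" for r :: real
  proof (cases "r \<le> 1")
    case True
    then have "r ^ 4 \<le> 1" using that by (simp add: power_le_one)
    then show ?thesis by (simp add: add_increasing2)
  next
    case False
    then have "r ^ 4 = r powr 4" by (simp add: powr_numeral)
    also have "\<dots> \<le> r powr (4 + \<delta>)" using False \<delta> by (intro powr_mono) auto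
    finally show ?thesis by simp
  qed
  then show "AE x in P. norm (norm x ^ 4) \<le> norm (1 + norm x powr (4 + \<delta>))" by (intro AE_I2) simp
qed

lemma ereal_convex_finite:
  fixes \<phi> :: "'a::real_vector \<Rightarrow> ereal"
  assumes conv: "convex_fun \<phi>" and ninf: "\<And>x. \<phi> x \<noteq> -\<infinity>"
  defines "A \<equiv> {x. \<bar>\<phi> x\<bar> \<noteq> \<infinity>}"
  shows "convex A" and "convex_on A (\<lambda>x. real_of_ereal (\<phi> x))"
proof -
  have key: "(1 - t) *\<^sub>R x + t *\<^sub>R y \<in> A \<and> real_of_ereal (\<phi> ((1 - t) *\<^sub>R x + t *\<^sub>R y)) \<le> (1 - t) * real_of_ereal (\<phi> x) + t * real_of_ereal (\<phi> y)"
    if xy: "x \<in> A" "y \<in> A" and t: "0 < t" "t < 1" for x y t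
  proof -
    let ?z = "(1 - t) *\<^sub>R x + t *\<^sub>R y"
    obtain a b where ab: "\<phi> x = ereal a" "\<phi> y = ereal b" using xy unfolding A_def by (cases "\<phi> x"; cases "\<phi> y") auto
    have le: "\<phi> ?z \<le> ereal ((1 - t) * a + t * b)"
    proof -
      have "\<phi> ?z \<le> ereal (1 - t) * \<phi> x + ereal t * \<phi> y"
        using conv[unfolded convex_fun_def, rule_format, of t x y] t by simp
      then show ?thesis by (simp add: ab)
    qed
    then obtain c where c: "\<phi> ?z = ereal c" using ninf[of ?z] by (cases "\<phi> ?z") auto
    then show ?thesis using le by (simp add: A_def ab)
  qed
  show "convex A"
    unfolding convex_alt
  proof (intro ballI allI impI)
    fix x y t assume "x \<in> A" "y \<in> A" "0 \<le> t \<and> t \<le> (1::real)"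
    then show "(1 - t) *\<^sub>R x + t *\<^sub>R y \<in> A" using key[of x y t] by (cases "t = 0"; cases "t = 1") auto
  qed
  then show "convex_on A (\<lambda>x. real_of_ereal (\<phi> x))"
    using key by (intro convex_onI) auto
qed

lemma convex_conjugate:
  assumes "proper_fun \<phi>"
  shows "convex_fun (conjugate \<phi>)" and "conjugate \<phi> y \<noteq> -\<infinity>"
proof -
  obtain v where "\<phi> v \<noteq> \<infinity>" "\<phi> v \<noteq> -\<infinity>" using assms unfolding proper_fun_def by auto
  then obtain a where a: "\<phi> v = ereal a" by (cases "\<phi> v") auto
  have "ereal (y \<bullet> v) - \<phi> v \<le> conjugate \<phi> y" for y unfolding conjugate_def by (rule SUP_upper) simp
  then have ge: "ereal (y \<bullet> v - a) \<le> conjugate \<phi> y" for y by (simp add: a)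
  then show ninf: "conjugate \<phi> y \<noteq> -\<infinity>" for y by (metis MInfty_neq_ereal(1) ereal_infty_less_eq(2))
  show "convex_fun (conjugate \<phi>)"
    unfolding convex_fun_def
  proof (intro allI ballI)
    fix x y :: 'a and t :: real assume t: "t \<in> {0<..<1}"
    show "conjugate \<phi> ((1 - t) *\<^sub>R x + t *\<^sub>R y) \<le> ereal (1 - t) * conjugate \<phi> x + ereal t * conjugate \<phi> y"
    proof (cases "conjugate \<phi> x = \<infinity> \<or> conjugate \<phi> y = \<infinity>")
      case True
      then have inf: "ereal (1 - t) * conjugate \<phi> x + ereal t * conjugate \<phi> y = \<infinity>"
        using ninf[of x] ninf[of y] t by (cases "conjugate \<phi> x"; cases "conjugate \<phi> y") auto
      show ?thesis unfolding inf by simp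
    next
      case False
      then obtain p q where pq: "conjugate \<phi> x = ereal p" "conjugate \<phi> y = ereal q"
        using ninf[of x] ninf[of y] by (cases "conjugate \<phi> x"; cases "conjugate \<phi> y") auto
      show ?thesis
        unfolding conjugate_def[of \<phi> "(1 - t) *\<^sub>R x + t *\<^sub>R y"] pq
      proof (rule SUP_least)
        fix w
        show "ereal (((1 - t) *\<^sub>R x + t *\<^sub>R y) \<bullet> w) - \<phi> w \<le> ereal (1 - t) * ereal p + ereal t * ereal q"
        proof (cases "\<phi> w")
          case (real b)
          have "ereal (x \<bullet> w) - \<phi> w \<le> ereal p" "ereal (y \<bullet> w) - \<phi> w \<le> ereal q"
            unfolding pq[symmetric] conjugate_def by (auto intro: SUP_upper)
          then have "x \<bullet> w - b \<le> p" "y \<bullet> w - b \<le> q" by (auto simp: real)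
          then have "(1 - t) * (x \<bullet> w - b) + t * (y \<bullet> w - b) \<le> (1 - t) * p + t * q"
            using t by (intro add_mono mult_left_mono) auto
          then show ?thesis by (simp add: real inner_add_left algebra_simps)
        qed (use assms in \<open>auto simp: proper_fun_def\<close>)
      qed
    qed
  qed
qed

text \<open>The domains where the potential and its conjugate are finite serve as \<open>A\<close>
  and \<open>B\<close>. They are convex of full measure, so they contain the interiors of the convex
  supports, and there the convex real parts are continuous. Minimality over extended-valued pairs
  specializes to real-valued ones.\<close>

lemma ot_potential_regular:
  fixes P Q :: "'a::euclidean_space measure"
  assumes P: "prob_space P" "sets P = sets borel" and Q: "prob_space Q" "sets Q = sets borel"
    and pos: "positive_density_in_interior P" "positive_density_in_interior Q"
    and P4: "integrable P (\<lambda>x. norm x ^ 4)" and Q4: "integrable Q (\<lambda>y. norm y ^ 4)"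
    and ot: "ot_potential P Q \<phi>"
  defines "f \<equiv> \<lambda>x. real_of_ereal (\<phi> x)" and "g \<equiv> \<lambda>y. real_of_ereal (conjugate \<phi> y)"
  obtains A B where "regular_potentials P Q f g A B (interior (convex_support P))"
    "regular_potentials Q P g f B A (interior (convex_support Q))"
proof -
  interpret P: prob_space P by (rule P(1))
  interpret Q: prob_space Q by (rule Q(1))
  have two: "two_samples P Q" by unfold_locales (fact P Q)+
  define A where "A = {x. \<bar>\<phi> x\<bar> \<noteq> \<infinity>}"
  define B where "B = {y. \<bar>conjugate \<phi> y\<bar> \<noteq> \<infinity>}"
  have proper: "proper_fun \<phi>" and conv: "convex_fun \<phi>" and L1: "\<phi> \<in> L1_ereal P" "conjugate \<phi> \<in> L1_ereal Q"
    and feas: "\<And>x y. ereal (x \<bullet> y) \<le> \<phi> x + conjugate \<phi> y"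
    and min: "\<And>F G. (F, G) \<in> dual_pairs P Q \<Longrightarrow> dual_cost P Q \<phi> (conjugate \<phi>) \<le> dual_cost P Q F G"
    using ot unfolding ot_potential_def dual_pairs_def by auto
  have meas: "\<phi> \<in> borel_measurable borel" "conjugate \<phi> \<in> borel_measurable borel"
    using L1 measurable_cong_sets[OF P(2) refl] measurable_cong_sets[OF Q(2) refl] unfolding L1_ereal_def by auto
  have A: "convex A" "convex_on A f" and B: "convex B" "convex_on B g"
    using ereal_convex_finite[OF conv] ereal_convex_finite[OF convex_conjugate[OF proper]] proper
    unfolding A_def B_def f_def g_def proper_fun_def by auto
  have AB: "A \<in> sets borel" "B \<in> sets borel"
    using meas unfolding A_def B_def by measurable
  have AE: "AE x in P. x \<in> A" "AE y in Q. y \<in> B" using L1 unfolding L1_ereal_def A_def B_def by auto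
  have dp: "dual_potentials P Q f g A B"
  proof (intro dual_potentials.intro two dual_potentials_axioms.intro)
    show "f \<in> borel_measurable borel" "g \<in> borel_measurable borel" unfolding f_def g_def using meas by measurable
    show "integrable P f" "integrable Q g" using L1 unfolding L1_ereal_def f_def g_def by auto
    show "x \<bullet> y \<le> f x + g y" if "x \<in> A" "y \<in> B" for x y
      using feas[of x y] that unfolding A_def B_def f_def g_def
      by (cases "\<phi> x"; cases "conjugate \<phi> y") auto
    show "(\<integral>x. f x \<partial>P) + (\<integral>y. g y \<partial>Q) \<le> (\<integral>x. F x \<partial>P) + (\<integral>y. G y \<partial>Q)"
      if FG: "F \<in> borel_measurable borel" "G \<in> borel_measurable borel" "integrable P F" "integrable Q G" "\<And>x y. x \<bullet> y \<le> F x + G y" for F G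
    proof -
      have "(\<lambda>x. ereal (F x), \<lambda>y. ereal (G y)) \<in> dual_pairs P Q"
        unfolding dual_pairs_def L1_ereal_def using FG by auto
      from min[OF this] show ?thesis by (simp add: dual_cost_def f_def g_def)
    qed
  qed (fact P4 Q4 AB AE)+
  have swap: "dual_potentials Q P g f B A" by (rule dual_potentials.dual_potentials_swap[OF dp])
  note SP = convex_support_interior[OF P pos(1) A(1) AB(1) AE(1)]
    and SQ = convex_support_interior[OF Q pos(2) B(1) AB(2) AE(2)]
  have "regular_potentials P Q f g A B (interior (convex_support P))"
    by (intro regular_potentials.intro dp regular_potentials_axioms.intro SP convex_on_continuous convex_on_subset[OF A(2) SP(3)])
  moreover have "regular_potentials Q P g f B A (interior (convex_support Q))"
    by (intro regular_potentials.intro swap regular_potentials_axioms.intro SQ convex_on_continuous convex_on_subset[OF B(2) SQ(3)])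
  ultimately show thesis by (rule that)
qed

context dual_potentials
begin

lemma ot_remainder_eq:
  assumes n: "n \<ge> 1" and m: "m \<ge> 1"
    and f: "f = (\<lambda>x. real_of_ereal (\<phi> x))" and g: "g = (\<lambda>y. real_of_ereal (conjugate \<phi> y))"
  shows "ot_remainder \<phi> n m x y = 2 * gap n m x y"
proof -
  have fg: "real_of_ereal (\<phi> z) = f z" "real_of_ereal (conjugate \<phi> z) = g z" for z by (simp_all add: f g)
  have 1: "(\<integral>z. (norm z)\<^sup>2 - 2 * f z \<partial>empirical_measure n x) = (\<Sum>i<n. (norm (x i))\<^sup>2 - 2 * f (x i)) / real n"
    by (rule integral_empirical_measure) measurable
  have 2: "(\<integral>z. (norm z)\<^sup>2 - 2 * g z \<partial>empirical_measure m y) = (\<Sum>j<m. (norm (y j))\<^sup>2 - 2 * g (y j)) / real m"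
    by (rule integral_empirical_measure) measurable
  show ?thesis
    unfolding ot_remainder_def fg 1 2 empirical_W_eq[OF n m] gap_def
    by (simp add: sum_subtractf sum_distrib_left[symmetric] diff_divide_distrib)
qed

lemma gap_restrict: "gap n m (restrict x {..<n}) (restrict y {..<m}) = gap n m x y"
proof -
  have "transport_value n m (\<lambda>i j. restrict x {..<n} i \<bullet> restrict y {..<m} j) = transport_value n m (\<lambda>i j. x i \<bullet> y j)"
    by (intro transport_value_cong) auto
  then show ?thesis by (simp add: gap_def)
qed

lemma gap_swap:
  assumes n: "n \<ge> 1" and m: "m \<ge> 1"
  shows "(\<lambda>y x. gap n m x y) = dual_potentials.gap g f m n"
proof (intro ext)
  interpret QP: dual_potentials Q P g f B A by (rule dual_potentials_swap)
  fix y x :: "nat \<Rightarrow> 'a"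
  have "transport_value n m (\<lambda>i j. x i \<bullet> y j) = transport_value m n (\<lambda>j i. y j \<bullet> x i)"
    by (subst transport_value_swap[OF n m]) (simp add: inner_commute)
  then show "gap n m x y = QP.gap m n y x" by (simp add: gap_def QP.gap_def)
qed

text \<open>Rests on \<open>f_square_integrable\<close> for \<open>f\<close> and, with the roles of
  \<open>P\<close> and \<open>Q\<close> exchanged, for \<open>g\<close>; it makes the variance of
  the gap meaningful.\<close>

lemma gap_square_integrable:
  assumes n: "n \<ge> 1" and m: "m \<ge> 1"
  shows "integrable (samples n m) (\<lambda>z. (gap n m (fst z) (snd z))\<^sup>2)"
proof (rule Bochner_Integration.integrable_bound)
  interpret QP: dual_potentials Q P g f B A by (rule dual_potentials_swap)
  let ?A = "\<lambda>x. (\<Sum>i<n. (f (x i))\<^sup>2) / real n" and ?B = "\<lambda>y. (\<Sum>j<m. (g (y j))\<^sup>2) / real m"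
  let ?T = "\<lambda>x y. transport_value n m (\<lambda>i j. x i \<bullet> y j)"
  have m2: "(\<lambda>x. (f x)\<^sup>2) \<in> borel_measurable borel" "(\<lambda>y. (g y)\<^sup>2) \<in> borel_measurable borel" by measurable
  show "integrable (samples n m) (\<lambda>z. 3 * (?A (fst z) + ?B (snd z) + (?T (fst z) (snd z))\<^sup>2))"
    by (intro integrable_mult_right Bochner_Integration.integrable_add integrable_average_fst(1)[OF m2(1) f_square_integrable]
        integrable_average_snd(1)[OF m2(2) QP.f_square_integrable] integrable_transport_value_square[OF n m P4 Q4])
  have "(gap n m x y)\<^sup>2 \<le> 3 * (?A x + ?B y + (?T x y)\<^sup>2)" for x y
  proof -
    have "(p + q - r)\<^sup>2 \<le> 3 * (p\<^sup>2 + q\<^sup>2 + r\<^sup>2)" for p q r :: real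
      using zero_le_power2[of "p - q"] zero_le_power2[of "p + r"] zero_le_power2[of "q + r"]
      by (simp add: power2_eq_square algebra_simps)
    from this[of "(\<Sum>i<n. f (x i)) / real n" "(\<Sum>j<m. g (y j)) / real m" "?T x y"] show ?thesis
      unfolding gap_def
      using average_power2_le[OF n, of "\<lambda>i. f (x i)"] average_power2_le[OF m, of "\<lambda>j. g (y j)"] by simp
  qed
  then have "norm ((gap n m x y)\<^sup>2) \<le> norm (3 * (?A x + ?B y + (?T x y)\<^sup>2))" for x y
    unfolding real_norm_def abs_power2 by (rule order_trans[OF _ abs_ge_self])
  then show "AE z in samples n m. norm ((gap n m (fst z) (snd z))\<^sup>2) \<le> norm (3 * (?A (fst z) + ?B (snd z) + (?T (fst z) (snd z))\<^sup>2))"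
    by (intro AE_I2)
qed measurable

end

section \<open>Variance of the remainder\<close>

text \<open>Both halves of the Efron--Stein bound are instances of
  \<open>resample_energy_gap_small\<close>, the second one with \<open>P\<close> and
  \<open>Q\<close> exchanged; regularity is therefore assumed in both orders.\<close>

theorem variance_gap:
  fixes P Q :: "'a::euclidean_space measure" and M :: "'w measure" and X Y :: "nat \<Rightarrow> 'w \<Rightarrow> 'a"
  assumes reg: "regular_potentials P Q f g A B \<Omega>" "regular_potentials Q P g f B A \<Omega>'" and M: "prob_space M"
    and X_indep: "prob_space.indep_vars M (\<lambda>_. borel) X UNIV" and X_law: "\<And>i. distr M borel (X i) = P"
    and Y_indep: "prob_space.indep_vars M (\<lambda>_. borel) Y UNIV" and Y_law: "\<And>j. distr M borel (Y j) = Q"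
    and XY_indep: "prob_space.indep_var M
          (\<Pi>\<^sub>M i\<in>UNIV. borel) (\<lambda>\<omega> i. X i \<omega>) (\<Pi>\<^sub>M j\<in>UNIV. borel) (\<lambda>\<omega> j. Y j \<omega>)"
  shows "n \<ge> 1 \<Longrightarrow> m \<ge> 1 \<Longrightarrow> square_integrable M (\<lambda>\<omega>. dual_potentials.gap f g n m (\<lambda>i. X i \<omega>) (\<lambda>j. Y j \<omega>))"
    and "\<eta> > 0 \<Longrightarrow> \<exists>N0\<ge>1. \<forall>n\<ge>N0. \<forall>m\<ge>N0.
      prob_space.variance M (\<lambda>\<omega>. dual_potentials.gap f g n m (\<lambda>i. X i \<omega>) (\<lambda>j. Y j \<omega>)) \<le> \<eta> / real n + \<eta> / real m"
proof -
  interpret regular_potentials P Q f g A B \<Omega> by (rule reg(1))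
  interpret QP: regular_potentials Q P g f B A \<Omega>' by (rule reg(2))
  interpret M: prob_space M by (rule M)
  have transfer: "square_integrable M (\<lambda>\<omega>. gap n m (\<lambda>i. X i \<omega>) (\<lambda>j. Y j \<omega>))"
    "ennreal (M.variance (\<lambda>\<omega>. gap n m (\<lambda>i. X i \<omega>) (\<lambda>j. Y j \<omega>))) = pos_var (samples n m) (\<lambda>z. gap n m (fst z) (snd z))"
    if n: "n \<ge> 1" and m: "m \<ge> 1" for n m
  proof -
    let ?T = "\<lambda>\<omega>. (\<lambda>i\<in>{..<n}. X i \<omega>, \<lambda>j\<in>{..<m}. Y j \<omega>)"
    note T = distr_samples[OF M X_indep X_law Y_indep Y_law XY_indep n m]
    have restrict: "gap n m (fst (?T \<omega>)) (snd (?T \<omega>)) = gap n m (\<lambda>i. X i \<omega>) (\<lambda>j. Y j \<omega>)" for \<omega>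
      using gap_restrict[of n m "\<lambda>i. X i \<omega>" "\<lambda>j. Y j \<omega>"] by simp
    note transfer = distr_transfer[OF M T(2,1) gap_measurable restrict gap_square_integrable[OF n m]]
    show "square_integrable M (\<lambda>\<omega>. gap n m (\<lambda>i. X i \<omega>) (\<lambda>j. Y j \<omega>))" by (rule transfer(1))
    show "ennreal (M.variance (\<lambda>\<omega>. gap n m (\<lambda>i. X i \<omega>) (\<lambda>j. Y j \<omega>))) = pos_var (samples n m) (\<lambda>z. gap n m (fst z) (snd z))"
      by (rule transfer(2))
  qed
  show "square_integrable M (\<lambda>\<omega>. gap n m (\<lambda>i. X i \<omega>) (\<lambda>j. Y j \<omega>))" if "n \<ge> 1" "m \<ge> 1"
    using transfer(1)[OF that] .
  show "\<exists>N0\<ge>1. \<forall>n\<ge>N0. \<forall>m\<ge>N0. M.variance (\<lambda>\<omega>. gap n m (\<lambda>i. X i \<omega>) (\<lambda>j. Y j \<omega>)) \<le> \<eta> / real n + \<eta> / real m"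
    if \<eta>: "\<eta> > 0"
  proof -
    obtain N1 where N1: "N1 \<ge> 1" "\<And>n m. n \<ge> N1 \<Longrightarrow> m \<ge> N1 \<Longrightarrow> resample_energy n m (gap n m) \<le> ennreal (\<eta> / real n)"
      using resample_energy_gap_small[OF \<eta>] by blast
    obtain N2 where N2: "N2 \<ge> 1" "\<And>n m. n \<ge> N2 \<Longrightarrow> m \<ge> N2 \<Longrightarrow> QP.resample_energy n m (QP.gap n m) \<le> ennreal (\<eta> / real n)"
      using QP.resample_energy_gap_small[OF \<eta>] by blast
    have "M.variance (\<lambda>\<omega>. gap n m (\<lambda>i. X i \<omega>) (\<lambda>j. Y j \<omega>)) \<le> \<eta> / real n + \<eta> / real m"
      if n: "n \<ge> max N1 N2" and m: "m \<ge> max N1 N2" for n m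
    proof -
      have nm: "n \<ge> 1" "m \<ge> 1" using n m N1(1) by auto
      have "ennreal (M.variance (\<lambda>\<omega>. gap n m (\<lambda>i. X i \<omega>) (\<lambda>j. Y j \<omega>))) \<le> resample_energy n m (gap n m) + QP.resample_energy m n (QP.gap m n)"
        using pos_var_le_resample_energy[OF gap_measurable, of n m] unfolding transfer(2)[OF nm] gap_swap[OF nm] .
      also have "\<dots> \<le> ennreal (\<eta> / real n) + ennreal (\<eta> / real m)"
        using N1(2)[of n m] N2(2)[of m n] n m by (intro add_mono) auto
      also have "\<dots> = ennreal (\<eta> / real n + \<eta> / real m)" using \<eta> by (simp flip: ennreal_plus)
      finally show ?thesis using \<eta> by (subst (asm) ennreal_le_iff) auto
    qed
    then show ?thesis using N1(1) by (intro exI[of _ "max N1 N2"]) auto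
  qed
qed

theorem theorem3p3:
  fixes P Q :: "(real ^ 'd) measure"
    and M :: "'w measure"
    and X Y :: "nat \<Rightarrow> 'w \<Rightarrow> real ^ 'd"
  assumes P: "prob_space P" "sets P = sets borel"
    and Q: "prob_space Q" "sets Q = sets borel"
    and M: "prob_space M"
    and X_indep: "prob_space.indep_vars M (\<lambda>_. borel) X UNIV"
    and X_law: "\<And>i. distr M borel (X i) = P"
    and Y_indep: "prob_space.indep_vars M (\<lambda>_. borel) Y UNIV"
    and Y_law: "\<And>j. distr M borel (Y j) = Q"
    and XY_indep: "prob_space.indep_var M
          (\<Pi>\<^sub>M i\<in>UNIV. borel) (\<lambda>\<omega> i. X i \<omega>) (\<Pi>\<^sub>M j\<in>UNIV. borel) (\<lambda>\<omega> j. Y j \<omega>)"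
  shows
    "(has_lebesgue_density P \<and> has_lebesgue_density Q \<and>
      integrable P (\<lambda>x. norm x ^ 4) \<and> integrable Q (\<lambda>y. norm y ^ 4)
      \<longrightarrow>
      (let C_PQ = 8 * (prob_space.expectation M (\<lambda>\<omega>. norm (X 0 \<omega> - X 1 \<omega>) ^ 2 * norm (X 0 \<omega>) ^ 2)
             + sqrt (prob_space.expectation M (\<lambda>\<omega>. norm (X 0 \<omega> - X 1 \<omega>) ^ 4))
               * sqrt (\<integral>y. norm y ^ 4 \<partial>Q));
           C_QP = 8 * (prob_space.expectation M (\<lambda>\<omega>. norm (Y 0 \<omega> - Y 1 \<omega>) ^ 2 * norm (Y 0 \<omega>) ^ 2)
             + sqrt (prob_space.expectation M (\<lambda>\<omega>. norm (Y 0 \<omega> - Y 1 \<omega>) ^ 4))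
               * sqrt (\<integral>x. norm x ^ 4 \<partial>P))
       in \<forall>n\<ge>1. \<forall>m\<ge>1.
            square_integrable M (\<lambda>\<omega>. empirical_W n m (\<lambda>i. X i \<omega>) (\<lambda>j. Y j \<omega>)) \<and>
            prob_space.variance M (\<lambda>\<omega>. empirical_W n m (\<lambda>i. X i \<omega>) (\<lambda>j. Y j \<omega>))
              \<le> C_PQ / real n + C_QP / real m))
     \<and>
     (\<forall>\<delta> \<phi>0. positive_density_in_interior P \<and> positive_density_in_interior Q \<and>
      \<delta> > 0 \<and> integrable P (\<lambda>x. norm x powr (4 + \<delta>)) \<and> integrable Q (\<lambda>y. norm y powr (4 + \<delta>)) \<and>
      ot_potential P Q \<phi>0
      \<longrightarrow>
      (\<forall>n\<ge>1. \<forall>m\<ge>1.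
         square_integrable M (\<lambda>\<omega>. ot_remainder \<phi>0 n m (\<lambda>i. X i \<omega>) (\<lambda>j. Y j \<omega>))) \<and>
      (\<forall>(n :: nat \<Rightarrow> nat) (m :: nat \<Rightarrow> nat) (\<theta> :: real).
         filterlim n at_top sequentially \<and> filterlim m at_top sequentially \<and>
         (\<lambda>k. real (n k) / (real (n k) + real (m k))) \<longlonglongrightarrow> \<theta> \<and> 0 < \<theta> \<and> \<theta> < 1
         \<longrightarrow>
         (\<lambda>k. real (n k) * real (m k) / (real (n k) + real (m k))
            * prob_space.variance M
                (\<lambda>\<omega>. ot_remainder \<phi>0 (n k) (m k) (\<lambda>i. X i \<omega>) (\<lambda>j. Y j \<omega>)))
         \<longlonglongrightarrow> 0))"
proof (rule conjI)
  have two: "two_samples P Q"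
    unfolding two_samples_def two_samples_axioms_def using P Q by blast
  show "has_lebesgue_density P \<and> has_lebesgue_density Q \<and>
      integrable P (\<lambda>x. norm x ^ 4) \<and> integrable Q (\<lambda>y. norm y ^ 4)
      \<longrightarrow>
      (let C_PQ = 8 * (prob_space.expectation M (\<lambda>\<omega>. norm (X 0 \<omega> - X 1 \<omega>) ^ 2 * norm (X 0 \<omega>) ^ 2)
             + sqrt (prob_space.expectation M (\<lambda>\<omega>. norm (X 0 \<omega> - X 1 \<omega>) ^ 4))
               * sqrt (\<integral>y. norm y ^ 4 \<partial>Q));
           C_QP = 8 * (prob_space.expectation M (\<lambda>\<omega>. norm (Y 0 \<omega> - Y 1 \<omega>) ^ 2 * norm (Y 0 \<omega>) ^ 2)
             + sqrt (prob_space.expectation M (\<lambda>\<omega>. norm (Y 0 \<omega> - Y 1 \<omega>) ^ 4))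
               * sqrt (\<integral>x. norm x ^ 4 \<partial>P))
       in \<forall>n\<ge>1. \<forall>m\<ge>1.
            square_integrable M (\<lambda>\<omega>. empirical_W n m (\<lambda>i. X i \<omega>) (\<lambda>j. Y j \<omega>)) \<and>
            prob_space.variance M (\<lambda>\<omega>. empirical_W n m (\<lambda>i. X i \<omega>) (\<lambda>j. Y j \<omega>))
              \<le> C_PQ / real n + C_QP / real m)"
    unfolding Let_def
    by (intro impI allI conjI variance_empirical_W_le[OF two M X_indep X_law Y_indep Y_law XY_indep]) auto
next
  show "\<forall>\<delta> \<phi>0. positive_density_in_interior P \<and> positive_density_in_interior Q \<and>
      \<delta> > 0 \<and> integrable P (\<lambda>x. norm x powr (4 + \<delta>)) \<and> integrable Q (\<lambda>y. norm y powr (4 + \<delta>)) \<and>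
      ot_potential P Q \<phi>0
      \<longrightarrow>
      (\<forall>n\<ge>1. \<forall>m\<ge>1.
         square_integrable M (\<lambda>\<omega>. ot_remainder \<phi>0 n m (\<lambda>i. X i \<omega>) (\<lambda>j. Y j \<omega>))) \<and>
      (\<forall>(n :: nat \<Rightarrow> nat) (m :: nat \<Rightarrow> nat) (\<theta> :: real).
         filterlim n at_top sequentially \<and> filterlim m at_top sequentially \<and>
         (\<lambda>k. real (n k) / (real (n k) + real (m k))) \<longlonglongrightarrow> \<theta> \<and> 0 < \<theta> \<and> \<theta> < 1
         \<longrightarrow>
         (\<lambda>k. real (n k) * real (m k) / (real (n k) + real (m k))
            * prob_space.variance M
                (\<lambda>\<omega>. ot_remainder \<phi>0 (n k) (m k) (\<lambda>i. X i \<omega>) (\<lambda>j. Y j \<omega>)))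
         \<longlonglongrightarrow> 0)"
  proof (intro allI impI)
    fix \<delta> :: real and \<phi>0 :: "real ^ 'd \<Rightarrow> ereal"
    assume H: "positive_density_in_interior P \<and> positive_density_in_interior Q \<and>
      \<delta> > 0 \<and> integrable P (\<lambda>x. norm x powr (4 + \<delta>)) \<and> integrable Q (\<lambda>y. norm y powr (4 + \<delta>)) \<and>
      ot_potential P Q \<phi>0"
    define f where "f = (\<lambda>x. real_of_ereal (\<phi>0 x))"
    define g where "g = (\<lambda>y. real_of_ereal (conjugate \<phi>0 y))"
    have P4: "integrable P (\<lambda>x. norm x ^ 4)" using H integrable_norm_power4[OF P] by blast
    have Q4: "integrable Q (\<lambda>y. norm y ^ 4)" using H integrable_norm_power4[OF Q] by blast
    obtain A B where reg: "regular_potentials P Q f g A B (interior (convex_support P))"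
        "regular_potentials Q P g f B A (interior (convex_support Q))"
      using ot_potential_regular[OF P Q _ _ P4 Q4, of \<phi>0] H unfolding f_def g_def by blast
    interpret R: regular_potentials P Q f g A B "interior (convex_support P)" by (rule reg(1))
    interpret M: prob_space M by (rule M)
    note var = variance_gap[OF reg M X_indep X_law Y_indep Y_law XY_indep]
    let ?G = "\<lambda>n m \<omega>. R.gap n m (\<lambda>i. X i \<omega>) (\<lambda>j. Y j \<omega>)"
    let ?R = "\<lambda>n m \<omega>. ot_remainder \<phi>0 n m (\<lambda>i. X i \<omega>) (\<lambda>j. Y j \<omega>)"
    note rem = R.ot_remainder_eq[OF _ _ f_def g_def]
    have varR: "M.variance (?R n m) = 4 * M.variance (?G n m)" if "n \<ge> 1" "m \<ge> 1" for n m
    proof -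
      have "(2 * ?G n m \<omega> - M.expectation (\<lambda>\<omega>. 2 * ?G n m \<omega>))\<^sup>2 = 4 * (?G n m \<omega> - M.expectation (?G n m))\<^sup>2" for \<omega>
      proof -
        have "M.expectation (\<lambda>\<omega>. 2 * ?G n m \<omega>) = 2 * M.expectation (?G n m)" by simp
        then show ?thesis by (simp only: power2_eq_square) (simp add: algebra_simps)
      qed
      then show ?thesis unfolding rem[OF that] by simp
    qed
    have sq: "square_integrable M (?R n m)" if "n \<ge> 1" "m \<ge> 1" for n m
      using var(1)[OF that] unfolding rem[OF that] square_integrable_def by (auto simp: power_mult_distrib)
    have lim: "(\<lambda>k. real (n k) * real (m k) / (real (n k) + real (m k)) * M.variance (?R (n k) (m k))) \<longlonglongrightarrow> 0"
      if n: "filterlim n at_top sequentially" and m: "filterlim m at_top sequentially" for n m :: "nat \<Rightarrow> nat"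
    proof (rule tendstoI)
      fix e :: real assume e: "e > 0"
      \<comment> \<open>The prefactor is the reciprocal of \<open>1 / n + 1 / m\<close>, so a bound
        \<open>\<eta> / n + \<eta> / m\<close> turns into \<open>\<eta>\<close>. With
        \<open>\<eta> = e / 8\<close> and the factor 4 from \<open>varR\<close> this gives
        \<open>e / 2\<close>.\<close>
      then have "e / 8 > 0" by simp
      from var(2)[OF this] obtain N0 where N0: "N0 \<ge> 1"
        "\<And>n m. n \<ge> N0 \<Longrightarrow> m \<ge> N0 \<Longrightarrow> M.variance (?G n m) \<le> e / 8 / real n + e / 8 / real m" by blast
      have "\<forall>\<^sub>F k in sequentially. N0 \<le> n k" "\<forall>\<^sub>F k in sequentially. N0 \<le> m k"
        using n m by (simp_all add: filterlim_at_top)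
      then show "\<forall>\<^sub>F k in sequentially. dist (real (n k) * real (m k) / (real (n k) + real (m k)) * M.variance (?R (n k) (m k))) 0 < e"
      proof eventually_elim
        case (elim k)
        let ?n = "real (n k)" and ?m = "real (m k)" and ?V = "M.variance (?G (n k) (m k))"
        have pos: "?n > 0" "?m > 0" and nm: "n k \<ge> 1" "m k \<ge> 1" using elim N0(1) by auto
        have V0: "0 \<le> ?V" by (rule M.variance_positive)
        have V: "?V \<le> e / 8 / ?n + e / 8 / ?m" using N0(2) elim by blast
        have "?n * ?m / (?n + ?m) * (4 * ?V) \<le> ?n * ?m / (?n + ?m) * (4 * (e / 8 / ?n + e / 8 / ?m))"
          using V pos by (intro mult_left_mono) auto
        also have "\<dots> = e / 2"
        proof -
          have "a * b / (a + b) * (4 * (e / 8 / a + e / 8 / b)) = e / 2" if "a > 0" "b > 0" for a b :: real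
          proof -
            have "e / 8 / a + e / 8 / b = e / 8 * ((a + b) / (a * b))" using that by (simp add: field_simps)
            then show ?thesis using that by simp
          qed
          then show ?thesis using pos by blast
        qed
        finally have "?n * ?m / (?n + ?m) * (4 * ?V) < e" using e by simp
        moreover have "0 \<le> ?n * ?m / (?n + ?m) * (4 * ?V)" using V0 pos by simp
        ultimately show ?case unfolding varR[OF nm] dist_real_def by (simp only: diff_zero abs_of_nonneg)
      qed
    qed
    show "(\<forall>n\<ge>1. \<forall>m\<ge>1. square_integrable M (?R n m)) \<and>
      (\<forall>(n :: nat \<Rightarrow> nat) (m :: nat \<Rightarrow> nat) (\<theta> :: real).
         filterlim n at_top sequentially \<and> filterlim m at_top sequentially \<and>
         (\<lambda>k. real (n k) / (real (n k) + real (m k))) \<longlonglongrightarrow> \<theta> \<and> 0 < \<theta> \<and> \<theta> < 1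
         \<longrightarrow> (\<lambda>k. real (n k) * real (m k) / (real (n k) + real (m k)) * M.variance (?R (n k) (m k))) \<longlonglongrightarrow> 0)"
      using sq lim by blast
  qed
qed

end
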